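(* Statements (i) and (ii) below are equivalent. (i) (Jump process condition) There exists an event of full $\mathbb P$-probability on which, for all $x,y\in\mathbb Z^2$, every point of $\operatorname{supp}\mu_{x,y}$ is isolated. (ii) With $\mathbb P$-probability one: for all $x,y\in\mathbb Z^2$, all $\xi\in\operatorname{ri}\mathcal U$, and both signs $\sigma\in\{-,+\}$, the geodesics $\gamma^{x,\xi\sigma}$ and $\gamma^{y,\xi\sigma}$ coalesce.
   Context: Directions. $e_1=e_+=(1,0)$, $e_2=e_-=(0,1)$, $\hat e=e_1+e_2$. $\mathcal U=\{te_1+(1-t)e_2:0\le t\le1\}$, $\operatorname{ri}\mathcal U=\mathcal U\setminus\{e_1,e_2\}$. For $\zeta,\eta\in\mathbb R^2$ with $\zeta\cdot\hat e=\eta\cdot\hat e$, $\zeta\prec\eta$ (resp. $\zeta\preceq\eta$) means $\zeta\cdot e_1<\eta\cdot e_1$ (resp. $\le$). Intervals $[\zeta,\eta]$, $]\zeta,\eta[$ etc. in $\mathcal U$ and monotone limits $\zeta\nearrow\xi$, $\zeta\searrow\xi$ refer to this order. Vector inequalities $x\le y$, $x<y$ are coordinatewise. $\sigma$ denotes a sign in $\{-,+\}$. Last-passage percolation. $(\Omega,\mathcal F,\mathbb P)$ is a Polish probability space with a group $\{T_x\}_{x\in\mathbb Z^2}$ of measurable $\mathbb P$-preserving bijections ($T_0=$ identity, $T_xT_y=T_{x+y}$) and real random variables (weights) $\omega_x$, $x\in\mathbb Z^2$, with $\omega_y(T_x\omega)=\omega_{x+y}(\omega)$, that are i.i.d. with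 continuous distribution, positive variance, and $\mathbb E|\omega_0|^p<\infty$ for some $p>2$. An up-right path has steps in $\{e_1,e_2\}$ and is indexed so that $\pi_k\cdot\hat e=k$. For $x\le y$, $k=x\cdot\hat e$, $m=y\cdot\hat e$, $G_{x,y}=\max\sum_{i=k}^{m-1}\omega_{\pi_i}$ over up-right paths from $x$ to $y$; a maximizer is a (finite) geodesic (a.s. unique). The shape function is the deterministic, concave, symmetric, 1-homogeneous $g:\mathbb R_+^2\to\mathbb R$ with a.s. $\lim_n\max_{x\in\mathbb Z_+^2,|x|_1=n}|G_{0,x}-g(x)|/n=0$. For $\xi\in\operatorname{ri}\mathcal U$: $\nabla g(\xi\pm)\cdot e_1=\lim_{\varepsilon\searrow0}\frac{g(\xi\pm\varepsilon e_1)-g(\xi)}{\pm\varepsilon}$, $\nabla g(\xi\pm)\cdot e_2=\lim_{\varepsilon\searrow0}\frac{g(\xi\mp\varepsilon e_2)-g(\xi)}{\mp\varepsilon}$. $\mathcal D=\{\xi\in\operatorname{ri}\mathcal U: g\text{ differentiable at }\xi\}$. $\mathcal U_{\xi\sigma}=\{\zeta\in\operatorname{ri}\mathcal U:g(\zeta)-g(\xi)=\nabla g(\xi\sigma)\cdot(\zeta-\xi)\}$, $\mathcal U_\xi=\mathcal U_{\xi-}\cup\mathcal U_{\xi+}=[\underline\xi,\overline\xi]$. Busemann process. On $\Omega$ there is a fixed family of real random variables $B^{\xi\sigma}(x,y)=B^{\xi\sigma}_{x,y}$ ($x,y\in\mathbb Z^2$, $\xi\in\operatorname{ri}\mathcal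 U$, $\sigma\in\{-,+\}$), measurable in $(x,y,\omega,\xi)$, constructed in earlier work, with these properties. (B1) On one $T$-invariant event of probability one, for all $x,y,z,\xi,\sigma$: $B^{\xi\sigma}(x+z,y+z,\omega)=B^{\xi\sigma}(x,y,T_z\omega)$; $B^{\xi\sigma}(x,y)+B^{\xi\sigma}(y,z)=B^{\xi\sigma}(x,z)$; $\min_{i}B^{\xi\sigma}(x,x+e_i)=\omega_x$; for $\xi\prec\xi'$, $B^{\xi-}(x,x+e_1)\ge B^{\xi+}(x,x+e_1)\ge B^{\xi'-}(x,x+e_1)\ge B^{\xi'+}(x,x+e_1)$ and the reversed inequalities with $e_2$ in place of $e_1$; $B^{\xi-}(x,y)=\lim_{\zeta\nearrow\xi}B^{\zeta\sigma}(x,y)$ and $B^{\xi+}(x,y)=\lim_{\zeta\searrow\xi}B^{\zeta\sigma}(x,y)$; $B^{\xi\sigma}(x,x+e_i)\to\infty$ as $\xi\to e_{3-i}$. (B2) $B^{\xi\sigma}(x,y)$ is integrable and $\mathbb E[B^{\xi\sigma}(x,x+e_i)]=\nabla g(\xi\sigma)\cdot e_i$. (B3) If $\nabla g(\zeta\sigma)=\nabla g(\eta\sigma)$ then $B^{\zeta\sigma}\equiv B^{\eta\sigma}$. (B4) For any $I\subset\mathbb Z^2$, $\{(\omega_x,B^{\xi\sigma}(x,y)):x\in I,y\ge x,\sigma,\xi\}$ is independent of $\{\omega_x: x\not\ge z\ \forall z\in I\}$. (B5) For each fixed $\xi$, a.s.: $B^{\xi\sigma}(x,x+e_1)\ne B^{\xi\sigma}(x,x+e_2)$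 for all $x,\sigma$; $n^{-1}\max_{x\in\mathbb Z_+^2,|x|_1=n}|B^{\xi\sigma}(0,x)-x\cdot\nabla g(\xi\sigma)|\to0$; if $\xi\in\mathcal D$ then $B^{\xi+}=B^{\xi-}$; if $\xi,\underline\xi,\overline\xi\in\mathcal D$ then $B^{\xi\pm}(x,y)=\lim_n(G_{x,v_n}-G_{y,v_n})$ whenever $|v_n|\to\infty$, $v_n/n\to\xi$. Busemann geodesics. $\gamma^{x,\xi\sigma}$ starts at $x$ and from its current point $z$ steps to $z+e_1$ if $B^{\xi\sigma}(z,z+e_1)<B^{\xi\sigma}(z,z+e_2)$, to $z+e_2$ if $>$ holds, and to $z+e_\sigma$ if equality holds; a.s. all its finite segments are geodesics. Two semi-infinite paths $\pi,\pi'$ coalesce if there is $k$ with $\pi_n=\pi'_n$ for all $n\ge k$. Busemann measures. For $x,y\in\mathbb Z^2$ and a compact interval $K\subset\operatorname{ri}\mathcal U$, $\mu^K_{x,y}$ is the signed measure on $K$ with $\mu^K_{x,y}(]\zeta,\eta])=B^{\eta+}_{x,y}-B^{\zeta+}_{x,y}$ and $\mu^K_{x,y}([\zeta,\eta[)=B^{\eta-}_{x,y}-B^{\zeta-}_{x,y}$ for $\zeta\prec\eta$, $[\zeta,\eta]\subset K$. $\operatorname{supp}\mu_{x,y}=\bigcup_{\zeta\prec\eta\text{ in }\operatorname{ri}\mathcal U}\operatorname{supp}\mu^{[\zeta,\eta]}_{x,y}$, where the support of a signed measure is the smallest closed set whose complement has zero total variation measure. *)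

theory Defs
  imports "HOL-Probability.Probability"
begin

section \<open>Directions\<close>

text \<open>Order relations on \<^typ>\<open>int \<times> int\<close> and \<^typ>\<open>real \<times> real\<close> are the coordinatewise ones
  of \<^theory>\<open>HOL-Library.Product_Order\<close>.\<close>

type_synonym site = "int \<times> int"
type_synonym direction = "real \<times> real"

datatype sign = Minus | Plus

primrec sign_val :: "sign \<Rightarrow> real" where
  "sign_val Minus = - 1"
| "sign_val Plus = 1"

text \<open>The basis vectors are needed both in the lattice and in the plane.\<close>

definition e\<^sub>1 :: "'a::zero_neq_one \<times> 'a" where "e\<^sub>1 = (1, 0)"
definition e\<^sub>2 :: "'a::zero_neq_one \<times> 'a" where "e\<^sub>2 = (0, 1)"

primrec e_sign :: "sign \<Rightarrow> 'a::zero_neq_one \<times> 'a" where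
  "e_sign Minus = e\<^sub>2"
| "e_sign Plus = e\<^sub>1"

definition e_hat :: direction where "e_hat = e\<^sub>1 + e\<^sub>2"

definition site_vec :: "site \<Rightarrow> direction" where
  "site_vec x = (real_of_int (fst x), real_of_int (snd x))"

definition dirs :: "direction set" where
  "dirs = {t *\<^sub>R e\<^sub>1 + (1 - t) *\<^sub>R e\<^sub>2 | t. 0 \<le> t \<and> t \<le> 1}"

definition ri_dirs :: "direction set" where
  "ri_dirs = dirs - {e\<^sub>1, e\<^sub>2}"

definition dir_less :: "direction \<Rightarrow> direction \<Rightarrow> bool" (infix \<open>\<prec>\<close> 50) where
  "\<zeta> \<prec> \<eta> \<longleftrightarrow> \<zeta> \<bullet> e_hat = \<eta> \<bullet> e_hat \<and> \<zeta> \<bullet> e\<^sub>1 < \<eta> \<bullet> e\<^sub>1"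

definition dir_le :: "direction \<Rightarrow> direction \<Rightarrow> bool" (infix \<open>\<preceq>\<close> 50) where
  "\<zeta> \<preceq> \<eta> \<longleftrightarrow> \<zeta> \<bullet> e_hat = \<eta> \<bullet> e_hat \<and> \<zeta> \<bullet> e\<^sub>1 \<le> \<eta> \<bullet> e\<^sub>1"

definition dir_Icc :: "direction \<Rightarrow> direction \<Rightarrow> direction set" where
  "dir_Icc \<zeta> \<eta> = {\<xi> \<in> dirs. \<zeta> \<preceq> \<xi> \<and> \<xi> \<preceq> \<eta>}"

definition dir_Ioc :: "direction \<Rightarrow> direction \<Rightarrow> direction set" where
  "dir_Ioc \<zeta> \<eta> = {\<xi> \<in> dirs. \<zeta> \<prec> \<xi> \<and> \<xi> \<preceq> \<eta>}"

definition dir_Ico :: "direction \<Rightarrow> direction \<Rightarrow> direction set" where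
  "dir_Ico \<zeta> \<eta> = {\<xi> \<in> dirs. \<zeta> \<preceq> \<xi> \<and> \<xi> \<prec> \<eta>}"

text \<open>The filters of the limits \<open>\<zeta> \<nearrow> \<xi>\<close> and \<open>\<zeta> \<searrow> \<xi>\<close>.\<close>

definition dir_at_left :: "direction \<Rightarrow> direction filter" where
  "dir_at_left \<xi> = at \<xi> within {\<zeta> \<in> ri_dirs. \<zeta> \<prec> \<xi>}"

definition dir_at_right :: "direction \<Rightarrow> direction filter" where
  "dir_at_right \<xi> = at \<xi> within {\<zeta> \<in> ri_dirs. \<xi> \<prec> \<zeta>}"


section \<open>Last-passage percolation\<close>

text \<open>The product of \<open>x\<close> with \<open>(1, 1)\<close>.\<close>

definition level :: "site \<Rightarrow> int" where
  "level x = fst x + snd x"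

text \<open>Paths are indexed by level, i.e. \<open>\<pi> k\<close> has level \<open>k\<close>; values of \<open>\<pi>\<close> at indices outside
  \<open>{level x..level y}\<close> are irrelevant.\<close>

definition up_right_paths :: "site \<Rightarrow> site \<Rightarrow> (int \<Rightarrow> site) set" where
  "up_right_paths x y = {\<pi>. \<pi> (level x) = x \<and> \<pi> (level y) = y \<and>
     (\<forall>i\<in>{level x..<level y}. \<pi> (i + 1) - \<pi> i \<in> {e\<^sub>1, e\<^sub>2})}"

text \<open>The first argument of \<open>last_passage\<close> is a realization of the weights.
  Only meaningful for \<open>x \<le> y\<close>.\<close>

definition last_passage :: "(site \<Rightarrow> real) \<Rightarrow> site \<Rightarrow> site \<Rightarrow> real" where
  "last_passage v x y =
     Max ((\<lambda>\<pi>. \<Sum>i = level x..<level y. v (\<pi> i)) ` up_right_paths x y)"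

definition antidiagonal :: "nat \<Rightarrow> site set" where
  "antidiagonal n = {x. 0 \<le> x \<and> \<bar>fst x\<bar> + \<bar>snd x\<bar> = int n}"

definition shape_grad :: "(direction \<Rightarrow> real) \<Rightarrow> direction \<Rightarrow> sign \<Rightarrow> direction" where
  "shape_grad g \<xi> \<sigma> = (let s = sign_val \<sigma> in
     (Lim (at_right 0) (\<lambda>\<epsilon>. (g (\<xi> + (s * \<epsilon>) *\<^sub>R e\<^sub>1) - g \<xi>) / (s * \<epsilon>)),
      Lim (at_right 0) (\<lambda>\<epsilon>. (g (\<xi> - (s * \<epsilon>) *\<^sub>R e\<^sub>2) - g \<xi>) / (- (s * \<epsilon>)))))"

definition diff_dirs :: "(direction \<Rightarrow> real) \<Rightarrow> direction set" where
  "diff_dirs g = {\<xi> \<in> ri_dirs. g differentiable (at \<xi>)}"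

definition linear_seg_side :: "(direction \<Rightarrow> real) \<Rightarrow> direction \<Rightarrow> sign \<Rightarrow> direction set" where
  "linear_seg_side g \<xi> \<sigma> = {\<zeta> \<in> ri_dirs. g \<zeta> - g \<xi> = shape_grad g \<xi> \<sigma> \<bullet> (\<zeta> - \<xi>)}"

definition linear_seg :: "(direction \<Rightarrow> real) \<Rightarrow> direction \<Rightarrow> direction set" where
  "linear_seg g \<xi> = linear_seg_side g \<xi> Minus \<union> linear_seg_side g \<xi> Plus"

definition seg_left :: "(direction \<Rightarrow> real) \<Rightarrow> direction \<Rightarrow> direction" where
  "seg_left g \<xi> = (THE \<zeta>. \<zeta> \<in> linear_seg g \<xi> \<and> (\<forall>\<eta>\<in>linear_seg g \<xi>. \<zeta> \<preceq> \<eta>))"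

definition seg_right :: "(direction \<Rightarrow> real) \<Rightarrow> direction \<Rightarrow> direction" where
  "seg_right g \<xi> = (THE \<zeta>. \<zeta> \<in> linear_seg g \<xi> \<and> (\<forall>\<eta>\<in>linear_seg g \<xi>. \<eta> \<preceq> \<zeta>))"

definition generated_sets :: "'w measure \<Rightarrow> ('w \<Rightarrow> real) set \<Rightarrow> 'w set set" where
  "generated_sets M F = sigma_sets (space M) {X -` A \<inter> space M | X A. X \<in> F \<and> A \<in> sets borel}"

text \<open>\<open>T\<close> is the shift group and \<open>w x\<close> the weight at \<open>x\<close>. The Polish structure is that of the
  type; \<open>M\<close> is a probability measure on its Borel sets.\<close>

locale lpp_environment = prob_space M for M :: "'w::polish_space measure" +
  fixes T :: "site \<Rightarrow> 'w \<Rightarrow> 'w"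
    and w :: "site \<Rightarrow> 'w \<Rightarrow> real"
  assumes sets_M: "sets M = sets borel"
    and T_bij: "bij (T x)"
    and T_measurable: "T x \<in> measurable M M"
    and T_preserving: "distr M M (T x) = M"
    and T_zero: "T 0 = id"
    and T_add: "T x \<circ> T y = T (x + y)"
    and weight_shift: "w y (T x \<omega>) = w (x + y) \<omega>"
    and weight_indep: "indep_vars (\<lambda>_. borel) w UNIV"
    and weight_identical: "distr M borel (w x) = distr M borel (w y)"
    and weight_continuous: "continuous_on UNIV (cdf (distr M borel (w 0)))"
    and weight_variance: "variance (w 0) > 0"
    and weight_moment: "\<exists>p>2. integrable M (\<lambda>\<omega>. \<bar>w 0 \<omega>\<bar> powr p)"

text \<open>\<open>g\<close> is the shape function; only its values on the closed first quadrant matter.\<close>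

locale lpp_shape = lpp_environment M T w
  for M :: "'w::polish_space measure" and T :: "site \<Rightarrow> 'w \<Rightarrow> 'w" and w :: "site \<Rightarrow> 'w \<Rightarrow> real" +
  fixes g :: "direction \<Rightarrow> real"
  assumes shape_concave: "concave_on {x. 0 \<le> x} g"
    and shape_symmetric: "0 \<le> a \<Longrightarrow> 0 \<le> b \<Longrightarrow> g (a, b) = g (b, a)"
    and shape_homogeneous: "0 \<le> c \<Longrightarrow> 0 \<le> x \<Longrightarrow> g (c *\<^sub>R x) = c * g x"
    and shape_limit: "AE \<omega> in M. (\<lambda>n.
      (MAX x\<in>antidiagonal n. \<bar>last_passage (\<lambda>z. w z \<omega>) 0 x - g (site_vec x)\<bar>) / real n)
        \<longlonglongrightarrow> 0"


section \<open>The Busemann process\<close>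

text \<open>\<open>B \<xi> \<sigma> x y \<omega>\<close> is only constrained for \<open>\<xi> \<in> ri_dirs\<close>. The properties that hold
  simultaneously on one shift-invariant event of full probability are collected in
  \<open>busemann_regular\<close>; those in \<open>B_no_ties\<close>, \<open>B_shape_limit\<close>, \<open>B_differentiable\<close> and
  \<open>B_limit\<close> below have exceptional null sets that depend on \<open>\<xi>\<close>.\<close>

definition busemann_regular ::
  "(site \<Rightarrow> 'w \<Rightarrow> 'w) \<Rightarrow> (site \<Rightarrow> 'w \<Rightarrow> real) \<Rightarrow>
   (direction \<Rightarrow> sign \<Rightarrow> site \<Rightarrow> site \<Rightarrow> 'w \<Rightarrow> real) \<Rightarrow> 'w \<Rightarrow> bool" where
  "busemann_regular T w B \<omega> \<longleftrightarrow>
    (\<forall>\<xi>\<in>ri_dirs. \<forall>\<sigma> x y z. B \<xi> \<sigma> (x + z) (y + z) \<omega> = B \<xi> \<sigma> x y (T z \<omega>)) \<and>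
    (\<forall>\<xi>\<in>ri_dirs. \<forall>\<sigma> x y z. B \<xi> \<sigma> x y \<omega> + B \<xi> \<sigma> y z \<omega> = B \<xi> \<sigma> x z \<omega>) \<and>
    (\<forall>\<xi>\<in>ri_dirs. \<forall>\<sigma> x. min (B \<xi> \<sigma> x (x + e\<^sub>1) \<omega>) (B \<xi> \<sigma> x (x + e\<^sub>2) \<omega>) = w x \<omega>) \<and>
    (\<forall>\<xi>\<in>ri_dirs. \<forall>\<xi>'\<in>ri_dirs. \<forall>x. \<xi> \<prec> \<xi>' \<longrightarrow>
       B \<xi> Minus x (x + e\<^sub>1) \<omega> \<ge> B \<xi> Plus x (x + e\<^sub>1) \<omega> \<and>
       B \<xi> Plus x (x + e\<^sub>1) \<omega> \<ge> B \<xi>' Minus x (x + e\<^sub>1) \<omega> \<and>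
       B \<xi>' Minus x (x + e\<^sub>1) \<omega> \<ge> B \<xi>' Plus x (x + e\<^sub>1) \<omega> \<and>
       B \<xi> Minus x (x + e\<^sub>2) \<omega> \<le> B \<xi> Plus x (x + e\<^sub>2) \<omega> \<and>
       B \<xi> Plus x (x + e\<^sub>2) \<omega> \<le> B \<xi>' Minus x (x + e\<^sub>2) \<omega> \<and>
       B \<xi>' Minus x (x + e\<^sub>2) \<omega> \<le> B \<xi>' Plus x (x + e\<^sub>2) \<omega>) \<and>
    (\<forall>\<xi>\<in>ri_dirs. \<forall>\<sigma> x y.
       ((\<lambda>\<zeta>. B \<zeta> \<sigma> x y \<omega>) \<longlongrightarrow> B \<xi> Minus x y \<omega>) (dir_at_left \<xi>) \<and>
       ((\<lambda>\<zeta>. B \<zeta> \<sigma> x y \<omega>) \<longlongrightarrow> B \<xi> Plus x y \<omega>) (dir_at_right \<xi>)) \<and>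
    (\<forall>\<sigma> x.
       filterlim (\<lambda>\<xi>. B \<xi> \<sigma> x (x + e\<^sub>1) \<omega>) at_top (at e\<^sub>2 within ri_dirs) \<and>
       filterlim (\<lambda>\<xi>. B \<xi> \<sigma> x (x + e\<^sub>2) \<omega>) at_top (at e\<^sub>1 within ri_dirs))"

locale busemann_process = lpp_shape M T w g
  for M :: "'w::polish_space measure" and T :: "site \<Rightarrow> 'w \<Rightarrow> 'w" and w :: "site \<Rightarrow> 'w \<Rightarrow> real"
    and g :: "direction \<Rightarrow> real" +
  fixes B :: "direction \<Rightarrow> sign \<Rightarrow> site \<Rightarrow> site \<Rightarrow> 'w \<Rightarrow> real"
  assumes B_measurable: "(\<lambda>(x, y, \<omega>, \<xi>). B \<xi> \<sigma> x y \<omega>) \<in> borel_measurable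
      (count_space UNIV \<Otimes>\<^sub>M count_space UNIV \<Otimes>\<^sub>M M \<Otimes>\<^sub>M restrict_space borel ri_dirs)"
    and B_regular: "\<exists>E\<in>events. prob E = 1 \<and> (\<forall>z. T z ` E = E) \<and>
      (\<forall>\<omega>\<in>E. busemann_regular T w B \<omega>)"
    and B_integrable: "\<xi> \<in> ri_dirs \<Longrightarrow> integrable M (B \<xi> \<sigma> x y)"
    and B_expectation_1: "\<xi> \<in> ri_dirs \<Longrightarrow>
      expectation (B \<xi> \<sigma> x (x + e\<^sub>1)) = shape_grad g \<xi> \<sigma> \<bullet> e\<^sub>1"
    and B_expectation_2: "\<xi> \<in> ri_dirs \<Longrightarrow>
      expectation (B \<xi> \<sigma> x (x + e\<^sub>2)) = shape_grad g \<xi> \<sigma> \<bullet> e\<^sub>2"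
    and B_flat: "AE \<omega> in M. \<forall>\<zeta>\<in>ri_dirs. \<forall>\<eta>\<in>ri_dirs. \<forall>\<sigma>.
      shape_grad g \<zeta> \<sigma> = shape_grad g \<eta> \<sigma> \<longrightarrow> (\<forall>x y. B \<zeta> \<sigma> x y \<omega> = B \<eta> \<sigma> x y \<omega>)"
    and B_indep: "indep_set
      (generated_sets M (w ` I \<union> {B \<xi> \<sigma> x y | \<xi> \<sigma> x y. \<xi> \<in> ri_dirs \<and> x \<in> I \<and> x \<le> y}))
      (generated_sets M {w x | x. \<forall>z\<in>I. \<not> z \<le> x})"
    and B_no_ties: "\<xi> \<in> ri_dirs \<Longrightarrow>
      AE \<omega> in M. \<forall>\<sigma> x. B \<xi> \<sigma> x (x + e\<^sub>1) \<omega> \<noteq> B \<xi> \<sigma> x (x + e\<^sub>2) \<omega>"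
    and B_shape_limit: "\<xi> \<in> ri_dirs \<Longrightarrow>
      AE \<omega> in M. \<forall>\<sigma>. (\<lambda>n.
        (MAX x\<in>antidiagonal n. \<bar>B \<xi> \<sigma> 0 x \<omega> - site_vec x \<bullet> shape_grad g \<xi> \<sigma>\<bar>) / real n)
          \<longlonglongrightarrow> 0"
    and B_differentiable: "\<xi> \<in> diff_dirs g \<Longrightarrow>
      AE \<omega> in M. \<forall>x y. B \<xi> Plus x y \<omega> = B \<xi> Minus x y \<omega>"
    and B_limit: "\<xi> \<in> diff_dirs g \<Longrightarrow> seg_left g \<xi> \<in> diff_dirs g \<Longrightarrow> seg_right g \<xi> \<in> diff_dirs g \<Longrightarrow>
      AE \<omega> in M. \<forall>\<sigma> x y. \<forall>v :: nat \<Rightarrow> site.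
        filterlim (\<lambda>n. norm (site_vec (v n))) at_top sequentially \<longrightarrow>
        (\<lambda>n. site_vec (v n) /\<^sub>R real n) \<longlonglongrightarrow> \<xi> \<longrightarrow>
        (\<lambda>n. last_passage (\<lambda>z. w z \<omega>) x (v n) - last_passage (\<lambda>z. w z \<omega>) y (v n))
          \<longlonglongrightarrow> B \<xi> \<sigma> x y \<omega>"


section \<open>Busemann geodesics\<close>

text \<open>From here on \<open>b\<close> is a realization of the Busemann process, \<open>b = (\<lambda>\<xi> \<sigma> x y. B \<xi> \<sigma> x y \<omega>)\<close>.\<close>

type_synonym busemann_realization = "direction \<Rightarrow> sign \<Rightarrow> site \<Rightarrow> site \<Rightarrow> real"

definition busemann_step ::
  "busemann_realization \<Rightarrow> direction \<Rightarrow> sign \<Rightarrow> site \<Rightarrow> site" where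
  "busemann_step b \<xi> \<sigma> z =
    (if b \<xi> \<sigma> z (z + e\<^sub>1) < b \<xi> \<sigma> z (z + e\<^sub>2) then z + e\<^sub>1
     else if b \<xi> \<sigma> z (z + e\<^sub>1) > b \<xi> \<sigma> z (z + e\<^sub>2) then z + e\<^sub>2
     else z + e_sign \<sigma>)"

text \<open>Indexed by level and meaningful at indices \<open>k \<ge> level x\<close>; below that the value is \<open>x\<close>,
  which does not affect coalescence.\<close>

definition busemann_geodesic ::
  "busemann_realization \<Rightarrow> site \<Rightarrow> direction \<Rightarrow> sign \<Rightarrow> int \<Rightarrow> site" where
  "busemann_geodesic b x \<xi> \<sigma> k = (busemann_step b \<xi> \<sigma> ^^ nat (k - level x)) x"

definition coalesce :: "(int \<Rightarrow> site) \<Rightarrow> (int \<Rightarrow> site) \<Rightarrow> bool" where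
  "coalesce \<pi> \<pi>' \<longleftrightarrow> (\<exists>k. \<forall>n\<ge>k. \<pi> n = \<pi>' n)"


section \<open>Busemann measures\<close>

text \<open>Finite signed measures on the measurable space underlying \<open>N\<close>. They are set functions made
  unique by the value 0 on non-measurable sets, as for \<^const>\<open>emeasure\<close>.\<close>

definition signed_measure_on :: "'a measure \<Rightarrow> ('a set \<Rightarrow> real) \<Rightarrow> bool" where
  "signed_measure_on N \<mu> \<longleftrightarrow>
     \<mu> {} = 0 \<and>
     (\<forall>A :: nat \<Rightarrow> 'a set. range A \<subseteq> sets N \<longrightarrow> disjoint_family A \<longrightarrow>
        (\<lambda>i. \<mu> (A i)) sums \<mu> (\<Union>i. A i)) \<and>
     (\<forall>A. A \<notin> sets N \<longrightarrow> \<mu> A = 0)"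

definition total_variation :: "'a measure \<Rightarrow> ('a set \<Rightarrow> real) \<Rightarrow> 'a set \<Rightarrow> ennreal" where
  "total_variation N \<mu> A =
     (SUP P\<in>{P. finite P \<and> P \<subseteq> sets N \<and> partition_on A P}. \<Sum>C\<in>P. ennreal \<bar>\<mu> C\<bar>)"

text \<open>\<open>K\<close> is closed and \<open>\<mu>\<close> lives on its Borel subsets. The least element is taken with respect to
  inclusion; it exists if the topology is second countable.\<close>

definition signed_support :: "'a::topological_space set \<Rightarrow> ('a set \<Rightarrow> real) \<Rightarrow> 'a set" where
  "signed_support K \<mu> =
     (LEAST C. closed C \<and> C \<subseteq> K \<and> total_variation (restrict_space borel K) \<mu> (K - C) = 0)"

definition busemann_measure ::
  "busemann_realization \<Rightarrow> site \<Rightarrow> site \<Rightarrow> direction set \<Rightarrow> direction set \<Rightarrow> real" where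
  "busemann_measure b x y K = (THE \<mu>.
     signed_measure_on (restrict_space borel K) \<mu> \<and>
     (\<forall>\<zeta>\<in>ri_dirs. \<forall>\<eta>\<in>ri_dirs. \<zeta> \<prec> \<eta> \<longrightarrow> dir_Icc \<zeta> \<eta> \<subseteq> K \<longrightarrow>
        \<mu> (dir_Ioc \<zeta> \<eta>) = b \<eta> Plus x y - b \<zeta> Plus x y \<and>
        \<mu> (dir_Ico \<zeta> \<eta>) = b \<eta> Minus x y - b \<zeta> Minus x y))"

definition busemann_support :: "busemann_realization \<Rightarrow> site \<Rightarrow> site \<Rightarrow> direction set" where
  "busemann_support b x y = \<Union> {signed_support (dir_Icc \<zeta> \<eta>) (busemann_measure b x y (dir_Icc \<zeta> \<eta>))
     | \<zeta> \<eta>. \<zeta> \<in> ri_dirs \<and> \<eta> \<in> ri_dirs \<and> \<zeta> \<prec> \<eta>}"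

end

theory Submission
  imports Defs
begin

text \<open>The support of the Busemann measure of \<open>(x, y)\<close> consists of the directions near which
  \<open>\<xi> \<mapsto> B\<^sup>\<xi>(x, y)\<close> is not locally constant, so the jump process condition says that this function is
  constant on a punctured neighbourhood of every direction.

  If the geodesics from \<open>x\<close> and \<open>y\<close> in direction \<open>\<xi>+\<close> meet, then for \<open>\<zeta>\<close> slightly to the right of
  \<open>\<xi>\<close> the \<open>\<zeta>\<close>-geodesics agree with them up to the meeting point (ties are excluded because there are
  none in rational directions), and \<open>B\<^sup>\<zeta>(x, y)\<close> is the same difference of path sums.

  Conversely let \<open>B\<^sup>\<zeta>(x, y) = B\<^sup>\<xi>(x, y)\<close> for a rational \<open>\<zeta>\<close> to the right of \<open>\<xi>\<close>, with
  \<open>x\<close> to the left of \<open>y\<close>. As the \<open>\<zeta>\<close>-geodesics coalesce and the \<open>\<xi>\<close>-geodesics lie to their left, the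
  \<open>\<zeta>\<close>-geodesic from \<open>x\<close> crosses the \<open>\<xi>\<close>-geodesic from \<open>y\<close>. Comparing path sums at the crossing shows
  that the \<open>\<zeta>\<close>-geodesic is also the \<open>\<xi>\<close>-geodesic from \<open>x\<close> up to there, so the \<open>\<xi>\<close>-geodesics meet.

  Coalescence in a fixed direction is an argument in the spirit of Burton and Keane. If it failed,
  neighbouring sites of an antidiagonal would be separated with a positive density that, by
  stationarity, is the same on all levels. Given the environment above level 0, the weights
  below it are independent of it, and with positive probability they prevent every path started \<open>N\<close>
  levels below from entering a block between two separations. Then two separations come from at most
  one, so the density strictly increases in \<open>N\<close> steps, a contradiction.\<close>

section \<open>Up-right paths and cocycles\<close>

definition up_right :: "(site \<Rightarrow> site) \<Rightarrow> bool" where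
  "up_right s \<longleftrightarrow> (\<forall>z. s z = z + e\<^sub>1 \<or> s z = z + e\<^sub>2)"

lemma up_rightD: "up_right s \<Longrightarrow> s z = z + e\<^sub>1 \<or> s z = z + e\<^sub>2"
  unfolding up_right_def by blast

text \<open>Two independent times, so that points on different levels can be compared. Orbits of one
  map stay together once they meet, which makes this an equivalence relation.\<close>

definition meets :: "('a \<Rightarrow> 'a) \<Rightarrow> 'a \<Rightarrow> 'a \<Rightarrow> bool" where
  "meets s x y \<longleftrightarrow> (\<exists>m n. (s ^^ m) x = (s ^^ n) y)"

lemma meets_refl: "meets s x x"
  unfolding meets_def by auto

lemma meets_sym: "meets s x y \<Longrightarrow> meets s y x"
  unfolding meets_def by metis

lemma meets_trans:
  assumes "meets s x y" "meets s y z" shows "meets s x z"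
proof -
  obtain m n m' n' where "(s ^^ m) x = (s ^^ n) y" "(s ^^ m') y = (s ^^ n') z"
    using assms unfolding meets_def by blast
  then have "(s ^^ (m' + m)) x = (s ^^ (m' + n)) y" "(s ^^ (n + m')) y = (s ^^ (n + n')) z"
    by (simp_all add: funpow_add)
  then have "(s ^^ (m' + m)) x = (s ^^ (n + n')) z" by (simp add: add.commute)
  then show ?thesis unfolding meets_def by blast
qed

lemma meets_funpow: "meets s x ((s ^^ n) x)"
  unfolding meets_def by (metis funpow_0)

lemma e1_simps [simp]: "fst e\<^sub>1 = 1" "snd e\<^sub>1 = 0" and e2_simps [simp]: "fst e\<^sub>2 = 0" "snd e\<^sub>2 = 1"
  by (simp_all add: e\<^sub>1_def e\<^sub>2_def)

lemma e1_neq_e2 [simp]: "(e\<^sub>1 :: site) \<noteq> e\<^sub>2"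
  by (simp add: prod_eq_iff)

lemma level_add [simp]: "level (x + y) = level x + level y"
  by (simp add: level_def)

lemma level_e [simp]: "level e\<^sub>1 = 1" "level e\<^sub>2 = 1"
  by (simp_all add: level_def)

lemma site_eqI: "level x = level y \<Longrightarrow> fst x = fst y \<Longrightarrow> x = y"
  by (simp add: level_def prod_eq_iff)

lemma level_funpow:
  assumes "up_right s" shows "level ((s ^^ n) x) = level x + int n"
proof (induction n)
  case (Suc n)
  then show ?case using up_rightD[OF assms, of "(s ^^ n) x"] by auto
qed simp

lemma fst_funpow_Suc:
  assumes "up_right s"
  shows "fst ((s ^^ Suc n) x) = fst ((s ^^ n) x) \<or> fst ((s ^^ Suc n) x) = fst ((s ^^ n) x) + 1"
  using up_rightD[OF assms, of "(s ^^ n) x"] by auto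

lemma fst_funpow_bounds:
  assumes "up_right s"
  shows "fst x \<le> fst ((s ^^ n) x) \<and> fst ((s ^^ n) x) \<le> fst x + int n"
proof (induction n)
  case (Suc n)
  then show ?case using fst_funpow_Suc[OF assms, of n x] by auto
qed simp

text \<open>Two paths on common levels can change sides only through a shared site, and there
  \<open>le\<close> prevents \<open>s\<close> from going right while \<open>s'\<close> goes
  up.\<close>

lemma funpow_ordered:
  assumes s: "up_right s" and s': "up_right s'"
    and le: "\<And>z. s z = z + e\<^sub>1 \<Longrightarrow> s' z = z + e\<^sub>1"
    and xy: "level x = level y" "fst x \<le> fst y"
  shows "fst ((s ^^ n) x) \<le> fst ((s' ^^ n) y)"
proof (induction n)
  case (Suc n)
  let ?p = "(s ^^ n) x" and ?q = "(s' ^^ n) y"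
  show ?case
  proof (cases "fst ?p = fst ?q")
    case True
    then have "?p = ?q" using xy by (intro site_eqI) (auto simp: level_funpow s s')
    then show ?thesis using up_rightD[OF s, of ?p] up_rightD[OF s', of ?p] le[of ?p] by auto
  next
    case False
    then show ?thesis using Suc fst_funpow_Suc[OF s, of n x] fst_funpow_Suc[OF s', of n y] by auto
  qed
qed (use xy in simp)

text \<open>A discrete intermediate value argument: the gap between the first coordinates shrinks by
  at most one per step, so at the first index where it is no longer positive it is zero.\<close>

lemma paths_cross:
  assumes s: "up_right s" and s': "up_right s'"
    and xy: "level x = level y" "fst x \<le> fst y"
    and N: "fst ((s' ^^ N) y) \<le> fst ((s ^^ N) x)"
  shows "\<exists>n. (s ^^ n) x = (s' ^^ n) y"
proof -
  define n where "n = (LEAST n. fst ((s' ^^ n) y) \<le> fst ((s ^^ n) x))"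
  have n: "fst ((s' ^^ n) y) \<le> fst ((s ^^ n) x)"
    unfolding n_def using N by (rule LeastI)
  have "fst ((s' ^^ n) y) = fst ((s ^^ n) x)"
  proof (cases n)
    case 0
    then show ?thesis using n xy by simp
  next
    case (Suc m)
    have "\<not> fst ((s' ^^ m) y) \<le> fst ((s ^^ m) x)"
      using not_less_Least[of m "\<lambda>n. fst ((s' ^^ n) y) \<le> fst ((s ^^ n) x)"] Suc
      unfolding n_def by simp
    then show ?thesis
      using n fst_funpow_Suc[OF s, of m x] fst_funpow_Suc[OF s', of m y]
      unfolding Suc by linarith
  qed
  then have "(s ^^ n) x = (s' ^^ n) y"
    using xy by (intro site_eqI) (auto simp: level_funpow s s')
  then show ?thesis by blast
qed

lemma meets_same_level:
  assumes "up_right s" "level x = level y" "meets s x y"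
  obtains n where "(s ^^ n) x = (s ^^ n) y"
proof -
  obtain m n where "(s ^^ m) x = (s ^^ n) y" using assms(3) unfolding meets_def by blast
  moreover from this have "m = n"
    using level_funpow[OF assms(1)] assms(2) by (metis add_left_cancel of_nat_eq_iff)
  ultimately show ?thesis using that by blast
qed

section \<open>Cocycles that recover the weights\<close>

definition recovers :: "(site \<Rightarrow> real) \<Rightarrow> (site \<Rightarrow> site \<Rightarrow> real) \<Rightarrow> bool" where
  "recovers v \<beta> \<longleftrightarrow> (\<forall>x y z. \<beta> x y + \<beta> y z = \<beta> x z) \<and>
     (\<forall>x. min (\<beta> x (x + e\<^sub>1)) (\<beta> x (x + e\<^sub>2)) = v x)"

lemma recovers_add: "recovers v \<beta> \<Longrightarrow> \<beta> x y + \<beta> y z = \<beta> x z"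
  unfolding recovers_def by blast

lemma recovers_refl: "recovers v \<beta> \<Longrightarrow> \<beta> x x = 0"
  using recovers_add[of v \<beta> x x x] by simp

lemma recovers_sym: "recovers v \<beta> \<Longrightarrow> \<beta> y x = - \<beta> x y"
  using recovers_add[of v \<beta> x y x] recovers_refl[of v \<beta> x] by simp

lemma recovers_ge:
  assumes "recovers v \<beta>" "y = x + e\<^sub>1 \<or> y = x + e\<^sub>2" shows "v x \<le> \<beta> x y"
proof -
  have "min (\<beta> x (x + e\<^sub>1)) (\<beta> x (x + e\<^sub>2)) = v x"
    using assms(1) unfolding recovers_def by blast
  then show ?thesis using assms(2) by (auto simp: min_def split: if_splits)
qed

text \<open>Every increment of \<beta> along an up-right step is at least the weight at its starting
  site. Paths that always take a minimizing increment turn this bound into the equality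
  \<open>path_sum_eq\<close>.\<close>

lemma path_sum_le:
  assumes "recovers v \<beta>" "up_right s"
  shows "(\<Sum>i<n. v ((s ^^ i) x)) \<le> \<beta> x ((s ^^ n) x)"
proof (induction n)
  case (Suc n)
  have "v ((s ^^ n) x) \<le> \<beta> ((s ^^ n) x) ((s ^^ Suc n) x)"
    using up_rightD[OF assms(2), of "(s ^^ n) x"] by (intro recovers_ge[OF assms(1)]) auto
  then show ?case using Suc recovers_add[OF assms(1), of x "(s ^^ n) x" "(s ^^ Suc n) x"] by simp
qed (simp add: recovers_refl[OF assms(1)])

lemma path_sum_eq:
  assumes "recovers v \<beta>" "\<And>z. \<beta> z (s z) = v z"
  shows "\<beta> x ((s ^^ n) x) = (\<Sum>i<n. v ((s ^^ i) x))"
proof (induction n)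
  case (Suc n)
  then show ?case
    using recovers_add[OF assms(1), of x "(s ^^ n) x" "(s ^^ Suc n) x"] assms(2)[of "(s ^^ n) x"]
    by simp
qed (simp add: recovers_refl[OF assms(1)])

text \<open>The bound of \<open>path_sum_le\<close> is a sum of stepwise bounds, so a path that
  attains it has no slack in any single step. In this way an equality between cocycle values yields
  information about a path.\<close>

lemma path_sum_tight:
  assumes "recovers v \<beta>" "up_right s"
    and "\<beta> x ((s ^^ n) x) \<le> (\<Sum>i<n. v ((s ^^ i) x))" "i < n"
  shows "\<beta> ((s ^^ i) x) ((s ^^ Suc i) x) = v ((s ^^ i) x)"
  using assms(3,4)
proof (induction n)
  case (Suc n)
  have ge: "v ((s ^^ n) x) \<le> \<beta> ((s ^^ n) x) ((s ^^ Suc n) x)"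
    using up_rightD[OF assms(2), of "(s ^^ n) x"] by (intro recovers_ge[OF assms(1)]) auto
  have eq: "\<beta> x ((s ^^ Suc n) x) = \<beta> x ((s ^^ n) x) + \<beta> ((s ^^ n) x) ((s ^^ Suc n) x)"
    using recovers_add[OF assms(1)] by simp
  have "\<beta> x ((s ^^ n) x) \<le> (\<Sum>i<n. v ((s ^^ i) x))"
    using Suc.prems(1) eq ge by simp
  moreover have "\<beta> ((s ^^ n) x) ((s ^^ Suc n) x) \<le> v ((s ^^ n) x)"
    using Suc.prems(1) eq path_sum_le[OF assms(1,2), where n = n and x = x] by simp
  ultimately show ?case using Suc.IH Suc.prems(2) ge by (cases "i = n") auto
qed simp

text \<open>Up to the meeting point, each path sum equals one cocycle and is a lower bound for the other.
  Since the cocycles agree on \<open>(x, y)\<close>, both bounds are equalities, so the \<open>s'\<close>-path is tight for \<open>\<beta>\<close>.\<close>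

lemma pinch:
  assumes \<beta>: "recovers v \<beta>" "\<And>z. \<beta> z (s z) = v z" "up_right s"
    and \<beta>': "recovers v \<beta>'" "\<And>z. \<beta>' z (s' z) = v z" "up_right s'"
    and eq: "\<beta> x y = \<beta>' x y"
    and hit: "(s' ^^ n) x = (s ^^ m) y"
    and tight: "\<And>z. \<beta> z (s' z) = v z \<Longrightarrow> s z = s' z"
  shows "meets s x y"
proof -
  let ?u = "(s' ^^ n) x"
  have "\<beta>' x ?u = (\<Sum>i<n. v ((s' ^^ i) x))" by (rule path_sum_eq[OF \<beta>'(1,2)])
  moreover have "\<beta> y ?u = (\<Sum>i<m. v ((s ^^ i) y))" unfolding hit by (rule path_sum_eq[OF \<beta>(1,2)])
  moreover have "(\<Sum>i<m. v ((s ^^ i) y)) \<le> \<beta>' y ?u"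
    unfolding hit by (rule path_sum_le[OF \<beta>'(1) \<beta>(3)])
  ultimately have "\<beta> x ?u \<le> (\<Sum>i<n. v ((s' ^^ i) x))"
    using eq recovers_add[OF \<beta>(1), of x y ?u] recovers_add[OF \<beta>'(1), of x y ?u] by linarith
  from path_sum_tight[OF \<beta>(1) \<beta>'(3) this]
  have step: "s ((s' ^^ i) x) = (s' ^^ Suc i) x" if "i < n" for i
    using tight that by simp
  have "(s ^^ i) x = (s' ^^ i) x" if "i \<le> n" for i
    using that by (induction i) (auto simp: step)
  then show ?thesis using hit unfolding meets_def by (metis le_refl)
qed

text \<open>The step rule of the Busemann geodesics as a function of a single cocycle, so that
  arguments in one direction need no family of directions.\<close>

definition tie_step :: "sign \<Rightarrow> (site \<Rightarrow> site \<Rightarrow> real) \<Rightarrow> site \<Rightarrow> site" where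
  "tie_step \<sigma> \<beta> z =
    (if \<beta> z (z + e\<^sub>1) < \<beta> z (z + e\<^sub>2) then z + e\<^sub>1
     else if \<beta> z (z + e\<^sub>1) > \<beta> z (z + e\<^sub>2) then z + e\<^sub>2
     else z + e_sign \<sigma>)"

lemma busemann_step_eq: "busemann_step b \<xi> \<sigma> = tie_step \<sigma> (b \<xi> \<sigma>)"
  by (simp add: fun_eq_iff busemann_step_def tie_step_def)

lemma up_right_tie_step: "up_right (tie_step \<sigma> \<beta>)"
  unfolding up_right_def tie_step_def by (cases \<sigma>) auto

lemma tie_step_tight:
  assumes "recovers v \<beta>" shows "\<beta> z (tie_step \<sigma> \<beta> z) = v z"
proof -
  have "min (\<beta> z (z + e\<^sub>1)) (\<beta> z (z + e\<^sub>2)) = v z"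
    using assms unfolding recovers_def by blast
  then show ?thesis unfolding tie_step_def by (cases \<sigma>) auto
qed

text \<open>Geodesics are orbits of one step map. A common site has a single level, so from there on
  equal indices belong to equal sites.\<close>

lemma coalesce_iff_meets:
  "coalesce (busemann_geodesic b x \<xi> \<sigma>) (busemann_geodesic b y \<xi> \<sigma>) \<longleftrightarrow>
     meets (tie_step \<sigma> (b \<xi> \<sigma>)) x y"
proof
  let ?s = "tie_step \<sigma> (b \<xi> \<sigma>)"
  assume "coalesce (busemann_geodesic b x \<xi> \<sigma>) (busemann_geodesic b y \<xi> \<sigma>)"
  then show "meets ?s x y"
    unfolding coalesce_def busemann_geodesic_def busemann_step_eq meets_def by blast
next
  let ?s = "tie_step \<sigma> (b \<xi> \<sigma>)"
  assume "meets ?s x y"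
  then obtain m n where mn: "(?s ^^ m) x = (?s ^^ n) y" unfolding meets_def by blast
  then have lev: "level x + int m = level y + int n"
    using level_funpow[OF up_right_tie_step] by metis
  have "busemann_geodesic b x \<xi> \<sigma> k = busemann_geodesic b y \<xi> \<sigma> k" if k: "k \<ge> level x + int m" for k
  proof -
    define r where "r = nat (k - level x - int m)"
    have "nat (k - level x) = r + m" "nat (k - level y) = r + n"
      using k lev unfolding r_def by auto
    then show ?thesis
      unfolding busemann_geodesic_def busemann_step_eq using mn by (simp add: funpow_add)
  qed
  then show "coalesce (busemann_geodesic b x \<xi> \<sigma>) (busemann_geodesic b y \<xi> \<sigma>)"
    unfolding coalesce_def by blast
qed

text \<open>Planarity supplies the intersection that \<open>pinch\<close> requires: the
  \<open>s'\<close>-paths merge and the \<open>s\<close>-paths keep to one side of them, so the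
  \<open>s'\<close>-path from one of the two points crosses the \<open>s\<close>-path from the
  other.\<close>

lemma meets_if_cocycles_agree:
  assumes \<beta>: "recovers v \<beta>" "\<And>z. \<beta> z (s z) = v z" "up_right s"
    and \<beta>': "recovers v \<beta>'" "\<And>z. \<beta>' z (s' z) = v z" "up_right s'"
    and tight: "\<And>z. \<beta> z (s' z) = v z \<Longrightarrow> s z = s' z"
    and order: "(\<forall>z. s z = z + e\<^sub>1 \<longrightarrow> s' z = z + e\<^sub>1) \<or> (\<forall>z. s' z = z + e\<^sub>1 \<longrightarrow> s z = z + e\<^sub>1)"
    and eq: "\<beta> x y = \<beta>' x y"
    and lev: "level x = level y"
    and "meets s' x y"
  shows "meets s x y"
proof -
  obtain N where N: "(s' ^^ N) x = (s' ^^ N) y"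
    using meets_same_level[OF \<beta>'(3) lev \<open>meets s' x y\<close>] .
  have eq': "\<beta> y x = \<beta>' y x"
    using eq recovers_sym[OF \<beta>(1)] recovers_sym[OF \<beta>'(1)] by metis
  note pinch = pinch[OF \<beta> \<beta>' _ _ tight]
  consider (right) "\<forall>z. s z = z + e\<^sub>1 \<longrightarrow> s' z = z + e\<^sub>1" | (left) "\<forall>z. s' z = z + e\<^sub>1 \<longrightarrow> s z = z + e\<^sub>1"
    using order by blast
  then show ?thesis
  proof cases
    case right
    \<comment> \<open>Here \<open>s\<close> keeps to the left of \<open>s'\<close>. At step
      \<open>N\<close> the \<open>s\<close>-path from \<open>q\<close> is not to the right of the
      merged \<open>s'\<close>-paths, although \<open>p\<close> starts to the left of
      \<open>q\<close>.\<close>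
    have *: "meets s p q" if pq: "\<beta> p q = \<beta>' p q" "level p = level q" "fst p \<le> fst q"
      "(s' ^^ N) p = (s' ^^ N) q" for p q
    proof -
      have "fst ((s ^^ N) q) \<le> fst ((s' ^^ N) q)"
        by (rule funpow_ordered[OF \<beta>(3) \<beta>'(3)]) (use right in auto)
      then obtain n where "(s' ^^ n) p = (s ^^ n) q"
        using paths_cross[OF \<beta>'(3) \<beta>(3) pq(2,3), of N] pq(4) by auto
      then show ?thesis by (rule pinch[OF pq(1)])
    qed
    show ?thesis
      using *[of x y] *[of y x] eq eq' lev N meets_sym[of s y x] by (cases "fst x \<le> fst y") auto
  next
    case left
    \<comment> \<open>Mirrored: \<open>s\<close> keeps to the right of \<open>s'\<close>, so the
      \<open>s\<close>-path from the left-hand point \<open>q\<close> crosses the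
      \<open>s'\<close>-path from the right-hand point \<open>p\<close>.\<close>
    have *: "meets s q p" if pq: "\<beta> p q = \<beta>' p q" "level p = level q" "fst q \<le> fst p"
      "(s' ^^ N) p = (s' ^^ N) q" for p q
    proof -
      have "fst ((s' ^^ N) q) \<le> fst ((s ^^ N) q)"
        by (rule funpow_ordered[OF \<beta>'(3) \<beta>(3)]) (use left in auto)
      then obtain n where "(s ^^ n) q = (s' ^^ n) p"
        using paths_cross[OF \<beta>(3) \<beta>'(3) pq(2)[symmetric] pq(3), of N] pq(4) by auto
      then have "(s' ^^ n) p = (s ^^ n) q" by simp
      then show ?thesis by (rule meets_sym[OF pinch[OF pq(1)]])
    qed
    show ?thesis
      using *[of x y] *[of y x] eq eq' lev N meets_sym[of s y x] by (cases "fst x \<le> fst y") auto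
  qed
qed

text \<open>Neighbours chain along an antidiagonal by transitivity. Points on different levels are
  reduced to this by running the lower one up to the level of the other.\<close>

lemma meets_all_if_neighbours:
  assumes s: "up_right s" and adj: "\<And>x. meets s x (x + (1, -1))"
  shows "meets s x y"
proof -
  have shift: "meets s x (x + (int n, - int n))" for x n
  proof (induction n)
    case (Suc n)
    have eq: "x + (int n, - int n) + (1, -1) = x + (int (Suc n), - int (Suc n))"
      by (simp add: prod_eq_iff)
    show ?case using meets_trans[OF Suc adj[of "x + (int n, - int n)"]] unfolding eq .
  qed (simp add: meets_refl flip: zero_prod_def)
  have same: "meets s x y" if "level x = level y" "fst x \<le> fst y" for x y
  proof -
    have "y = x + (int (nat (fst y - fst x)), - int (nat (fst y - fst x)))"
      using that by (simp add: prod_eq_iff level_def)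
    then show ?thesis using shift[of x "nat (fst y - fst x)"] by simp
  qed
  have same': "meets s x y" if "level x = level y" for x y
    using same[of x y] same[of y x] that meets_sym[of s] by (cases "fst x \<le> fst y") auto
  have up: "meets s x y" if "level x \<le> level y" for x y
  proof -
    have "level ((s ^^ nat (level y - level x)) x) = level y"
      using that by (simp add: level_funpow[OF s])
    then have "meets s ((s ^^ nat (level y - level x)) x) y" by (rule same')
    then show ?thesis by (rule meets_trans[OF meets_funpow])
  qed
  show ?thesis using up[of x y] up[of y x] meets_sym[of s y x] by linarith
qed

section \<open>Separated trees and dead ends\<close>

text \<open>\<open>j\<close> counts levels downward from level 0 and \<open>i\<close> is the first
  coordinate, so a path from \<open>grid N i\<close> reaches level 0 after \<open>N\<close>
  steps.\<close>

definition grid :: "nat \<Rightarrow> int \<Rightarrow> site" where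
  "grid j i = (i, - int j - i)"

lemma level_grid [simp]: "level (grid j i) = - int j"
  by (simp add: grid_def level_def)

lemma fst_grid [simp]: "fst (grid j i) = i"
  by (simp add: grid_def)

lemma grid_eq_iff [simp]: "grid j i = grid j' i' \<longleftrightarrow> j = j' \<and> i = i'"
  by (auto simp: grid_def)

lemma grid_Suc: "grid (Suc j) i + e\<^sub>1 = grid j (i + 1)" "grid (Suc j) i + e\<^sub>2 = grid j i"
  by (simp_all add: grid_def prod_eq_iff)

lemma grid_neighbour: "grid j i + (1, -1) = grid j (i + 1)"
  by (simp add: grid_def)

lemma grid_level_fst: "level x = - int j \<Longrightarrow> x = grid j (fst x)"
  by (rule site_eqI) auto

section \<open>Passage bounds along the sides of a cone\<close>

lemma horizontal_lower_bound:
  assumes "recovers v \<beta>" "\<And>t. 1 \<le> t \<Longrightarrow> t \<le> k \<Longrightarrow> c \<le> v (grid (j + t) (i - int t))"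
  shows "real k * c \<le> \<beta> (grid (j + k) (i - int k)) (grid j i)"
  using assms(2)
proof (induction k)
  case (Suc k)
  let ?x = "grid (j + Suc k) (i - int (Suc k))" and ?y = "grid (j + k) (i - int k)"
  have "?y = ?x + e\<^sub>1" using grid_Suc(1)[of "j + k" "i - int (Suc k)"] by (simp add: algebra_simps)
  then have "v ?x \<le> \<beta> ?x ?y" by (intro recovers_ge[OF assms(1)]) simp
  moreover have "c \<le> v ?x" using Suc.prems[of "Suc k"] by simp
  moreover have "real k * c \<le> \<beta> ?y (grid j i)" using Suc by simp
  moreover have "\<beta> ?x ?y + \<beta> ?y (grid j i) = \<beta> ?x (grid j i)" by (rule recovers_add[OF assms(1)])
  ultimately show ?case by (simp add: algebra_simps)
qed (simp add: recovers_refl[OF assms(1)])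

lemma vertical_lower_bound:
  assumes "recovers v \<beta>" "\<And>t. 1 \<le> t \<Longrightarrow> t \<le> k \<Longrightarrow> c \<le> v (grid (j + t) i)"
  shows "real k * c \<le> \<beta> (grid (j + k) i) (grid j i)"
  using assms(2)
proof (induction k)
  case (Suc k)
  let ?x = "grid (j + Suc k) i" and ?y = "grid (j + k) i"
  have "?y = ?x + e\<^sub>2" using grid_Suc(2)[of "j + k" i] by simp
  then have "v ?x \<le> \<beta> ?x ?y" by (intro recovers_ge[OF assms(1)]) simp
  moreover have "c \<le> v ?x" using Suc.prems[of "Suc k"] by simp
  moreover have "real k * c \<le> \<beta> ?y (grid j i)" using Suc by simp
  moreover have "\<beta> ?x ?y + \<beta> ?y (grid j i) = \<beta> ?x (grid j i)" by (rule recovers_add[OF assms(1)])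
  ultimately show ?case by (simp add: algebra_simps)
qed (simp add: recovers_refl[OF assms(1)])

text \<open>Paths from level \<open>- N\<close> to \<open>{a..b}\<close> stay in the backward cone of \<open>{a..b}\<close>, where weights are
  low. Leaving the cone on the nearer side and following its boundary, where weights are high,
  gains an amount linear in \<open>N\<close>, so no such path is optimal.\<close>

lemma no_path_into_low_cone:
  assumes rec: "recovers v \<beta>" and tight: "\<And>z. \<beta> z (s z) = v z" and s: "up_right s"
    and low: "\<And>j i. 1 \<le> j \<Longrightarrow> j \<le> N \<Longrightarrow> a - int j \<le> i \<Longrightarrow> i \<le> b \<Longrightarrow>
      l \<le> v (grid j i) \<and> v (grid j i) \<le> l + \<delta>"
    and right: "\<And>j. 1 \<le> j \<Longrightarrow> j \<le> N \<Longrightarrow> l + 3 * \<delta> \<le> v (grid j (b + 1))"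
    and left: "\<And>j. 1 \<le> j \<Longrightarrow> j \<le> N \<Longrightarrow> l + 3 * \<delta> \<le> v (grid j (a - 1 - int j))"
    and bound: "\<And>i. a - 1 \<le> i \<Longrightarrow> i \<le> b + 1 \<Longrightarrow> \<bar>\<beta> (grid 0 i) m\<bar> \<le> C"
    and size: "real N * \<delta> + 2 * C < 3 * \<delta> * (real N - real_of_int (b - a + 2)) / 2"
    and "0 \<le> \<delta>" "a \<le> b"
  shows "(s ^^ N) (grid N i) \<notin> grid 0 ` {a..b}"
proof
  assume "(s ^^ N) (grid N i) \<in> grid 0 ` {a..b}"
  then obtain k where k: "(s ^^ N) (grid N i) = grid 0 k" "a \<le> k" "k \<le> b" by auto
  \<comment> \<open>An orbit that ends in the block stays in its backward cone: the first coordinate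
    never decreases and grows by at most one per remaining step.\<close>
  have site: "\<exists>h. (s ^^ t) (grid N i) = grid (N - t) h \<and> a - int (N - t) \<le> h \<and> h \<le> b" if "t \<le> N" for t
  proof -
    let ?z = "(s ^^ t) (grid N i)"
    have "(s ^^ (N - t)) ?z = grid 0 k"
      using k(1) that by (metis comp_apply funpow_add le_add_diff_inverse2)
    then have "fst ?z \<le> k" "k \<le> fst ?z + int (N - t)"
      using fst_funpow_bounds[OF s, of ?z "N - t"] by auto
    moreover have "level ?z = - int (N - t)" using that by (simp add: level_funpow[OF s])
    then have "?z = grid (N - t) (fst ?z)" by (rule grid_level_fst)
    ultimately show ?thesis using k by (intro exI[of _ "fst ?z"]) auto
  qed
  from site[of 0] have i: "a - int N \<le> i" "i \<le> b" by auto
  have "\<beta> (grid N i) (grid 0 k) = (\<Sum>t<N. v ((s ^^ t) (grid N i)))"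
    using path_sum_eq[OF rec tight, where x = "grid N i" and n = N] k(1) by simp
  also have "\<dots> \<le> real (card {..<N}) * (l + \<delta>)"
  proof (rule sum_bounded_above)
    fix t assume "t \<in> {..<N}"
    then show "v ((s ^^ t) (grid N i)) \<le> l + \<delta>" using site[of t] low[of "N - t"] by force
  qed
  finally have upper: "\<beta> (grid N i) (grid 0 k) \<le> real N * (l + \<delta>)" by simp
  have "0 \<le> C" using bound[of a] \<open>a \<le> b\<close> by simp
  \<comment> \<open>The stretch of high weights has length \<open>N - (b + 1 - i)\<close> on the
    right-hand detour and \<open>a - 1 - i\<close> on the left-hand one. These lengths add up to
    \<open>2 * h\<close>, so one of them is at least \<open>h\<close>.\<close>
  define h where "h = (real N - real_of_int (b - a + 2)) / 2"
  have size': "real N * \<delta> + 2 * C < 3 * \<delta> * h" using size unfolding h_def by simp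
  have "0 < h"
  proof (rule ccontr)
    assume "\<not> 0 < h"
    then have "3 * \<delta> * h \<le> 0" using \<open>0 \<le> \<delta>\<close> by (simp add: mult_nonneg_nonpos)
    moreover have "0 \<le> real N * \<delta>" using \<open>0 \<le> \<delta>\<close> by simp
    ultimately show False using size' \<open>0 \<le> C\<close> by linarith
  qed
  \<comment> \<open>A detour with \<open>r\<close> high and \<open>N - r\<close> low weights gains
    at least \<open>3 * \<delta> * r - N * \<delta>\<close> over the given path. By
    \<open>bound\<close>, moving its end point on level 0 costs at most
    \<open>2 * C\<close>.\<close>
  have lower: False if r: "h \<le> real r" and e: "e = a - 1 \<or> e = b + 1"
    and ge: "real (N - r) * l + real r * (l + 3 * \<delta>) \<le> \<beta> (grid N i) (grid 0 e)" "r \<le> N" for r e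
  proof -
    have "\<beta> (grid 0 k) m = \<beta> (grid 0 k) (grid 0 e) + \<beta> (grid 0 e) m"
      by (rule recovers_add[OF rec, symmetric])
    moreover have "\<bar>\<beta> (grid 0 e) m\<bar> \<le> C" "\<bar>\<beta> (grid 0 k) m\<bar> \<le> C"
      using bound k e \<open>a \<le> b\<close> by auto
    moreover have "\<beta> (grid N i) (grid 0 e) = \<beta> (grid N i) (grid 0 k) + \<beta> (grid 0 k) (grid 0 e)"
      by (rule recovers_add[OF rec, symmetric])
    moreover have "real (N - r) * l + real r * (l + 3 * \<delta>) = real N * l + 3 * \<delta> * real r"
      using ge(2) by (simp add: of_nat_diff algebra_simps)
    moreover have "3 * \<delta> * h \<le> 3 * \<delta> * real r"
      using r \<open>0 \<le> \<delta>\<close> by (intro mult_left_mono) auto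
    ultimately show False using ge(1) upper size' by (simp add: algebra_simps)
  qed
  have "real_of_int (int N - (b + 1 - i)) + real_of_int (a - 1 - i) = 2 * h"
    by (simp add: h_def)
  then consider "h \<le> real_of_int (int N - (b + 1 - i))" | "h \<le> real_of_int (a - 1 - i)"
    by linarith
  then show False
  proof cases
    case 1
    define r where "r = nat (int N - (b + 1 - i))"
    have r: "int r = int N - (b + 1 - i)" using 1 \<open>0 < h\<close> unfolding r_def by simp
    then have rN: "r \<le> N" "int (N - r) = b + 1 - i" using i by auto
    have "real (N - r) * l \<le> \<beta> (grid (r + (N - r)) (b + 1 - int (N - r))) (grid r (b + 1))"
      using rN i by (intro horizontal_lower_bound[OF rec] low[THEN conjunct1]) auto
    moreover have "real r * (l + 3 * \<delta>) \<le> \<beta> (grid (0 + r) (b + 1)) (grid 0 (b + 1))"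
      using rN by (intro vertical_lower_bound[OF rec]) (simp add: right)
    moreover have "h \<le> real r" using 1 r by linarith
    ultimately show False
      using lower[of r "b + 1"] rN recovers_add[OF rec, of "grid N i" "grid r (b + 1)" "grid 0 (b + 1)"]
      by simp
  next
    case 2
    define r where "r = nat (a - 1 - i)"
    have r: "int r = a - 1 - i" using 2 \<open>0 < h\<close> unfolding r_def by simp
    then have rN: "r \<le> N" using i by auto
    have "real (N - r) * l \<le> \<beta> (grid (r + (N - r)) i) (grid r i)"
      using rN r i by (intro vertical_lower_bound[OF rec] low[THEN conjunct1]) auto
    moreover have "real r * (l + 3 * \<delta>) \<le> \<beta> (grid (0 + r) (a - 1 - int r)) (grid 0 (a - 1))"
      using rN by (intro horizontal_lower_bound[OF rec]) (simp add: left)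
    moreover have "h \<le> real r" using 2 r by linarith
    moreover have "a - 1 - int r = i" using r by simp
    ultimately show False
      using lower[of r "a - 1"] rN recovers_add[OF rec, of "grid N i" "grid r i" "grid 0 (a - 1)"]
      by simp
  qed
qed

section \<open>Separations and their number\<close>

definition separated :: "(site \<Rightarrow> site) \<Rightarrow> site \<Rightarrow> bool" where
  "separated s x \<longleftrightarrow> \<not> meets s x (x + (1, -1))"

text \<open>Orbits from \<open>N\<close> levels below skip the block between the two separations, so
  at most one of these separations can be inherited from the lower level. This is the loss that
  \<open>separation_count\<close> records.\<close>

definition dead_end :: "(site \<Rightarrow> site) \<Rightarrow> nat \<Rightarrow> nat \<Rightarrow> int \<Rightarrow> bool" where
  "dead_end s N d b \<longleftrightarrow> separated s (grid 0 (b - int d)) \<and> separated s (grid 0 b) \<and>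
     (\<forall>i. (s ^^ N) (grid N i) \<notin> grid 0 ` {b - int d + 1..b})"

text \<open>Otherwise all neighbours in between meet, and transitivity links the two ends.\<close>

lemma separated_between:
  assumes "\<not> meets s (grid 0 u) (grid 0 v)" "u \<le> v"
  shows "\<exists>k\<in>{u..<v}. separated s (grid 0 k)"
proof (rule ccontr)
  assume no: "\<not> (\<exists>k\<in>{u..<v}. separated s (grid 0 k))"
  have "meets s (grid 0 u) (grid 0 (u + int n))" if "u + int n \<le> v" for n
    using that
  proof (induction n)
    case (Suc n)
    have "meets s (grid 0 (u + int n)) (grid 0 (u + int n + 1))"
      using no Suc.prems unfolding separated_def grid_neighbour by auto
    with Suc have "meets s (grid 0 u) (grid 0 (u + int n + 1))"
      using meets_trans[of s "grid 0 u" "grid 0 (u + int n)"] by auto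
    then show ?case by (simp add: algebra_simps)
  qed (simp add: meets_refl)
  from this[of "nat (v - u)"] assms show False by simp
qed

text \<open>Each separation on level \<open>- N\<close> is mapped to the first separation on level 0 between the two
  paths. This is injective and misses the right end of every dead end.\<close>

lemma separation_count:
  assumes s: "up_right s" and d: "d \<ge> 1"
  shows "card {i\<in>{0..<int L}. separated s (grid N i)} + card {b\<in>{0..<int (L + N)}. dead_end s N d b}
    \<le> card {k\<in>{0..<int (L + N)}. separated s (grid 0 k)}"
proof -
  define f where "f i = fst ((s ^^ N) (grid N i))" for i
  have f: "(s ^^ N) (grid N i) = grid 0 (f i)" for i
    unfolding f_def by (rule grid_level_fst) (simp add: level_funpow[OF s])
  have f_bounds: "i \<le> f i" "f i \<le> i + int N" for i
    unfolding f_def using fst_funpow_bounds[OF s, of "grid N i" N] by auto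
  have f_mono: "f i \<le> f j" if "i \<le> j" for i j
    unfolding f_def using that by (intro funpow_ordered[OF s s]) auto
  define Q where "Q i = {k\<in>{f i..<f (i + 1)}. separated s (grid 0 k)}" for i
  have fin: "finite (Q i)" for i 
    unfolding Q_def by (rule finite_subset[of _ "{f i..<f (i + 1)}"]) auto
  have ne: "Q i \<noteq> {}" if "separated s (grid N i)" for i
  proof -
    have "\<not> meets s (grid 0 (f i)) (grid 0 (f (i + 1)))"
    proof
      assume "meets s (grid 0 (f i)) (grid 0 (f (i + 1)))"
      then have "meets s (grid N i) ((s ^^ N) (grid N (i + 1)))"
        by (metis f meets_trans[OF meets_funpow])
      then have "meets s (grid N i) (grid N (i + 1))"
        by (rule meets_trans[OF _ meets_sym[OF meets_funpow]])
      then show False using that unfolding separated_def grid_neighbour by simp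
    qed
    then have "\<exists>k\<in>{f i..<f (i + 1)}. separated s (grid 0 k)"
      by (rule separated_between) (simp add: f_mono)
    then show ?thesis unfolding Q_def by blast
  qed
  have window: "finite {k\<in>{u..<v}. P k}" for u v :: int and P
    by (rule finite_subset[of _ "{u..<v}"]) auto
  define \<phi> where "\<phi> i = Min (Q i)" for i
  let ?S = "{i\<in>{0..<int L}. separated s (grid N i)}"
  have \<phi>: "f i \<le> \<phi> i \<and> \<phi> i < f (i + 1) \<and> separated s (grid 0 (\<phi> i))" if "i \<in> ?S" for i
    using Min_in[OF fin ne, of i] that unfolding Q_def \<phi>_def by auto
  have "inj_on \<phi> ?S"
  proof (rule linorder_inj_onI')
    fix i j assume "i \<in> ?S" "j \<in> ?S" "i < j"
    then show "\<phi> i \<noteq> \<phi> j" using \<phi>[of i] \<phi>[of j] f_mono[of "i + 1" j] by linarith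
  qed
  then have card: "card ?S = card (\<phi> ` ?S)" by (rule card_image[symmetric])
  have disjoint: "\<phi> ` ?S \<inter> {b\<in>{0..<int (L + N)}. dead_end s N d b} = {}"
  proof (rule ccontr)
    assume "\<phi> ` ?S \<inter> {b\<in>{0..<int (L + N)}. dead_end s N d b} \<noteq> {}"
    then obtain i where i: "i \<in> ?S" "dead_end s N d (\<phi> i)" by auto
    \<comment> \<open>\<open>f i\<close> avoids the block and is at most \<open>\<phi> i\<close>,
      hence at most \<open>\<phi> i - d\<close>. But then \<open>\<phi> i - d\<close> is an earlier
      separation in \<open>Q i\<close>, against minimality.\<close>
    have "grid 0 (f i) \<notin> grid 0 ` {\<phi> i - int d + 1..\<phi> i}"
      using i(2) f[of i] unfolding dead_end_def by metis
    then have "f i \<notin> {\<phi> i - int d + 1..\<phi> i}" by blast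
    then have "f i \<le> \<phi> i - int d" using \<phi>[OF i(1)] by auto
    then have "\<phi> i - int d \<in> Q i"
      using i(2) \<phi>[OF i(1)] unfolding Q_def dead_end_def by auto
    then have "\<phi> i \<le> \<phi> i - int d" unfolding \<phi>_def by (rule Min_le[OF fin])
    then show False using d by simp
  qed
  have "card ?S + card {b\<in>{0..<int (L + N)}. dead_end s N d b} =
      card (\<phi> ` ?S \<union> {b\<in>{0..<int (L + N)}. dead_end s N d b})"
    unfolding card
    by (rule card_Un_disjoint[OF finite_imageI[OF window] window disjoint, symmetric])
  also have "\<dots> \<le> card {k\<in>{0..<int (L + N)}. separated s (grid 0 k)}"
  proof (rule card_mono)
    show "\<phi> ` ?S \<union> {b\<in>{0..<int (L + N)}. dead_end s N d b} \<subseteq>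
      {k\<in>{0..<int (L + N)}. separated s (grid 0 k)}"
    proof
      fix k assume "k \<in> \<phi> ` ?S \<union> {b\<in>{0..<int (L + N)}. dead_end s N d b}"
      then consider i where "i \<in> ?S" "k = \<phi> i" | "k \<in> {0..<int (L + N)}" "dead_end s N d k" by blast
      then show "k \<in> {k\<in>{0..<int (L + N)}. separated s (grid 0 k)}"
      proof cases
        case 1
        then show ?thesis using \<phi>[of i] f_bounds[of i] f_bounds[of "i + 1"] by auto
      qed (auto simp: dead_end_def)
    qed
  qed (rule window)
  finally show ?thesis .
qed

section \<open>Coalescence in a fixed direction\<close>

lemma vimage_in_generated_sets:
  "X \<in> F \<Longrightarrow> A \<in> sets borel \<Longrightarrow> X -` A \<inter> space M \<in> generated_sets M F"
  unfolding generated_sets_def by (intro sigma_sets.Basic) blast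

text \<open>Turns a bare family of sets into a measure space, so that the usual rules can show that
  composite events belong to the family.\<close>

lemma obtain_sigma_algebra_generated_sets:
  obtains N where "space N = space M" "sets N = generated_sets M F"
    "\<And>X. X \<in> F \<Longrightarrow> X \<in> borel_measurable N"
proof
  let ?G = "{X -` A \<inter> space M | X A. X \<in> F \<and> A \<in> sets (borel :: real measure)}"
  let ?N = "sigma (space M) ?G"
  have sub: "?G \<subseteq> Pow (space M)" by auto
  show sp: "space ?N = space M" by (rule space_measure_of[OF sub])
  show s: "sets ?N = generated_sets M F"
    unfolding generated_sets_def by (rule sets_measure_of[OF sub])
  show "X \<in> borel_measurable ?N" if "X \<in> F" for X
    by (rule measurableI) (auto simp: s sp intro: vimage_in_generated_sets[OF that])
qed

lemma generated_sets_mono: "F \<subseteq> F' \<Longrightarrow> generated_sets M F \<subseteq> generated_sets M F'"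
  unfolding generated_sets_def by (rule sigma_sets_subseteq) blast

lemma (in prob_space) expectation_card:
  assumes "finite A" "\<And>i. i \<in> A \<Longrightarrow> {\<omega>\<in>space M. S i \<omega>} \<in> events"
  shows integrable_card: "integrable M (\<lambda>\<omega>. real (card {i\<in>A. S i \<omega>}))"
    and "expectation (\<lambda>\<omega>. real (card {i\<in>A. S i \<omega>})) = (\<Sum>i\<in>A. prob {\<omega>\<in>space M. S i \<omega>})"
proof -
  have card: "real (card {i\<in>A. S i \<omega>}) = (\<Sum>i\<in>A. indicator {\<omega>\<in>space M. S i \<omega>} \<omega>)"
    if "\<omega> \<in> space M" for \<omega>
    using \<open>finite A\<close> that by (simp add: indicator_def sum.If_cases Int_def)
  have i: "integrable M (\<lambda>\<omega>. indicator {\<omega>\<in>space M. S i \<omega>} \<omega> :: real)" if "i \<in> A" for i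
    using assms(2)[OF that] by (intro integrable_real_indicator) (auto simp: emeasure_eq_measure)
  have "integrable M (\<lambda>\<omega>. \<Sum>i\<in>A. indicator {\<omega>\<in>space M. S i \<omega>} \<omega> :: real)"
    by (rule Bochner_Integration.integrable_sum) (rule i)
  then show "integrable M (\<lambda>\<omega>. real (card {i\<in>A. S i \<omega>}))"
    by (subst Bochner_Integration.integrable_cong[OF refl card]) auto
  have "expectation (\<lambda>\<omega>. real (card {i\<in>A. S i \<omega>})) =
    expectation (\<lambda>\<omega>. \<Sum>i\<in>A. indicator {\<omega>\<in>space M. S i \<omega>} \<omega>)"
    by (rule Bochner_Integration.integral_cong[OF refl card])
  also have "\<dots> = (\<Sum>i\<in>A. prob {\<omega>\<in>space M. S i \<omega>})"
    by (subst Bochner_Integration.integral_sum[OF i]) (auto intro!: sum.cong arg_cong[where f = prob])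
  finally show "expectation (\<lambda>\<omega>. real (card {i\<in>A. S i \<omega>})) = (\<Sum>i\<in>A. prob {\<omega>\<in>space M. S i \<omega>})" .
qed

text \<open>Linearity of expectation turns a pathwise inequality between numbers of sites into one
  between sums of probabilities.\<close>

lemma (in prob_space) sum_prob_mono:
  assumes I: "finite I" "\<And>i. i \<in> I \<Longrightarrow> {\<omega>\<in>space M. P i \<omega>} \<in> events"
    and J: "finite J" "\<And>i. i \<in> J \<Longrightarrow> {\<omega>\<in>space M. Q i \<omega>} \<in> events"
    and K: "finite K" "\<And>i. i \<in> K \<Longrightarrow> {\<omega>\<in>space M. R i \<omega>} \<in> events"
    and le: "\<And>\<omega>. \<omega> \<in> space M \<Longrightarrow>
      card {i\<in>I. P i \<omega>} + card {i\<in>J. Q i \<omega>} \<le> card {i\<in>K. R i \<omega>}"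
  shows "(\<Sum>i\<in>I. prob {\<omega>\<in>space M. P i \<omega>}) + (\<Sum>i\<in>J. prob {\<omega>\<in>space M. Q i \<omega>})
    \<le> (\<Sum>i\<in>K. prob {\<omega>\<in>space M. R i \<omega>})"
proof -
  let ?c = "\<lambda>A S \<omega>. real (card {i\<in>A. S i \<omega>})"
  note int = integrable_card[OF I] integrable_card[OF J] integrable_card[OF K]
  have "expectation (\<lambda>\<omega>. ?c I P \<omega> + ?c J Q \<omega>) \<le> expectation (?c K R)"
  proof (rule integral_mono)
    fix \<omega> assume "\<omega> \<in> space M"
    from le[OF this] show "?c I P \<omega> + ?c J Q \<omega> \<le> ?c K R \<omega>" by linarith
  qed (simp_all add: int)
  then show ?thesis
    using Bochner_Integration.integral_add[OF int(1,2)] expectation_card(2)[OF I]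
      expectation_card(2)[OF J] expectation_card(2)[OF K] by simp
qed

section \<open>Measurability of orbits and meetings\<close>

lemma tie_step_iff:
  "tie_step \<sigma> \<beta> x = y \<longleftrightarrow>
    (if \<beta> x (x + e\<^sub>1) < \<beta> x (x + e\<^sub>2) \<or> \<beta> x (x + e\<^sub>1) = \<beta> x (x + e\<^sub>2) \<and> \<sigma> = Plus
     then y = x + e\<^sub>1 else y = x + e\<^sub>2)"
  by (cases \<sigma>) (auto simp: tie_step_def)

text \<open>Orbits only move to higher levels, so the increments from level \<open>r\<close> upward
  decide them. \<open>N\<close> may therefore be a sigma-algebra that knows only the future of level
  \<open>r\<close>, as the independence argument in \<open>AE_meets\<close> requires.\<close>

lemma pred_funpow_tie_step:
  fixes \<beta> :: "site \<Rightarrow> site \<Rightarrow> 'w \<Rightarrow> real"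
  assumes "\<And>z. r \<le> level z \<Longrightarrow> \<beta> z (z + e\<^sub>1) \<in> borel_measurable N"
    and "\<And>z. r \<le> level z \<Longrightarrow> \<beta> z (z + e\<^sub>2) \<in> borel_measurable N"
    and x: "r \<le> level x"
  shows "Measurable.pred N (\<lambda>\<omega>. (tie_step \<sigma> (\<lambda>x y. \<beta> x y \<omega>) ^^ n) x = y)"
proof (induction n arbitrary: y)
  case (Suc n)
  let ?s = "\<lambda>\<omega>. tie_step \<sigma> (\<lambda>x y. \<beta> x y \<omega>)"
  have "(?s \<omega> ^^ Suc n) x = y \<longleftrightarrow>
    (\<exists>z\<in>{z. r \<le> level z}. (?s \<omega> ^^ n) x = z \<and> ?s \<omega> z = y)" for \<omega>
    using x by (auto simp: level_funpow[OF up_right_tie_step])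
  moreover have "Measurable.pred N (\<lambda>\<omega>. ?s \<omega> z = y)" if "r \<le> level z" for z
  proof -
    have [measurable]: "\<beta> z (z + e\<^sub>1) \<in> borel_measurable N" "\<beta> z (z + e\<^sub>2) \<in> borel_measurable N"
      using assms that by auto
    show ?thesis unfolding tie_step_iff by measurable
  qed
  then have "Measurable.pred N
      (\<lambda>\<omega>. \<exists>z\<in>{z. r \<le> level z}. (?s \<omega> ^^ n) x = z \<and> ?s \<omega> z = y)"
    using Suc by (intro pred_intros_countable_bounded pred_intros_logic) auto
  ultimately show ?case by simp
qed simp

lemma pred_meets_tie_step:
  fixes \<beta> :: "site \<Rightarrow> site \<Rightarrow> 'w \<Rightarrow> real"
  assumes "\<And>z. r \<le> level z \<Longrightarrow> \<beta> z (z + e\<^sub>1) \<in> borel_measurable N"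
    and "\<And>z. r \<le> level z \<Longrightarrow> \<beta> z (z + e\<^sub>2) \<in> borel_measurable N"
    and "r \<le> level x" "r \<le> level y"
  shows "Measurable.pred N (\<lambda>\<omega>. meets (tie_step \<sigma> (\<lambda>x y. \<beta> x y \<omega>)) x y)"
proof -
  have "meets s x y \<longleftrightarrow> (\<exists>m n z. (s ^^ m) x = z \<and> (s ^^ n) y = z)" for s
    unfolding meets_def by metis
  then show ?thesis
    using pred_funpow_tie_step[of r \<beta> N, OF assms(1,2)] assms(3,4)
    by (simp only:) (intro pred_intros_countable pred_intros_logic; simp)
qed

text \<open>The properties of one Busemann function that suffice for coalescence in its direction.
  Directions and the shape function no longer occur.\<close>

locale recovering_cocycle = lpp_environment M T w
  for M :: "'w::polish_space measure" and T :: "site \<Rightarrow> 'w \<Rightarrow> 'w" and w :: "site \<Rightarrow> 'w \<Rightarrow> real" +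
  fixes \<beta> :: "site \<Rightarrow> site \<Rightarrow> 'w \<Rightarrow> real" and \<sigma> :: sign
  assumes \<beta>_measurable [measurable]: "\<beta> x y \<in> borel_measurable M"
    and \<beta>_shift: "AE \<omega> in M. \<forall>x y z. \<beta> (x + z) (y + z) \<omega> = \<beta> x y (T z \<omega>)"
    and \<beta>_recovers: "AE \<omega> in M. recovers (\<lambda>x. w x \<omega>) (\<lambda>x y. \<beta> x y \<omega>)"
    and \<beta>_indep: "indep_set (generated_sets M {\<beta> x y | x y. 0 \<le> level x \<and> x \<le> y})
      (generated_sets M {w x | x. level x < 0})"
begin

definition step :: "'w \<Rightarrow> site \<Rightarrow> site" where
  "step \<omega> = tie_step \<sigma> (\<lambda>x y. \<beta> x y \<omega>)"

lemma up_right_step: "up_right (step \<omega>)"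
  unfolding step_def by (rule up_right_tie_step)

lemma pred_funpow_step [measurable]: "Measurable.pred M (\<lambda>\<omega>. (step \<omega> ^^ n) x = y)"
  unfolding step_def by (rule pred_funpow_tie_step[of "level x"]) auto

lemma pred_meets_step [measurable]: "Measurable.pred M (\<lambda>\<omega>. meets (step \<omega>) x y)"
  unfolding step_def by (rule pred_meets_tie_step[of "min (level x) (level y)"]) auto

lemma pred_separated_step [measurable]: "Measurable.pred M (\<lambda>\<omega>. separated (step \<omega>) x)"
  unfolding separated_def by measurable

lemma pred_dead_end_step [measurable]: "Measurable.pred M (\<lambda>\<omega>. dead_end (step \<omega>) N d b)"
proof -
  have eq: "dead_end s N d b \<longleftrightarrow> separated s (grid 0 (b - int d)) \<and> separated s (grid 0 b) \<and>
     (\<forall>i. \<forall>k\<in>{b - int d + 1..b}. (s ^^ N) (grid N i) \<noteq> grid 0 k)" for s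
    unfolding dead_end_def by auto
  show ?thesis unfolding eq by measurable
qed

section \<open>Stationarity of separations and dead ends\<close>

lemma weight_measurable [measurable]: "w x \<in> borel_measurable M"
  using weight_indep unfolding indep_vars_def by blast

lemma prob_weight: "A \<in> sets borel \<Longrightarrow> prob (w x -` A \<inter> space M) = prob (w 0 -` A \<inter> space M)"
  using weight_identical[of x 0] measure_distr[OF weight_measurable] by metis

text \<open>Shifting the environment by \<open>z\<close> almost surely conjugates the step map by a
  translation, and the shift preserves the measure.\<close>

lemma prob_shift:
  assumes [measurable]: "Measurable.pred M (\<lambda>\<omega>. P (step \<omega>))"
    "Measurable.pred M (\<lambda>\<omega>. P (\<lambda>x. step \<omega> (x + z) - z))"
  shows "prob {\<omega>\<in>space M. P (\<lambda>x. step \<omega> (x + z) - z)} = prob {\<omega>\<in>space M. P (step \<omega>)}"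
proof -
  note T_measurable[of z, measurable]
  have "AE \<omega> in M. (\<lambda>x. step \<omega> (x + z) - z) = step (T z \<omega>)"
    using \<beta>_shift
  proof eventually_elim
    case (elim \<omega>)
    have shift: "\<beta> (x + z) (x + z + e) \<omega> = \<beta> x (x + e) (T z \<omega>)" for x e
      using elim[rule_format, of x z "x + e"] by (simp add: ac_simps)
    show ?case
      unfolding step_def tie_step_def shift by (auto simp: fun_eq_iff)
  qed
  then have "prob {\<omega>\<in>space M. P (\<lambda>x. step \<omega> (x + z) - z)} = prob {\<omega>\<in>space M. P (step (T z \<omega>))}"
    by (intro finite_measure_eq_AE) auto
  also have "\<dots> = prob (T z -` {\<omega>\<in>space M. P (step \<omega>)} \<inter> space M)"
    using measurable_space[OF T_measurable[of z]] by (intro arg_cong[where f = prob]) auto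
  also have "\<dots> = measure (distr M M (T z)) {\<omega>\<in>space M. P (step \<omega>)}"
    by (rule measure_distr[symmetric]) auto
  finally show ?thesis by (simp add: T_preserving)
qed

lemma funpow_conj_translation: "((\<lambda>x. s (x + z) - z) ^^ n) x = (s ^^ n) (x + z) - (z :: site)"
  by (induction n) auto

lemma separated_conj_translation:
  "separated (\<lambda>x. s (x + z) - z) x \<longleftrightarrow> separated s (x + (z :: site))"
  unfolding separated_def meets_def funpow_conj_translation by (simp add: ac_simps)

lemma prob_separated: "prob {\<omega>\<in>space M. separated (step \<omega>) x} = prob {\<omega>\<in>space M. separated (step \<omega>) 0}"
  using prob_shift[of "\<lambda>s. separated s 0" x] unfolding separated_conj_translation by simp

text \<open>Only translations along an antidiagonal occur, because \<open>dead_end\<close> refers to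
  fixed levels.\<close>

lemma dead_end_conj_translation:
  "dead_end (\<lambda>x. s (x + (c, - c)) - (c, - c)) N d b \<longleftrightarrow> dead_end s N d (b + c)"
proof -
  have grid: "grid j i + (c, - c) = grid j (i + c)" for j i
    by (simp add: grid_def)
  have "(\<forall>i. (s ^^ N) (grid N (i + c)) - (c, - c) \<notin> grid 0 ` {b - int d + 1..b}) \<longleftrightarrow>
    (\<forall>i. (s ^^ N) (grid N i) \<notin> grid 0 ` {b + c - int d + 1..b + c})" (is "?L \<longleftrightarrow> ?R")
  proof -
    have img: "grid 0 ` {b + c - int d + 1..b + c} = (\<lambda>x. x + (c, - c)) ` grid 0 ` {b - int d + 1..b}"
    proof -
      have "{b + c - int d + 1..b + c} = (\<lambda>x. x + c) ` {b - int d + 1..b}"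
        by (simp add: algebra_simps)
      then show ?thesis by (simp only: image_image grid)
    qed
    have "y - (c, - c) \<in> grid 0 ` {b - int d + 1..b} \<longleftrightarrow>
      y \<in> grid 0 ` {b + c - int d + 1..b + c}" for y
      unfolding img by (metis (no_types, lifting) diff_add_cancel add_diff_cancel image_iff)
    then have "?L \<longleftrightarrow> (\<forall>i. (s ^^ N) (grid N (i + c)) \<notin> grid 0 ` {b + c - int d + 1..b + c})"
      by simp
    also have "\<dots> \<longleftrightarrow> ?R" by (metis diff_add_cancel)
    finally show ?thesis .
  qed
  then show ?thesis
    unfolding dead_end_def separated_conj_translation funpow_conj_translation grid
    by (simp add: algebra_simps)
qed

lemma prob_dead_end:
  "prob {\<omega>\<in>space M. dead_end (step \<omega>) N d b} = prob {\<omega>\<in>space M. dead_end (step \<omega>) N d b'}"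
  using prob_shift[of "\<lambda>s. dead_end s N d b'" "(b - b', - (b - b'))"]
  unfolding dead_end_conj_translation by simp

text \<open>Let \<open>p\<close> and \<open>c\<close> be the probabilities of a separation and of a
  dead end. The expectation of \<open>separation_count\<close> gives
  \<open>L * p + (L + N) * c \<le> (L + N) * p\<close>, as stationarity makes \<open>p\<close> the
  same on both levels. Hence \<open>L * c \<le> N\<close> for every \<open>L\<close>, which forces
  \<open>c = 0\<close>.\<close>

lemma prob_dead_end_eq_0:
  assumes "d \<ge> 1" shows "prob {\<omega>\<in>space M. dead_end (step \<omega>) N d b} = 0"
proof -
  define p where "p = prob {\<omega>\<in>space M. separated (step \<omega>) 0}"
  define c where "c = prob {\<omega>\<in>space M. dead_end (step \<omega>) N d b}"
  have c: "prob {\<omega>\<in>space M. dead_end (step \<omega>) N d b'} = c" for b'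
    unfolding c_def by (rule prob_dead_end)
  have p: "prob {\<omega>\<in>space M. separated (step \<omega>) x} = p" for x
    unfolding p_def by (rule prob_separated)
  have le: "real L * c \<le> real N" for L
  proof -
    have "(\<Sum>i\<in>{0..<int L}. prob {\<omega>\<in>space M. separated (step \<omega>) (grid N i)})
        + (\<Sum>b\<in>{0..<int (L + N)}. prob {\<omega>\<in>space M. dead_end (step \<omega>) N d b})
      \<le> (\<Sum>k\<in>{0..<int (L + N)}. prob {\<omega>\<in>space M. separated (step \<omega>) (grid 0 k)})"
      by (rule sum_prob_mono[OF _ _ _ _ _ _ separation_count[OF up_right_step assms]]) simp_all
    then have "real L * p + real (L + N) * c \<le> real (L + N) * p" by (simp add: p c)
    moreover have "p \<le> 1" "0 \<le> c" by (simp_all add: p_def c_def)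
    then have "real N * p \<le> real N" "0 \<le> real N * c" by (simp_all add: mult_left_le)
    ultimately show ?thesis by (simp add: algebra_simps)
  qed
  have "c = 0"
  proof (rule ccontr)
    assume "c \<noteq> 0"
    then have "c > 0" unfolding c_def by (simp add: zero_less_measure_iff)
    then obtain L where "real N < real L * c" using reals_Archimedean3 by blast
    with le[of L] show False by simp
  qed
  then show ?thesis unfolding c_def .
qed

text \<open>Continuity of the distribution yields quartiles \<open>u < v\<close>. With
  \<open>\<delta> = (v - u) / 4\<close>, countably many windows of length \<delta> cover
  \<open>{..u}\<close>, so one of them has positive mass, and it ends at or below \<open>u\<close>.
  The factor 3 suits \<open>no_path_into_low_cone\<close>: a gain of \<open>3 * \<delta>\<close> on
  about half of the levels outweighs an uncertainty of \<delta> on all of them.\<close>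

lemma weight_windows:
  obtains l \<delta> where "\<delta> > 0" "prob (w 0 -` {l..l + \<delta>} \<inter> space M) > 0"
    "prob (w 0 -` {l + 3 * \<delta>..} \<inter> space M) > 0"
proof -
  let ?D = "distr M borel (w 0)"
  interpret D: real_distribution ?D by (rule real_distribution_distr) simp
  have D: "measure ?D A = prob (w 0 -` A \<inter> space M)" if "A \<in> sets borel" for A
    using that by (intro measure_distr) auto
  have IVT: "\<exists>u. cdf ?D u = q" if q: "0 < q" "q < 1" for q
  proof -
    obtain u where u: "cdf ?D u < q"
      using order_tendstoD(2)[OF D.cdf_lim_at_bot q(1)] by (auto simp: eventually_at_bot_linorder)
    obtain v where v: "q < cdf ?D v"
      using order_tendstoD(1)[OF D.cdf_lim_at_top_prob q(2)] by (auto simp: eventually_at_top_linorder)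
    have "u \<le> v" using u v D.cdf_nondecreasing[of v u] by linarith
    then have "\<exists>x\<ge>u. x \<le> v \<and> cdf ?D x = q"
      using u v by (intro IVT') (auto intro: continuous_on_subset[OF weight_continuous])
    then show ?thesis by blast
  qed
  obtain u v where uv: "cdf ?D u = 1/4" "cdf ?D v = 3/4" using IVT[of "1/4"] IVT[of "3/4"] by auto
  have "u < v" using uv D.cdf_nondecreasing[of v u] by (rule_tac ccontr) auto
  define \<delta> where "\<delta> = (v - u) / 4"
  have "\<delta> > 0" using \<open>u < v\<close> by (simp add: \<delta>_def)
  have "measure ?D {v..} > 0"
  proof -
    have "measure ?D (- {..v}) = 1 - measure ?D {..v}"
      using D.prob_compl[of "{..v}"] by (simp add: Compl_eq_Diff_UNIV)
    then have "measure ?D (- {..v}) = 1/4" using uv(2) by (simp add: cdf_def2)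
    moreover have "measure ?D (- {..v}) \<le> measure ?D {v..}"
      by (rule D.finite_measure_mono) auto
    ultimately show ?thesis by simp
  qed
  have "\<exists>k::nat. measure ?D {u - (real k + 1) * \<delta>..u - (real k + 1) * \<delta> + \<delta>} > 0"
  proof (rule ccontr)
    let ?J = "\<lambda>k::nat. {u - (real k + 1) * \<delta>..u - (real k + 1) * \<delta> + \<delta>}"
    assume "\<not> ?thesis"
    then have "?J k \<in> null_sets ?D" for k
      by (simp add: null_setsI D.emeasure_eq_measure zero_less_measure_iff)
    then have "(\<Union>k. ?J k) \<in> null_sets ?D" by (rule null_sets_UN)
    moreover have "{..u} \<subseteq> (\<Union>k. ?J k)"
    proof
      fix x assume "x \<in> {..u}"
      define k where "k = nat \<lfloor>(u - x) / \<delta>\<rfloor>"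
      have "0 \<le> (u - x) / \<delta>" using \<open>x \<in> {..u}\<close> \<open>\<delta> > 0\<close> by simp
      then have "real k \<le> (u - x) / \<delta>" "(u - x) / \<delta> \<le> real k + 1" unfolding k_def by linarith+
      then have "real k * \<delta> \<le> u - x" "u - x \<le> (real k + 1) * \<delta>"
        using \<open>\<delta> > 0\<close> by (simp_all add: field_simps)
      then show "x \<in> (\<Union>k. ?J k)" by (intro UN_I[of k]) (auto simp: algebra_simps)
    qed
    ultimately have "{..u} \<in> null_sets ?D" 
      by (intro null_sets_subset[where A = "{..u}" and M = ?D]) auto
    then have "measure ?D {..u} = 0" by (rule measure_eq_0_null_sets)
    then show False using uv(1) by (simp add: cdf_def2)
  qed
  then obtain k :: nat where k: "measure ?D {u - (real k + 1) * \<delta>..u - (real k + 1) * \<delta> + \<delta>} > 0" ..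
  define l where "l = u - (real k + 1) * \<delta>"
  have "0 \<le> real k * \<delta>" "4 * \<delta> = v - u" using \<open>\<delta> > 0\<close> by (simp_all add: \<delta>_def)
  moreover have "(real k + 1) * \<delta> = real k * \<delta> + \<delta>" by (simp add: algebra_simps)
  ultimately have "l + 3 * \<delta> \<le> v" unfolding l_def using \<open>\<delta> > 0\<close> by linarith
  then have "measure ?D {v..} \<le> measure ?D {l + 3 * \<delta>..}"
    by (intro D.finite_measure_mono) auto
  with \<open>measure ?D {v..} > 0\<close> have "measure ?D {l + 3 * \<delta>..} > 0" by simp
  then show ?thesis using that[of \<delta> l] \<open>\<delta> > 0\<close> k by (simp add: D l_def)
qed

text \<open>Countable subadditivity. It serves to replace a random bound on finitely many cocycle
  values by a deterministic one.\<close>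

lemma positive_prob_union:
  assumes "\<And>n::nat. Measurable.pred M (P n)" "prob {\<omega>\<in>space M. Q \<omega>} > 0"
    and "\<And>\<omega>. \<omega> \<in> space M \<Longrightarrow> Q \<omega> \<Longrightarrow> \<exists>n. P n \<omega>"
  obtains n where "prob {\<omega>\<in>space M. P n \<omega>} > 0"
proof (rule ccontr)
  note assms(1)[measurable]
  assume "\<not> thesis"
  with that have "prob {\<omega>\<in>space M. P n \<omega>} = 0" for n
    by (metis zero_less_measure_iff)
  then have "{\<omega>\<in>space M. P n \<omega>} \<in> null_sets M" for n
    by (simp add: null_setsI emeasure_eq_measure)
  then have "(\<Union>n. {\<omega>\<in>space M. P n \<omega>}) \<in> null_sets M" by (rule null_sets_UN)
  then have "prob (\<Union>n. {\<omega>\<in>space M. P n \<omega>}) = 0" by (rule measure_eq_0_null_sets)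
  moreover have "prob {\<omega>\<in>space M. Q \<omega>} \<le> prob (\<Union>n. {\<omega>\<in>space M. P n \<omega>})"
    using assms(3) by (intro finite_measure_mono) auto
  ultimately show False using assms(2) by simp
qed

text \<open>Otherwise level 0 almost surely carries at most one separation, whereas the expected
  number among \<open>n\<close> of its sites is \<open>n\<close> times the probability of
  one.\<close>

lemma two_separations:
  assumes "prob {\<omega>\<in>space M. separated (step \<omega>) 0} > 0"
  obtains k l where "k < l"
    "prob {\<omega>\<in>space M. separated (step \<omega>) (grid 0 k) \<and> separated (step \<omega>) (grid 0 l)} > 0"
proof (rule ccontr)
  assume no: "\<not> thesis"
  note found = that
  have "prob {\<omega>\<in>space M. separated (step \<omega>) (grid 0 k) \<and> separated (step \<omega>) (grid 0 l)} = 0"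
    if kl: "k < l" for k l
  proof (rule ccontr)
    assume "\<not> ?thesis"
    then show False using found[OF kl] no by (simp add: zero_less_measure_iff)
  qed
  then have "AE \<omega> in M. \<not> (separated (step \<omega>) (grid 0 k) \<and> separated (step \<omega>) (grid 0 l))" if "k < l" for k l
    using that by (subst AE_iff_measurable[OF _ refl]) (auto simp: emeasure_eq_measure)
  then have "AE \<omega> in M. \<forall>k l. k < l \<longrightarrow> \<not> (separated (step \<omega>) (grid 0 k) \<and> separated (step \<omega>) (grid 0 l))"
    unfolding AE_all_countable by simp
  then have "AE \<omega> in M. real (card {i\<in>{0..<int n}. separated (step \<omega>) (grid 0 i)}) \<le> 1" for n
  proof eventually_elim
    case (elim \<omega>)
    then have "\<exists>i. {i\<in>{0..<int n}. separated (step \<omega>) (grid 0 i)} \<subseteq> {i}"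
      by (metis (mono_tags, lifting) linorder_neqE mem_Collect_eq singletonI subsetI)
    then obtain i where "{i\<in>{0..<int n}. separated (step \<omega>) (grid 0 i)} \<subseteq> {i}" ..
    from card_mono[OF _ this] show ?case by simp
  qed
  then have "expectation (\<lambda>\<omega>. real (card {i\<in>{0..<int n}. separated (step \<omega>) (grid 0 i)})) \<le> expectation (\<lambda>\<omega>. 1)" for n
    by (intro integral_mono_AE integrable_card) auto
  then have "real n * prob {\<omega>\<in>space M. separated (step \<omega>) 0} \<le> 1" for n
    using prob_separated[of "grid 0 i" for i]
    by (subst (asm) expectation_card(2)) (simp_all add: prob_space)
  moreover obtain n where "1 < real n * prob {\<omega>\<in>space M. separated (step \<omega>) 0}"
    using reals_Archimedean3[OF assms] by blast
  ultimately show False by (meson not_le)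
qed

theorem AE_meets: "AE \<omega> in M. \<forall>x y. meets (step \<omega>) x y"
proof -
  have "prob {\<omega>\<in>space M. separated (step \<omega>) 0} = 0"
  proof (rule ccontr)
    assume "prob {\<omega>\<in>space M. separated (step \<omega>) 0} \<noteq> 0"
    then have "prob {\<omega>\<in>space M. separated (step \<omega>) 0} > 0" by (simp add: zero_less_measure_iff)
    then obtain k b where "k < b"
      and kb: "prob {\<omega>\<in>space M. separated (step \<omega>) (grid 0 k) \<and> separated (step \<omega>) (grid 0 b)} > 0"
      using two_separations by blast
    define a where "a = k + 1"
    define d where "d = nat (b - k)"
    have d: "d \<ge> 1" "b - int d = a - 1" "k = a - 1" "a \<le> b" using \<open>k < b\<close> by (auto simp: d_def a_def)
    \<comment> \<open>This site dominates \<open>grid 0 i\<close> for all \<open>i\<close> from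
      \<open>a - 1\<close> to \<open>b + 1\<close>, so the values
      \<open>\<beta> (grid 0 i) m\<close> belong to the future of level 0. They serve as potentials
      for comparing end points on that level.\<close>
    define m :: site where "m = (b + 1, 1 - a)"
    define fut where "fut C \<omega> \<longleftrightarrow> separated (step \<omega>) (grid 0 k) \<and> separated (step \<omega>) (grid 0 b) \<and>
        (\<forall>i\<in>{a - 1..b + 1}. \<bar>\<beta> (grid 0 i) m \<omega>\<bar> \<le> C)" for C :: real and \<omega>
    have "Measurable.pred M (fut (real n))" for n unfolding fut_def by measurable
    then obtain n where n: "prob {\<omega>\<in>space M. fut (real n) \<omega>} > 0"
    proof (rule positive_prob_union[OF _ kb])
      fix \<omega> assume "separated (step \<omega>) (grid 0 k) \<and> separated (step \<omega>) (grid 0 b)"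
      moreover obtain n where "Max ((\<lambda>i. \<bar>\<beta> (grid 0 i) m \<omega>\<bar>) ` {a - 1..b + 1}) \<le> real n"
        using real_arch_simple by blast
      ultimately show "\<exists>n. fut (real n) \<omega>" unfolding fut_def using \<open>a \<le> b\<close> by (auto simp: Max_le_iff)
    qed
    obtain l \<delta> where l: "\<delta> > 0" "prob (w 0 -` {l..l + \<delta>} \<inter> space M) > 0"
      "prob (w 0 -` {l + 3 * \<delta>..} \<inter> space M) > 0"
      using weight_windows by blast
    obtain N' :: nat where N': "(4 * real n + 3 * \<delta> * real_of_int (b - a + 2)) / \<delta> \<le> real N'"
      using real_arch_simple by blast
    \<comment> \<open>The bound on \<open>N'\<close> is a rearrangement of \<open>size\<close>
      below. \<open>Suc\<close> makes it strict and ensures that \<open>J\<close> is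
      nonempty.\<close>
    define N where "N = Suc N'"
    have "(4 * real n + 3 * \<delta> * real_of_int (b - a + 2)) / \<delta> < real N"
      using N' unfolding N_def by simp
    then have size: "real N * \<delta> + 2 * real n < 3 * \<delta> * (real N - real_of_int (b - a + 2)) / 2"
      using l(1) by (simp add: field_simps)
    \<comment> \<open>The backward cone of the block down to level \<open>- N\<close>.
      \<open>J\<close> adds one layer of sites along each of its two sides.\<close>
    define low where "low = {grid j i | j i. j \<in> {1..N} \<and> i \<in> {a - int j..b}}"
    define J where "J = low \<union> (\<lambda>j. grid j (b + 1)) ` {1..N} \<union> (\<lambda>j. grid j (a - 1 - int j)) ` {1..N}"
    have "low = (\<Union>j\<in>{1..N}. grid j ` {a - int j..b})" unfolding low_def by auto
    then have "finite J" unfolding J_def by simp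
    have "J \<noteq> {}" unfolding J_def N_def by auto
    have J_level: "level x < 0" if "x \<in> J" for x using that unfolding J_def low_def by auto
    define U where "U x = (if x \<in> low then {l..l + \<delta>} else {l + 3 * \<delta>..})" for x
    have U [measurable]: "U x \<in> sets borel" for x unfolding U_def by simp
    define past where "past = (\<Inter>x\<in>J. w x -` U x \<inter> space M)"
    have "prob past = (\<Prod>x\<in>J. prob (w x -` U x \<inter> space M))"
      unfolding past_def using weight_indep \<open>J \<noteq> {}\<close> \<open>finite J\<close> U by (intro indep_varsD) auto
    also have "\<dots> > 0"
    proof (rule prod_pos)
      fix x show "0 < prob (w x -` U x \<inter> space M)"
        by (subst prob_weight[OF U]) (use l in \<open>simp add: U_def\<close>)
    qed
    finally have "prob past > 0" .
    have past: "past \<in> generated_sets M {w x | x. level x < 0}"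
    proof -
      let ?F = "{w x | x. level x < 0}"
      obtain N where "space N = space M" and N: "sets N = generated_sets M ?F"
        and "\<And>X. X \<in> ?F \<Longrightarrow> X \<in> borel_measurable N"
        by (rule obtain_sigma_algebra_generated_sets[where M = M and F = ?F]) (rule that)
      have "past \<in> sets N"
        unfolding past_def
      proof (rule sets.finite_INT[OF \<open>finite J\<close> \<open>J \<noteq> {}\<close>])
        fix x assume "x \<in> J"
        then have "level x < 0" by (rule J_level)
        then have "w x \<in> ?F" by blast
        then show "w x -` U x \<inter> space M \<in> sets N"
          unfolding N by (rule vimage_in_generated_sets[OF _ U])
      qed
      then show ?thesis by (simp only: N)
    qed
    have future: "{\<omega>\<in>space M. fut (real n) \<omega>} \<in> generated_sets M {\<beta> x y | x y. 0 \<le> level x \<and> x \<le> y}"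
    proof -
      let ?F = "{\<beta> x y | x y. 0 \<le> level x \<and> x \<le> y}"
      obtain N where N: "space N = space M" "sets N = generated_sets M ?F"
        "\<And>X. X \<in> ?F \<Longrightarrow> X \<in> borel_measurable N"
        by (rule obtain_sigma_algebra_generated_sets[where M = M and F = ?F]) (rule that)
      have \<beta>: "\<beta> x y \<in> borel_measurable N" if "0 \<le> level x" "x \<le> y" for x y
        using that by (intro N(3)) blast
      have e: "z \<le> z + e\<^sub>1" "z \<le> z + e\<^sub>2" for z :: site
        by (simp_all add: less_eq_prod_def)
      have "Measurable.pred N (\<lambda>\<omega>. meets (step \<omega>) x y)" if "0 \<le> level x" "0 \<le> level y" for x y
        unfolding step_def by (rule pred_meets_tie_step[of 0]) (use that e in \<open>auto intro: \<beta>\<close>)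
      then have "Measurable.pred N (\<lambda>\<omega>. separated (step \<omega>) (grid 0 i))" for i
        unfolding separated_def grid_neighbour by (intro pred_intros_logic) auto
      moreover have "Measurable.pred N (\<lambda>\<omega>. \<forall>i\<in>{a - 1..b + 1}. \<bar>\<beta> (grid 0 i) m \<omega>\<bar> \<le> real n)"
      proof (rule pred_intros_finite)
        fix i assume "i \<in> {a - 1..b + 1}"
        then have [measurable]: "\<beta> (grid 0 i) m \<in> borel_measurable N"
          by (intro \<beta>) (auto simp: m_def grid_def level_def less_eq_prod_def)
        show "Measurable.pred N (\<lambda>\<omega>. \<bar>\<beta> (grid 0 i) m \<omega>\<bar> \<le> real n)" by measurable
      qed simp
      ultimately have "Measurable.pred N (fut (real n))"
        unfolding fut_def by (intro pred_intros_logic)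
      then show ?thesis using N(1,2) by (simp add: pred_def)
    qed
    \<comment> \<open>One event concerns the cocycle from level 0 upward, the other the weights
      below, so by independence they occur together with positive probability. Almost surely on
      their intersection \<open>no_path_into_low_cone\<close> applies and produces a dead
      end.\<close>
    have "0 < prob {\<omega>\<in>space M. fut (real n) \<omega>} * prob past" using n \<open>prob past > 0\<close> by simp
    also have "\<dots> = prob ({\<omega>\<in>space M. fut (real n) \<omega>} \<inter> past)"
      by (rule indep_setD[OF \<beta>_indep future past, symmetric])
    also have "\<dots> \<le> prob {\<omega>\<in>space M. dead_end (step \<omega>) N d b}"
    proof (rule finite_measure_mono_AE)
      show "AE \<omega> in M. \<omega> \<in> {\<omega>\<in>space M. fut (real n) \<omega>} \<inter> past \<longrightarrow> \<omega> \<in> {\<omega>\<in>space M. dead_end (step \<omega>) N d b}"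
        using \<beta>_recovers
      proof (eventually_elim, intro impI)
        fix \<omega> assume rec: "recovers (\<lambda>x. w x \<omega>) (\<lambda>x y. \<beta> x y \<omega>)"
          and "\<omega> \<in> {\<omega>\<in>space M. fut (real n) \<omega>} \<inter> past"
        then have \<omega>: "\<omega> \<in> space M" "fut (real n) \<omega>" and "\<omega> \<in> past" by blast+
        from \<open>\<omega> \<in> past\<close> have U: "w x \<omega> \<in> U x" if "x \<in> J" for x
          unfolding past_def using that by blast
        have "(step \<omega> ^^ N) (grid N i) \<notin> grid 0 ` {a..b}" for i
        proof (rule no_path_into_low_cone[OF rec _ up_right_step])
          show "\<beta> z (step \<omega> z) \<omega> = w z \<omega>" for z
            unfolding step_def by (rule tie_step_tight[OF rec])
          show "l \<le> w (grid j i) \<omega> \<and> w (grid j i) \<omega> \<le> l + \<delta>"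
            if "1 \<le> j" "j \<le> N" "a - int j \<le> i" "i \<le> b" for j i
          proof -
            have "grid j i \<in> low" using that unfolding low_def by auto
            then show ?thesis using U[of "grid j i"] unfolding U_def J_def by auto
          qed
          show "l + 3 * \<delta> \<le> w (grid j (b + 1)) \<omega>" if "1 \<le> j" "j \<le> N" for j
          proof -
            have "grid j (b + 1) \<notin> low" "grid j (b + 1) \<in> J" using that unfolding low_def J_def by auto
            then show ?thesis using U[of "grid j (b + 1)"] unfolding U_def by auto
          qed
          show "l + 3 * \<delta> \<le> w (grid j (a - 1 - int j)) \<omega>" if "1 \<le> j" "j \<le> N" for j
          proof -
            have "grid j (a - 1 - int j) \<notin> low" "grid j (a - 1 - int j) \<in> J"
              using that unfolding low_def J_def by auto
            then show ?thesis using U[of "grid j (a - 1 - int j)"] unfolding U_def by auto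
          qed
          show "\<bar>\<beta> (grid 0 i) m \<omega>\<bar> \<le> real n" if "a - 1 \<le> i" "i \<le> b + 1" for i
            using \<omega>(2) that unfolding fut_def by auto
        qed (use size l d in auto)
        then show "\<omega> \<in> {\<omega>\<in>space M. dead_end (step \<omega>) N d b}"
          using \<omega> d unfolding dead_end_def fut_def by simp
      qed
    qed simp
    also have "\<dots> = 0" by (rule prob_dead_end_eq_0[OF d(1)])
    finally show False by simp
  qed
  then have "AE \<omega> in M. \<not> separated (step \<omega>) x" for x
    by (subst AE_iff_measurable[OF _ refl]) (simp_all add: emeasure_eq_measure prob_separated[of x])
  then have "AE \<omega> in M. \<forall>x. \<not> separated (step \<omega>) x"
    unfolding AE_all_countable by simp
  then show ?thesis
    by eventually_elim (auto simp: separated_def intro: meets_all_if_neighbours[OF up_right_step])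
qed

end

section \<open>Busemann measures and their supports\<close>

definition dir_at :: "real \<Rightarrow> direction" where
  "dir_at t = (t, 1 - t)"

lemma fst_dir_at [simp]: "fst (dir_at t) = t"
  by (simp add: dir_at_def)

lemma dir_at_eq_iff [simp]: "dir_at s = dir_at t \<longleftrightarrow> s = t"
  by (auto simp: dir_at_def)

lemma inj_dir_at: "inj dir_at"
  by (simp add: inj_def)

lemma dirs_eq: "dirs = dir_at ` {0..1}"
  by (force simp: dirs_def dir_at_def e\<^sub>1_def e\<^sub>2_def)

lemma ri_dirs_eq: "ri_dirs = dir_at ` {0<..<1}"
proof -
  have "dir_at ` {0<..<1} = dir_at ` {0..1} - {dir_at 1, dir_at 0}"
    by (auto simp: less_le)
  then show ?thesis
    unfolding ri_dirs_def dirs_eq by (simp add: dir_at_def e\<^sub>1_def e\<^sub>2_def)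
qed

lemma dir_at_in_ri_dirs [simp]: "dir_at t \<in> ri_dirs \<longleftrightarrow> 0 < t \<and> t < 1"
  unfolding ri_dirs_eq by auto

lemma dir_less_dir_at [simp]: "dir_at s \<prec> dir_at t \<longleftrightarrow> s < t"
  by (simp add: dir_less_def e_hat_def e\<^sub>1_def e\<^sub>2_def dir_at_def)

lemma dir_le_dir_at [simp]: "dir_at s \<preceq> dir_at t \<longleftrightarrow> s \<le> t"
  by (simp add: dir_le_def e_hat_def e\<^sub>1_def e\<^sub>2_def dir_at_def)

lemma dir_Icc_dir_at: "0 \<le> s \<Longrightarrow> t \<le> 1 \<Longrightarrow> dir_Icc (dir_at s) (dir_at t) = dir_at ` {s..t}"
  unfolding dir_Icc_def dirs_eq by auto

lemma dir_Ioc_dir_at: "0 \<le> s \<Longrightarrow> t \<le> 1 \<Longrightarrow> dir_Ioc (dir_at s) (dir_at t) = dir_at ` {s<..t}"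
  unfolding dir_Ioc_def dirs_eq by auto

lemma dir_Ico_dir_at: "0 \<le> s \<Longrightarrow> t \<le> 1 \<Longrightarrow> dir_Ico (dir_at s) (dir_at t) = dir_at ` {s..<t}"
  unfolding dir_Ico_def dirs_eq by auto

lemma continuous_dir_at: "continuous_on A dir_at"
  unfolding dir_at_def by (intro continuous_intros)

lemma tendsto_dir_at: "(dir_at \<longlongrightarrow> dir_at t) (at t within A)"
  using continuous_dir_at[of UNIV] by (metis UNIV_I continuous_on_def tendsto_within_subset top_greatest)

lemma filterlim_dir_at_left:
  assumes "0 < t" "t < 1" shows "filterlim dir_at (dir_at_left (dir_at t)) (at_left t)"
  unfolding dir_at_left_def filterlim_at
proof (intro conjI tendsto_dir_at)
  have "\<forall>\<^sub>F s in at_left t. s \<in> {0<..<t}" using assms eventually_at_left_real by blast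
  then show "\<forall>\<^sub>F s in at_left t. dir_at s \<in> {\<zeta> \<in> ri_dirs. \<zeta> \<prec> dir_at t} \<and> dir_at s \<noteq> dir_at t"
    by eventually_elim (use assms in auto)
qed

lemma filterlim_dir_at_right:
  assumes "0 < t" "t < 1" shows "filterlim dir_at (dir_at_right (dir_at t)) (at_right t)"
  unfolding dir_at_right_def filterlim_at
proof (intro conjI tendsto_dir_at)
  have "\<forall>\<^sub>F s in at_right t. s \<in> {t<..<1}" using assms eventually_at_right_real by blast
  then show "\<forall>\<^sub>F s in at_right t. dir_at s \<in> {\<zeta> \<in> ri_dirs. dir_at t \<prec> \<zeta>} \<and> dir_at s \<noteq> dir_at t"
    by eventually_elim (use assms in auto)
qed

lemma closed_dir_at_image: "closed (dir_at ` {s..t})"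
  by (intro compact_imp_closed compact_continuous_image continuous_dir_at) simp

lemma borel_measurable_dir_at [measurable]: "dir_at \<in> borel_measurable borel"
  by (intro borel_measurable_continuous_onI continuous_dir_at)

lemma sets_restrict_segment:
  "A \<in> sets (restrict_space borel (dir_at ` {s..t})) \<longleftrightarrow> A \<in> sets borel \<and> A \<subseteq> dir_at ` {s..t}"
  by (subst sets_restrict_space_iff) (auto intro: borel_closed closed_dir_at_image)

lemma dir_at_image_borel:
  assumes "A \<in> sets borel" shows "dir_at ` (A \<inter> {s..t}) \<in> sets borel"
proof -
  have "dir_at ` (A \<inter> {s..t}) = fst -` A \<inter> dir_at ` {s..t}" by auto
  moreover have "fst -` A \<in> sets (borel :: direction measure)"
    using measurable_sets[OF borel_measurable_continuous_onI[OF continuous_on_fst[OF continuous_on_id]] assms]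
    by simp
  ultimately show ?thesis by (simp add: borel_closed closed_dir_at_image sets.Int)
qed

lemma dir_at_image_in_segment:
  "A \<in> sets borel \<Longrightarrow> A \<subseteq> {s..t} \<Longrightarrow> dir_at ` A \<in> sets (restrict_space borel (dir_at ` {s..t}))"
  using dir_at_image_borel[of A s t] unfolding sets_restrict_segment by (simp add: Int_absorb2 image_mono)

lemma segment_set_eq:
  assumes "A \<in> sets (restrict_space borel (dir_at ` {s..t}))"
  obtains A' where "A' \<in> sets borel" "A = dir_at ` (A' \<inter> {s..t})"
proof
  have A: "A \<in> sets borel" "A \<subseteq> dir_at ` {s..t}" using assms by (auto simp: sets_restrict_segment)
  then show "dir_at -` A \<in> sets borel" using measurable_sets[OF borel_measurable_dir_at A(1)] by simp
  show "A = dir_at ` (dir_at -` A \<inter> {s..t})" using A(2) by auto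
qed

section \<open>Signed measures\<close>

lemma signed_measure_empty: "signed_measure_on N \<mu> \<Longrightarrow> \<mu> {} = 0"
  unfolding signed_measure_on_def by blast

lemma signed_measure_sums:
  "signed_measure_on N \<mu> \<Longrightarrow> range A \<subseteq> sets N \<Longrightarrow> disjoint_family A \<Longrightarrow> (\<lambda>i::nat. \<mu> (A i)) sums \<mu> (\<Union>i. A i)"
  unfolding signed_measure_on_def by blast

lemma signed_measure_Un:
  assumes "signed_measure_on N \<mu>" "A \<in> sets N" "B \<in> sets N" "A \<inter> B = {}"
  shows "\<mu> (A \<union> B) = \<mu> A + \<mu> B"
proof -
  have "disjoint_family (binaryset A B)"
    using assms(4) by (auto simp: disjoint_family_on_def binaryset_def)
  then have "(\<lambda>i. \<mu> (binaryset A B i)) sums \<mu> (\<Union>i. binaryset A B i)"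
    using assms by (intro signed_measure_sums) (auto simp: range_binaryset_eq)
  then show ?thesis
    using binaryset_sums[of \<mu> A B] signed_measure_empty[OF assms(1)]
    by (simp add: UN_binaryset_eq sums_unique2)
qed

text \<open>A signed measure can vanish on a set without vanishing on its subsets. The assumption on
  subsets is what permits making the family disjoint.\<close>

lemma signed_measure_UN_null:
  assumes "signed_measure_on N \<mu>" "range A \<subseteq> sets N"
    and "\<And>C i. C \<in> sets N \<Longrightarrow> C \<subseteq> A (i::nat) \<Longrightarrow> \<mu> C = 0"
  shows "\<mu> (\<Union>i. A i) = 0"
proof -
  have "(\<lambda>i. \<mu> (disjointed A i)) sums \<mu> (\<Union>i. disjointed A i)"
    by (intro signed_measure_sums[OF assms(1)] sets.range_disjointed_sets assms(2) disjoint_family_disjointed)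
  moreover have "\<mu> (disjointed A i) = 0" for i
    using sets.range_disjointed_sets[OF assms(2)] disjointed_subset[of A i] by (intro assms(3)) auto
  ultimately show ?thesis by (simp add: UN_disjointed_eq sums_iff)
qed

lemma signed_measure_on_linear:
  assumes "signed_measure_on N \<mu>" "signed_measure_on N \<nu>"
  shows "signed_measure_on N (\<lambda>A. a * \<mu> A + b * \<nu> A)"
  using assms unfolding signed_measure_on_def by (auto intro!: sums_add sums_mult)

lemma signed_measure_on_zero: "signed_measure_on N (\<lambda>A. 0)"
  unfolding signed_measure_on_def by auto


section \<open>Existence and uniqueness of Busemann measures\<close>

definition interval_charge ::
  "direction set \<Rightarrow> (direction \<Rightarrow> sign \<Rightarrow> real) \<Rightarrow> (direction set \<Rightarrow> real) \<Rightarrow> bool" where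
  "interval_charge K F \<mu> \<longleftrightarrow> signed_measure_on (restrict_space borel K) \<mu> \<and>
     (\<forall>\<zeta>\<in>ri_dirs. \<forall>\<eta>\<in>ri_dirs. \<zeta> \<prec> \<eta> \<longrightarrow> dir_Icc \<zeta> \<eta> \<subseteq> K \<longrightarrow>
        \<mu> (dir_Ioc \<zeta> \<eta>) = F \<eta> Plus - F \<zeta> Plus \<and> \<mu> (dir_Ico \<zeta> \<eta>) = F \<eta> Minus - F \<zeta> Minus)"

lemma interval_charge_segment:
  assumes "0 < s" "t < 1"
  shows "interval_charge (dir_at ` {s..t}) F \<mu> \<longleftrightarrow>
    signed_measure_on (restrict_space borel (dir_at ` {s..t})) \<mu> \<and>
    (\<forall>u v. s \<le> u \<and> u < v \<and> v \<le> t \<longrightarrow>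
      \<mu> (dir_at ` {u<..v}) = F (dir_at v) Plus - F (dir_at u) Plus \<and>
      \<mu> (dir_at ` {u..<v}) = F (dir_at v) Minus - F (dir_at u) Minus)"
proof -
  have "dir_at ` {u..v} \<subseteq> dir_at ` {s..t} \<longleftrightarrow> s \<le> u \<and> v \<le> t" if "u < v" for u v
    using that by (subst inj_image_subset_iff[OF inj_dir_at]) auto
  then show ?thesis
    using assms unfolding interval_charge_def ri_dirs_eq
    by (auto simp: dir_Icc_dir_at dir_Ioc_dir_at dir_Ico_dir_at)
qed

lemma interval_charge_cong:
  "(\<And>\<xi> \<sigma>. \<xi> \<in> ri_dirs \<Longrightarrow> F \<xi> \<sigma> = G \<xi> \<sigma>) \<Longrightarrow> interval_charge K F \<mu> \<Longrightarrow> interval_charge K G \<mu>"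
  unfolding interval_charge_def by auto

text \<open>The condition that defines \<open>busemann_measure\<close>, stated for arbitrary
  \<open>F\<close>, is linear in \<open>F\<close>. Uniqueness thus reduces to \<open>F = 0\<close>
  and existence to monotone \<open>F\<close>.\<close>

lemma interval_charge_linear:
  assumes "interval_charge K F \<mu>" "interval_charge K G \<nu>"
  shows "interval_charge K (\<lambda>\<xi> \<sigma>. a * F \<xi> \<sigma> + b * G \<xi> \<sigma>) (\<lambda>A. a * \<mu> A + b * \<nu> A)"
  unfolding interval_charge_def
proof (intro conjI ballI impI)
  show "signed_measure_on (restrict_space borel K) (\<lambda>A. a * \<mu> A + b * \<nu> A)"
    using assms unfolding interval_charge_def by (intro signed_measure_on_linear) auto
next
  fix \<zeta> \<eta> :: direction
  assume "\<zeta> \<in> ri_dirs" "\<eta> \<in> ri_dirs" "\<zeta> \<prec> \<eta>" "dir_Icc \<zeta> \<eta> \<subseteq> K"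
  then have eq: "\<mu> (dir_Ioc \<zeta> \<eta>) = F \<eta> Plus - F \<zeta> Plus" "\<mu> (dir_Ico \<zeta> \<eta>) = F \<eta> Minus - F \<zeta> Minus"
    "\<nu> (dir_Ioc \<zeta> \<eta>) = G \<eta> Plus - G \<zeta> Plus" "\<nu> (dir_Ico \<zeta> \<eta>) = G \<eta> Minus - G \<zeta> Minus"
    using assms unfolding interval_charge_def by blast+
  show "a * \<mu> (dir_Ioc \<zeta> \<eta>) + b * \<nu> (dir_Ioc \<zeta> \<eta>) =
      a * F \<eta> Plus + b * G \<eta> Plus - (a * F \<zeta> Plus + b * G \<zeta> Plus)"
    "a * \<mu> (dir_Ico \<zeta> \<eta>) + b * \<nu> (dir_Ico \<zeta> \<eta>) =
      a * F \<eta> Minus + b * G \<eta> Minus - (a * F \<zeta> Minus + b * G \<zeta> Minus)"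
    unfolding eq by (simp_all add: algebra_simps)
qed

lemma interval_charge_zero: "interval_charge K (\<lambda>\<xi> \<sigma>. 0) (\<lambda>A. 0)"
  unfolding interval_charge_def using signed_measure_on_zero by auto

text \<open>The condition only speaks of half-open intervals, so the mass of \<open>{s}\<close> and
  the total mass have to be found first. Then the rays \<open>{..<a}\<close> are an
  intersection-stable generator on which the charge vanishes, and additivity extends this to all
  Borel sets.\<close>

lemma interval_charge_unique_zero:
  assumes st: "0 < s" "s < t" "t < 1"
    and charge: "interval_charge (dir_at ` {s..t}) (\<lambda>\<xi> \<sigma>. 0) \<theta>"
  shows "\<theta> A = 0"
proof -
  let ?N = "restrict_space borel (dir_at ` {s..t})"
  note mem = dir_at_image_in_segment[of _ s t]
  from charge have \<theta>: "signed_measure_on ?N \<theta>"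
    and Ioc: "\<And>u v. s \<le> u \<Longrightarrow> u < v \<Longrightarrow> v \<le> t \<Longrightarrow> \<theta> (dir_at ` {u<..v}) = 0"
    and Ico: "\<And>u v. s \<le> u \<Longrightarrow> u < v \<Longrightarrow> v \<le> t \<Longrightarrow> \<theta> (dir_at ` {u..<v}) = 0"
    unfolding interval_charge_segment[OF st(1,3)] by auto
  have additive: "\<theta> (dir_at ` Z) = \<theta> (dir_at ` X) + \<theta> (dir_at ` Y)"
    if "X \<in> sets borel" "Y \<in> sets borel" "X \<inter> Y = {}" "X \<union> Y = Z" "Z \<subseteq> {s..t}" for X Y Z
  proof -
    have "\<theta> (dir_at ` X \<union> dir_at ` Y) = \<theta> (dir_at ` X) + \<theta> (dir_at ` Y)"
      using that by (intro signed_measure_Un[OF \<theta>] mem) auto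
    then show ?thesis using that(4) by (simp flip: image_Un)
  qed
  \<comment> \<open>A sequence that decreases from \<open>t\<close> to \<open>s\<close>. It cuts the
    open segment into countably many half-open pieces of charge 0.\<close>
  define v where "v n = s + (t - s) / real (Suc n)" for n
  have v_dec: "v m \<le> v n" if "n \<le> m" for m n
    unfolding v_def using that st by (intro add_left_mono divide_left_mono) auto
  have v_gt: "s < v n" for n unfolding v_def using st by simp
  have v_Suc: "v (Suc n) < v n" for n
    unfolding v_def using st by (intro add_strict_left_mono divide_strict_left_mono) auto
  have v0: "v 0 = t" by (simp add: v_def)
  have v_le: "v n \<le> t" for n using v_dec[of 0 n] v0 by simp
  have v_lim: "\<exists>n. v (Suc n) \<le> x" if "s < x" for x
  proof -
    obtain n where "(t - s) / (x - s) \<le> real n" using real_arch_simple by blast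
    then have "(t - s) / (x - s) \<le> real (Suc (Suc n))" by simp
    then have "(t - s) / real (Suc (Suc n)) \<le> x - s"
      using that by (simp add: field_simps)
    then show ?thesis unfolding v_def by (intro exI[of _ n]) simp
  qed
  have Ioo: "\<theta> (dir_at ` {s<..<t}) = 0"
  proof -
    let ?A = "\<lambda>n. dir_at ` {v (Suc n)..<v n}"
    have "disjoint_family ?A"
      unfolding disjoint_family_on_def
    proof (intro ballI impI)
      fix m n :: nat assume "m \<noteq> n"
      then consider "Suc m \<le> n" | "Suc n \<le> m" by linarith
      then show "?A m \<inter> ?A n = {}"
        by cases (use v_dec[of "Suc m" n] v_dec[of "Suc n" m] in auto)
    qed
    moreover have "?A n \<in> sets ?N" for n
      using v_gt[of "Suc n"] v_le[of n] by (intro mem) auto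
    then have "range ?A \<subseteq> sets ?N" by blast
    ultimately have "(\<lambda>n. \<theta> (?A n)) sums \<theta> (\<Union>n. ?A n)" by (intro signed_measure_sums[OF \<theta>])
    moreover have "\<theta> (?A n) = 0" for n 
      using v_gt[of "Suc n"] v_le[of n] v_Suc[of n] by (intro Ico) auto
    moreover have "(\<Union>n. ?A n) = dir_at ` (\<Union>n. {v (Suc n)..<v n})" by blast
    moreover have "(\<Union>n. {v (Suc n)..<v n}) = {s<..<t}"
    proof (intro equalityI subsetI)
      fix x assume "x \<in> {s<..<t}"
      then have x: "s < x" "x < t" by auto
      define n where "n = (LEAST n. v (Suc n) \<le> x)"
      have "v (Suc n) \<le> x" unfolding n_def using v_lim[OF x(1)] by (rule LeastI_ex)
      moreover have "x < v n"
      proof (cases n)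
        case (Suc k)
        then show ?thesis using not_less_Least[of k "\<lambda>n. v (Suc n) \<le> x"] unfolding n_def by simp
      qed (use v0 x in simp)
      ultimately show "x \<in> (\<Union>n. {v (Suc n)..<v n})" by auto
    next
      fix x assume "x \<in> (\<Union>n. {v (Suc n)..<v n})"
      then obtain n where "v (Suc n) \<le> x" "x < v n" by auto
      then show "x \<in> {s<..<t}" using v_gt[of "Suc n"] v_le[of n] by auto
    qed
    ultimately show ?thesis by (simp add: sums_iff)
  qed
  have "\<theta> (dir_at ` {s..<t}) = \<theta> (dir_at ` {s}) + \<theta> (dir_at ` {s<..<t})"
    using st by (intro additive) auto
  then have "\<theta> (dir_at ` {s}) = 0" using Ico[of s t] Ioo st by simp
  moreover have "\<theta> (dir_at ` {s..t}) = \<theta> (dir_at ` {s}) + \<theta> (dir_at ` {s<..t})"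
    using st by (intro additive) auto
  ultimately have total: "\<theta> (dir_at ` {s..t}) = 0" using Ioc[of s t] st by simp
  have zero: "\<theta> (dir_at ` (A \<inter> {s..t})) = 0" if "A \<in> sets borel" for A
  proof -
    have A: "A \<in> sigma_sets UNIV (range lessThan)" using that by (subst (asm) borel_Iio) simp
    have stable: "Int_stable (range (lessThan :: real \<Rightarrow> real set))"
    proof -
      have "{..<a} \<inter> {..<b} = {..<min a b}" for a b :: real by auto
      then show ?thesis unfolding Int_stable_def by blast
    qed
    have "range (lessThan :: real \<Rightarrow> real set) \<subseteq> Pow UNIV" by simp
    from stable this A show ?thesis
    proof (induction A rule: sigma_sets_induct_disjoint)
      case (basic A)
      then obtain a where A: "A = {..<a}" by auto
      consider "a \<le> s" | "s < a" "a \<le> t" | "t < a" by linarith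
      then show ?case
      proof cases
        case 1
        then have "A \<inter> {s..t} = {}" using A by auto
        then show ?thesis by (simp add: signed_measure_empty[OF \<theta>])
      next
        case 2
        then have "A \<inter> {s..t} = {s..<a}" using A by auto
        then show ?thesis using Ico[of s a] 2 by simp
      next
        case 3
        then have "A \<inter> {s..t} = {s..t}" using A by auto
        then show ?thesis using total by simp
      qed
    next
      case (compl A)
      then have A: "A \<in> sets borel" by (subst borel_Iio) simp
      have "\<theta> (dir_at ` {s..t}) = \<theta> (dir_at ` (A \<inter> {s..t})) + \<theta> (dir_at ` ((UNIV - A) \<inter> {s..t}))"
        using A by (intro additive) auto
      then show ?case using total compl by simp
    next
      case (union A)
      have A: "A i \<in> sets borel" for i using union(2) by (subst borel_Iio) auto
      have "(\<lambda>i. \<theta> (dir_at ` (A i \<inter> {s..t}))) sums \<theta> (\<Union>i. dir_at ` (A i \<inter> {s..t}))"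
      proof (rule signed_measure_sums[OF \<theta>])
        show "disjoint_family (\<lambda>i. dir_at ` (A i \<inter> {s..t}))"
          unfolding disjoint_family_on_def image_Int[OF inj_dir_at, symmetric]
          using disjoint_family_onD[OF union(1)] by blast
      qed (use A in \<open>auto intro!: mem\<close>)
      moreover have "(\<Union>i. dir_at ` (A i \<inter> {s..t})) = dir_at ` ((\<Union>i. A i) \<inter> {s..t})" by blast
      ultimately show ?case using union(3) by (simp add: sums_iff)
    qed (auto simp: signed_measure_empty[OF \<theta>])
  qed
  show ?thesis
  proof (cases "A \<in> sets ?N")
    case True
    then show ?thesis using zero by (metis segment_set_eq)
  next
    case False
    then show ?thesis using \<theta> unfolding signed_measure_on_def by blast
  qed
qed

lemma interval_charge_unique:
  assumes st: "0 < s" "s < t" "t < 1"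
    and "interval_charge (dir_at ` {s..t}) F \<mu>" "interval_charge (dir_at ` {s..t}) F \<nu>"
  shows "\<mu> = \<nu>"
proof
  fix A
  have "interval_charge (dir_at ` {s..t}) (\<lambda>\<xi> \<sigma>. 0) (\<lambda>A. 1 * \<mu> A + (- 1) * \<nu> A)"
    by (rule interval_charge_cong[OF _ interval_charge_linear[OF assms(4,5)]]) simp
  from interval_charge_unique_zero[OF st this, of A] show "\<mu> A = \<nu> A" by simp
qed

text \<open>The value 0 off the smaller sigma-algebra is the default that
  \<open>signed_measure_on\<close> prescribes. Together with uniqueness this localizes a Busemann
  measure.\<close>

lemma interval_charge_subsegment:
  assumes "0 < s" "t < 1" "s \<le> s'" "t' \<le> t" and charge: "interval_charge (dir_at ` {s..t}) F \<mu>"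
  shows "interval_charge (dir_at ` {s'..t'}) F
    (\<lambda>A. if A \<in> sets (restrict_space borel (dir_at ` {s'..t'})) then \<mu> A else 0)"
proof -
  let ?N = "restrict_space borel (dir_at ` {s..t})" and ?N' = "restrict_space borel (dir_at ` {s'..t'})"
  have sub: "sets ?N' \<subseteq> sets ?N"
  proof
    fix A assume "A \<in> sets ?N'"
    moreover have "dir_at ` {s'..t'} \<subseteq> dir_at ` {s..t}" using assms(3,4) by (intro image_mono) auto
    ultimately show "A \<in> sets ?N" unfolding sets_restrict_segment by blast
  qed
  from charge have \<mu>: "signed_measure_on ?N \<mu>"
    unfolding interval_charge_def by blast
  have "signed_measure_on ?N' (\<lambda>A. if A \<in> sets ?N' then \<mu> A else 0)"
    unfolding signed_measure_on_def
  proof (intro conjI allI impI)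
    fix A :: "nat \<Rightarrow> direction set" assume A: "range A \<subseteq> sets ?N'" "disjoint_family A"
    then have "(\<Union>i. A i) \<in> sets ?N'" "\<And>i. A i \<in> sets ?N'" by auto
    then show "(\<lambda>i. if A i \<in> sets ?N' then \<mu> (A i) else 0) sums (if (\<Union>i. A i) \<in> sets ?N' then \<mu> (\<Union>i. A i) else 0)"
      using signed_measure_sums[OF \<mu> order_trans[OF A(1) sub] A(2)] by simp
  qed (use signed_measure_empty[OF \<mu>] in auto)
  moreover have "dir_at ` {u<..v} \<in> sets ?N'" "dir_at ` {u..<v} \<in> sets ?N'" if "s' \<le> u" "v \<le> t'" for u v
    using that by (auto intro!: dir_at_image_in_segment)
  moreover have "\<forall>u v. s \<le> u \<and> u < v \<and> v \<le> t \<longrightarrow>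
      \<mu> (dir_at ` {u<..v}) = F (dir_at v) Plus - F (dir_at u) Plus \<and>
      \<mu> (dir_at ` {u..<v}) = F (dir_at v) Minus - F (dir_at u) Minus"
    using charge assms(1,2) by (simp add: interval_charge_segment)
  ultimately show ?thesis
    using assms by (subst interval_charge_segment) auto
qed

text \<open>The Stieltjes measure of the right-continuous values for the sign \<open>Plus\<close>.
  The left limits of these are the values for \<open>Minus\<close>, which accounts for the intervals
  closed on the left.\<close>

lemma interval_charge_exists_mono:
  assumes st: "0 < s" "s < t" "t < 1"
    and mono: "\<And>u v. 0 < u \<Longrightarrow> u < v \<Longrightarrow> v < 1 \<Longrightarrow>
      F (dir_at u) Minus \<le> F (dir_at u) Plus \<and> F (dir_at u) Plus \<le> F (dir_at v) Minus"
    and left: "\<And>u. 0 < u \<Longrightarrow> u < 1 \<Longrightarrow> ((\<lambda>v. F (dir_at v) Plus) \<longlongrightarrow> F (dir_at u) Minus) (at_left u)"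
    and right: "\<And>u. 0 < u \<Longrightarrow> u < 1 \<Longrightarrow> ((\<lambda>v. F (dir_at v) Plus) \<longlongrightarrow> F (dir_at u) Plus) (at_right u)"
  shows "\<exists>\<mu>. interval_charge (dir_at ` {s..t}) F \<mu>"
proof -
  define f where "f u \<sigma> = F (dir_at u) \<sigma>" for u \<sigma>
  \<comment> \<open>Left of \<open>s\<close> the value is \<open>f s Minus\<close>, so that the jump
    at \<open>s\<close> becomes an atom of the segment. Right of \<open>t\<close> the function is
    constant.\<close>
  define G where "G u = (if u < s then f s Minus else f (min u t) Plus)" for u
  have jump: "f u Minus \<le> f u Plus" if "0 < u" "u < 1" for u
    using mono[of u "(u + 1) / 2"] that unfolding f_def by simp
  have f_mono: "f u Plus \<le> f v Plus" if "0 < u" "u \<le> v" "v < 1" for u v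
    using mono[of u v] jump[of v] that unfolding f_def by (cases "u = v") auto
  have G_mono: "G x \<le> G y" if "x \<le> y" for x y
    unfolding G_def using that st jump[of s] f_mono[of s "min y t"] f_mono[of "min x t" "min y t"]
    by (auto simp: min_less_iff_disj)
  have G_right: "continuous (at_right a) G" for a
    unfolding continuous_within
  proof -
    consider "a < s" | "s \<le> a" "a < t" | "t \<le> a" by linarith
    then show "(G \<longlongrightarrow> G a) (at_right a)"
    proof cases
      case 1
      then have "\<forall>\<^sub>F x in at_right a. x \<in> {a<..<s}" by (rule eventually_at_right_real)
      then have "\<forall>\<^sub>F x in at_right a. G x = G a"
        by eventually_elim (auto simp: G_def)
      then show ?thesis by (rule tendsto_eventually)
    next
      case 2
      from 2(2) have "\<forall>\<^sub>F x in at_right a. x \<in> {a<..<t}" by (rule eventually_at_right_real)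
      then have "\<forall>\<^sub>F x in at_right a. f x Plus = G x"
        by eventually_elim (use 2 in \<open>auto simp: G_def\<close>)
      moreover have "((\<lambda>x. f x Plus) \<longlongrightarrow> f a Plus) (at_right a)"
        unfolding f_def using 2 st by (intro right) auto
      moreover have "G a = f a Plus" using 2 by (simp add: G_def)
      ultimately show ?thesis by (simp add: Lim_transform_eventually)
    next
      case 3
      have "\<forall>\<^sub>F x in at_right a. x \<in> {a<..<a + 1}" by (rule eventually_at_right_real) simp
      then have "\<forall>\<^sub>F x in at_right a. G x = G a"
        by eventually_elim (use 3 st in \<open>auto simp: G_def\<close>)
      then show ?thesis by (rule tendsto_eventually)
    qed
  qed
  have G_left: "(G \<longlongrightarrow> f v Minus) (at_left v)" if v: "s \<le> v" "v \<le> t" for v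
  proof (cases "v = s")
    case True
    have "\<forall>\<^sub>F x in at_left v. x \<in> {v - 1<..<v}" by (rule eventually_at_left_real) simp
    then have "\<forall>\<^sub>F x in at_left v. G x = f v Minus"
      by eventually_elim (use True in \<open>auto simp: G_def\<close>)
    then show ?thesis by (rule tendsto_eventually)
  next
    case False
    then have "s < v" using v by simp
    then have "\<forall>\<^sub>F x in at_left v. x \<in> {s<..<v}" by (rule eventually_at_left_real)
    then have "\<forall>\<^sub>F x in at_left v. f x Plus = G x"
      by eventually_elim (use v in \<open>auto simp: G_def\<close>)
    moreover have "((\<lambda>x. f x Plus) \<longlongrightarrow> f v Minus) (at_left v)"
      unfolding f_def using v st by (intro left) auto
    ultimately show ?thesis by (simp add: Lim_transform_eventually)
  qed
  define N where "N = interval_measure G"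
  have sets_N [simp]: "sets N = sets borel" "space N = UNIV" unfolding N_def by simp_all
  have Ioc: "measure N {u<..v} = G v - G u" if "u \<le> v" for u v
    unfolding N_def by (rule measure_interval_measure_Ioc[OF that G_mono G_right])
  have fin: "emeasure N A \<noteq> \<infinity>" if "A \<subseteq> {s - 1<..t}" for A
  proof -
    have "emeasure N A \<le> emeasure N {s - 1<..t}" using that by (intro emeasure_mono) auto
    also have "\<dots> = G t - G (s - 1)"
      unfolding N_def using st by (intro emeasure_interval_measure_Ioc G_mono G_right) auto
    finally show ?thesis by (auto simp: top_unique)
  qed
  \<comment> \<open>\<open>s - 1\<close> is a point at which \<open>G\<close> still has its constant
    value left of \<open>s\<close>, and it does not exceed any \<open>X n\<close>. Exhausting the
    interval from within produces the left limit at \<open>v\<close>.\<close>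
  have Ioo: "measure N {s - 1<..<v} = f v Minus - G (s - 1)" if v: "s \<le> v" "v \<le> t" for v
  proof -
    define X where "X n = v - 1 / real (Suc n)" for n
    have X_less: "X n < v" "s - 1 \<le> X n" for n
    proof -
      have "1 / real (Suc n) \<le> 1" by simp
      then show "s - 1 \<le> X n" unfolding X_def using v by linarith
    qed (simp add: X_def)
    have X_lim: "X \<longlonglongrightarrow> v"
    proof -
      have "(\<lambda>n. v - 1 / real (Suc n)) \<longlonglongrightarrow> v - 0"
        by (intro tendsto_diff tendsto_const LIMSEQ_Suc[OF lim_1_over_n])
      then show ?thesis unfolding X_def by simp
    qed
    have "incseq X" unfolding X_def incseq_def by (auto intro!: divide_left_mono)
    have "(\<lambda>n. measure N {s - 1<..X n}) \<longlonglongrightarrow> measure N (\<Union>n. {s - 1<..X n})"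
    proof (rule Lim_measure_incseq)
      show "incseq (\<lambda>n. {s - 1<..X n})"
        using \<open>incseq X\<close> by (force simp: incseq_def intro: order_trans)
      show "emeasure N (\<Union>n. {s - 1<..X n}) \<noteq> \<infinity>"
        using X_less(1) v by (intro fin) (force dest: le_less_trans)
    qed auto
    moreover have "(\<Union>n. {s - 1<..X n}) = {s - 1<..<v}"
    proof (intro equalityI subsetI)
      fix x assume "x \<in> {s - 1<..<v}"
      then have "\<forall>\<^sub>F n in sequentially. x < X n" using order_tendstoD(1)[OF X_lim] by simp
      then obtain n where "x < X n" by (auto simp: eventually_sequentially)
      then show "x \<in> (\<Union>n. {s - 1<..X n})" using \<open>x \<in> {s - 1<..<v}\<close> by (auto intro!: exI[of _ n])
    qed (use X_less(1) in \<open>auto dest: le_less_trans\<close>)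
    moreover have "(\<lambda>n. G (X n) - G (s - 1)) \<longlonglongrightarrow> f v Minus - G (s - 1)"
    proof (intro tendsto_diff tendsto_const)
      have "filterlim X (at_left v) sequentially"
        unfolding filterlim_at using X_lim X_less(1) by (auto simp: less_le)
      then show "(\<lambda>n. G (X n)) \<longlonglongrightarrow> f v Minus"
        by (rule filterlim_compose[OF G_left[OF v]])
    qed
    ultimately show ?thesis
      using Ioc X_less(2) by (simp add: LIMSEQ_unique)
  qed
  have Ico: "measure N {u..<v} = f v Minus - f u Minus" if uv: "s \<le> u" "u < v" "v \<le> t" for u v
  proof -
    have "{u..<v} = {s - 1<..<v} - {s - 1<..<u}" using uv by auto
    moreover have "measure N ({s - 1<..<v} - {s - 1<..<u}) = measure N {s - 1<..<v} - measure N {s - 1<..<u}"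
      using uv by (intro measure_Diff fin) auto
    ultimately show ?thesis using Ioo[of u] Ioo[of v] uv by simp
  qed
  let ?B = "restrict_space borel (dir_at ` {s..t})"
  define \<mu> where "\<mu> A = (if A \<in> sets ?B then measure N (dir_at -` A) else 0)" for A
  have vimage: "dir_at -` A \<in> sets borel" "dir_at -` A \<subseteq> {s - 1<..t}" if "A \<in> sets ?B" for A
    using that measurable_sets[OF borel_measurable_dir_at, of A] by (auto simp: sets_restrict_segment)
  have "signed_measure_on ?B \<mu>"
    unfolding signed_measure_on_def
  proof (intro conjI allI impI)
    fix A :: "nat \<Rightarrow> direction set" assume A: "range A \<subseteq> sets ?B" "disjoint_family A"
    then have A_sets: "(\<Union>i. A i) \<in> sets ?B" "\<And>i. A i \<in> sets ?B" by auto
    have "(\<lambda>i. measure N (dir_at -` A i)) sums measure N (\<Union>i. dir_at -` A i)"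
    proof (rule measure_UNION)
      show "range (\<lambda>i. dir_at -` A i) \<subseteq> sets N" using vimage(1) A_sets(2) by auto
      show "disjoint_family (\<lambda>i. dir_at -` A i)"
        unfolding disjoint_family_on_def vimage_Int[symmetric]
        using disjoint_family_onD[OF A(2)] by auto
      show "emeasure N (\<Union>i. dir_at -` A i) \<noteq> \<infinity>"
        using vimage(2)[OF A_sets(2)] by (intro fin) blast
    qed
    then show "(\<lambda>i. \<mu> (A i)) sums \<mu> (\<Union>i. A i)"
      unfolding \<mu>_def using A_sets by (simp add: vimage_UN)
  qed (auto simp: \<mu>_def)
  moreover have \<mu>: "\<mu> (dir_at ` A) = measure N A" if "A \<in> sets borel" "A \<subseteq> {s..t}" for A
    unfolding \<mu>_def using dir_at_image_in_segment[OF that] by (simp add: inj_dir_at inj_vimage_image_eq)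
  moreover have "\<mu> (dir_at ` {u<..v}) = f v Plus - f u Plus \<and> \<mu> (dir_at ` {u..<v}) = f v Minus - f u Minus"
    if uv: "s \<le> u" "u < v" "v \<le> t" for u v
  proof
    have "\<mu> (dir_at ` {u<..v}) = measure N {u<..v}" using uv by (intro \<mu>) auto
    then show "\<mu> (dir_at ` {u<..v}) = f v Plus - f u Plus" using Ioc[of u v] uv by (simp add: G_def)
    have "\<mu> (dir_at ` {u..<v}) = measure N {u..<v}" using uv by (intro \<mu>) auto
    then show "\<mu> (dir_at ` {u..<v}) = f v Minus - f u Minus" using Ico uv by simp
  qed
  ultimately have "interval_charge (dir_at ` {s..t}) F \<mu>"
    unfolding interval_charge_segment[OF st(1,3)] f_def by blast
  then show ?thesis by blast
qed

section \<open>Total variation and support\<close>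

lemma total_variation_eq_0_iff:
  assumes \<mu>: "signed_measure_on N \<mu>" and A: "A \<in> sets N"
  shows "total_variation N \<mu> A = 0 \<longleftrightarrow> (\<forall>C\<in>sets N. C \<subseteq> A \<longrightarrow> \<mu> C = 0)"
proof
  assume zero: "total_variation N \<mu> A = 0"
  show "\<forall>C\<in>sets N. C \<subseteq> A \<longrightarrow> \<mu> C = 0"
  proof (intro ballI impI)
    fix C assume C: "C \<in> sets N" "C \<subseteq> A"
    \<comment> \<open>A partition into at most two blocks detects \<open>C\<close>. The empty set is
      removed because blocks of a partition are nonempty.\<close>
    let ?P = "{C, A - C} - {{}}"
    show "\<mu> C = 0"
    proof (cases "C = {}")
      case False
      have "?P \<in> {P. finite P \<and> P \<subseteq> sets N \<and> partition_on A P}"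
        using A C by (auto simp: partition_on_def disjoint_def)
      then have "(\<Sum>C\<in>?P. ennreal \<bar>\<mu> C\<bar>) \<le> total_variation N \<mu> A"
        unfolding total_variation_def by (rule SUP_upper)
      moreover have "ennreal \<bar>\<mu> C\<bar> \<le> (\<Sum>C\<in>?P. ennreal \<bar>\<mu> C\<bar>)"
        using False by (intro member_le_sum) auto
      ultimately have "ennreal \<bar>\<mu> C\<bar> = 0" using zero by simp
      then show ?thesis by (simp add: ennreal_eq_0_iff)
    qed (simp add: signed_measure_empty[OF \<mu>])
  qed
next
  assume "\<forall>C\<in>sets N. C \<subseteq> A \<longrightarrow> \<mu> C = 0"
  then have "(\<Sum>C\<in>P. ennreal \<bar>\<mu> C\<bar>) = 0" if "P \<subseteq> sets N" "partition_on A P" for P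
    using that by (intro sum.neutral) (auto dest!: partition_onD1)
  then have "total_variation N \<mu> A \<le> 0" unfolding total_variation_def by (intro SUP_least) auto
  then show "total_variation N \<mu> A = 0" by simp
qed

text \<open>By the Lindelof property the union of all null open sets is a countable union of such
  sets, hence null itself. Its complement in \<open>K\<close> is therefore the least admissible
  closed set.\<close>

lemma signed_support_eq:
  fixes K :: "'a::second_countable_topology set"
  assumes \<mu>: "signed_measure_on (restrict_space borel K) \<mu>" and K: "closed K"
  shows "signed_support K \<mu> =
    K - \<Union>{V. open V \<and> (\<forall>C\<in>sets (restrict_space borel K). C \<subseteq> V \<longrightarrow> \<mu> C = 0)}"
proof -
  let ?N = "restrict_space borel K"
  have sets_N: "A \<in> sets ?N \<longleftrightarrow> A \<in> sets borel \<and> A \<subseteq> K" for A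
    by (subst sets_restrict_space_iff) (use K in auto)
  define \<V> where "\<V> = {V. open V \<and> (\<forall>C\<in>sets ?N. C \<subseteq> V \<longrightarrow> \<mu> C = 0)}"
  have diff: "K - C \<in> sets ?N" if "closed C" for C using that K by (simp add: sets_N sets.Diff)
  have null: "\<mu> C = 0" if C: "C \<in> sets ?N" "C \<subseteq> \<Union>\<V>" for C
  proof -
    obtain \<W> where \<W>: "\<W> \<subseteq> \<V>" "countable \<W>" "\<Union>\<W> = \<Union>\<V>"
      using Lindelof[of \<V>] unfolding \<V>_def by blast
    show ?thesis
    proof (cases "\<W> = {}")
      case True
      then have "C = {}" using C(2) \<W>(3) by blast
      then show ?thesis by (simp add: signed_measure_empty[OF \<mu>])
    next
      case False
      define V where "V = from_nat_into \<W>"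
      have V: "V i \<in> \<V>" for i unfolding V_def using from_nat_into[OF False] \<W>(1) by blast
      have "\<Union>\<W> = (\<Union>i. V i)" unfolding V_def using range_from_nat_into[OF False \<W>(2)] by simp
      then have "C = (\<Union>i. C \<inter> V i)" using C(2) \<W>(3) by auto
      moreover have "\<mu> (\<Union>i. C \<inter> V i) = 0"
      proof (rule signed_measure_UN_null[OF \<mu>])
        show "range (\<lambda>i. C \<inter> V i) \<subseteq> sets ?N"
          using C(1) V unfolding \<V>_def by (auto simp: sets_N)
        show "\<mu> D = 0" if "D \<in> sets ?N" "D \<subseteq> C \<inter> V i" for D i
          using V[of i] that unfolding \<V>_def by auto
      qed
      ultimately show ?thesis by simp
    qed
  qed
  show ?thesis
    unfolding signed_support_def \<V>_def[symmetric]
  proof (rule Least_equality)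
    have "open (\<Union>\<V>)" unfolding \<V>_def by blast
    then have closed: "closed (K - \<Union>\<V>)" using K by (simp add: closed_Diff)
    moreover have "total_variation ?N \<mu> (K - (K - \<Union>\<V>)) = 0"
      by (subst total_variation_eq_0_iff[OF \<mu> diff[OF closed]]) (use null in auto)
    ultimately show "closed (K - \<Union>\<V>) \<and> K - \<Union>\<V> \<subseteq> K \<and> total_variation ?N \<mu> (K - (K - \<Union>\<V>)) = 0"
      by auto
  next
    fix C assume C: "closed C \<and> C \<subseteq> K \<and> total_variation ?N \<mu> (K - C) = 0"
    then have zero: "\<forall>D\<in>sets ?N. D \<subseteq> K - C \<longrightarrow> \<mu> D = 0"
      using total_variation_eq_0_iff[OF \<mu> diff[of C]] by simp
    have "\<mu> D = 0" if "D \<in> sets ?N" "D \<subseteq> - C" for D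
    proof -
      have "D \<subseteq> K - C" using that(2) that(1)[unfolded sets_N] by blast
      then show ?thesis using zero that(1) by blast
    qed
    then have "- C \<in> \<V>" using C unfolding \<V>_def by (simp add: open_Compl)
    then show "K - \<Union>\<V> \<le> C" by auto
  qed
qed

section \<open>Local constancy of Busemann functions\<close>

lemma tie_step_Plus: "tie_step Plus \<beta> z = (if \<beta> z (z + e\<^sub>1) \<le> \<beta> z (z + e\<^sub>2) then z + e\<^sub>1 else z + e\<^sub>2)"
  by (auto simp: tie_step_def)

lemma tie_step_Minus: "tie_step Minus \<beta> z = (if \<beta> z (z + e\<^sub>1) < \<beta> z (z + e\<^sub>2) then z + e\<^sub>1 else z + e\<^sub>2)"
  by (auto simp: tie_step_def)

text \<open>Both signs share the value \<open>r\<close>, also at \<open>u\<close> itself, so a jump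
  at \<open>u\<close> is excluded. Parameters outside the open unit interval are left out because
  nothing is known about \<open>b\<close> there.\<close>

definition flat_at :: "(direction \<Rightarrow> sign \<Rightarrow> real) \<Rightarrow> real \<Rightarrow> bool" where
  "flat_at F u \<longleftrightarrow> (\<exists>a c r. a < u \<and> u < c \<and> (\<forall>v\<in>{a<..<c} \<inter> {0<..<1}. \<forall>\<sigma>. F (dir_at v) \<sigma> = r))"

text \<open>A realization of the Busemann process on the regular event; the arguments in this locale
  are deterministic.\<close>

locale busemann_function =
  fixes b :: busemann_realization and v :: "site \<Rightarrow> real"
  assumes b_recovers: "\<xi> \<in> ri_dirs \<Longrightarrow> recovers v (b \<xi> \<sigma>)"
    and b_mono: "0 < s \<Longrightarrow> s < t \<Longrightarrow> t < 1 \<Longrightarrow>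
      b (dir_at s) Minus x (x + e\<^sub>1) \<ge> b (dir_at s) Plus x (x + e\<^sub>1) \<and>
      b (dir_at s) Plus x (x + e\<^sub>1) \<ge> b (dir_at t) Minus x (x + e\<^sub>1) \<and>
      b (dir_at t) Minus x (x + e\<^sub>1) \<ge> b (dir_at t) Plus x (x + e\<^sub>1) \<and>
      b (dir_at s) Minus x (x + e\<^sub>2) \<le> b (dir_at s) Plus x (x + e\<^sub>2) \<and>
      b (dir_at s) Plus x (x + e\<^sub>2) \<le> b (dir_at t) Minus x (x + e\<^sub>2) \<and>
      b (dir_at t) Minus x (x + e\<^sub>2) \<le> b (dir_at t) Plus x (x + e\<^sub>2)"
    and b_left: "0 < t \<Longrightarrow> t < 1 \<Longrightarrow>
      ((\<lambda>s. b (dir_at s) \<sigma> x y) \<longlongrightarrow> b (dir_at t) Minus x y) (at_left t)"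
    and b_right: "0 < t \<Longrightarrow> t < 1 \<Longrightarrow>
      ((\<lambda>s. b (dir_at s) \<sigma> x y) \<longlongrightarrow> b (dir_at t) Plus x y) (at_right t)"
begin

lemma b_antimono_1:
  assumes "0 < s" "s < t" "t < 1" shows "b (dir_at t) \<tau> x (x + e\<^sub>1) \<le> b (dir_at s) \<sigma> x (x + e\<^sub>1)"
  using b_mono[OF assms, of x] by (cases \<sigma>; cases \<tau>) auto

lemma b_mono_2:
  assumes "0 < s" "s < t" "t < 1" shows "b (dir_at s) \<sigma> x (x + e\<^sub>2) \<le> b (dir_at t) \<tau> x (x + e\<^sub>2)"
  using b_mono[OF assms, of x] by (cases \<sigma>; cases \<tau>) auto

text \<open>Along \<open>e\<^sub>1\<close> the increments decrease in the direction and along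
  \<open>e\<^sub>2\<close> they increase, so the monotone case covers both up to sign. Additivity
  reaches every pair from these, by a path from \<open>x\<close> to \<open>sup x y\<close> and from
  there back to \<open>y\<close>.\<close>

lemma interval_charge_exists:
  assumes st: "0 < s" "s < t" "t < 1"
  shows "\<exists>\<mu>. interval_charge (dir_at ` {s..t}) (\<lambda>\<xi> \<sigma>. b \<xi> \<sigma> x y) \<mu>"
proof -
  define P where "P x y \<longleftrightarrow> (\<exists>\<mu>. interval_charge (dir_at ` {s..t}) (\<lambda>\<xi> \<sigma>. b \<xi> \<sigma> x y) \<mu>)" for x y
  have linear: "P x y" if pq: "P p q" "P p' q'"
    and eq: "\<And>\<xi> \<sigma>. \<xi> \<in> ri_dirs \<Longrightarrow> b \<xi> \<sigma> x y = k * b \<xi> \<sigma> p q + l * b \<xi> \<sigma> p' q'" for x y p q p' q' k l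
  proof -
    obtain \<mu> \<nu> where "interval_charge (dir_at ` {s..t}) (\<lambda>\<xi> \<sigma>. b \<xi> \<sigma> p q) \<mu>"
      "interval_charge (dir_at ` {s..t}) (\<lambda>\<xi> \<sigma>. b \<xi> \<sigma> p' q') \<nu>"
      using pq unfolding P_def by blast
    from interval_charge_cong[OF eq[symmetric] interval_charge_linear[OF this]]
    show ?thesis unfolding P_def by blast
  qed
  have P_refl: "P x x" for x
    unfolding P_def
    by (rule exI, rule interval_charge_cong[OF _ interval_charge_zero])
      (simp add: recovers_refl[OF b_recovers])
  have P_sym: "P y x" if "P x y" for x y
    by (rule linear[OF that that, of _ _ "- 1" 0]) (simp add: recovers_sym[OF b_recovers, where y = y and x = x])
  have P_trans: "P x z" if "P x y" "P y z" for x y z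
    by (rule linear[OF that, of _ _ 1 1]) (simp add: recovers_add[OF b_recovers])
  have P_1: "P x (x + e\<^sub>1)" for x
  proof -
    have "\<exists>\<mu>. interval_charge (dir_at ` {s..t}) (\<lambda>\<xi> \<sigma>. - b \<xi> \<sigma> x (x + e\<^sub>1)) \<mu>"
      by (intro interval_charge_exists_mono st tendsto_minus b_left b_right) (use b_mono[of _ _ x] in auto)
    then obtain \<mu> where "interval_charge (dir_at ` {s..t}) (\<lambda>\<xi> \<sigma>. - b \<xi> \<sigma> x (x + e\<^sub>1)) \<mu>" ..
    from interval_charge_linear[OF this this, of "- 1" 0] show ?thesis unfolding P_def by auto
  qed
  have P_2: "P x (x + e\<^sub>2)" for x
    unfolding P_def
    by (intro interval_charge_exists_mono st b_left b_right) (use b_mono[of _ _ x] in auto)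
  have right: "P x (x + (int n, 0))" for x n
  proof (induction n)
    case (Suc n)
    have eq: "x + (int n, 0) + e\<^sub>1 = x + (int (Suc n), 0)" by (simp add: prod_eq_iff)
    show ?case using P_trans[OF Suc P_1] unfolding eq .
  qed (simp add: P_refl flip: zero_prod_def)
  have up: "P x (x + (0, int n))" for x n
  proof (induction n)
    case (Suc n)
    have eq: "x + (0, int n) + e\<^sub>2 = x + (0, int (Suc n))" by (simp add: prod_eq_iff)
    show ?case using P_trans[OF Suc P_2] unfolding eq .
  qed (simp add: P_refl flip: zero_prod_def)
  have le: "P x y" if "x \<le> y" for x y
  proof -
    have "y = x + (int (nat (fst y - fst x)), 0) + (0, int (nat (snd y - snd x)))"
      using that by (simp add: prod_eq_iff less_eq_prod_def)
    then show ?thesis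
      using P_trans[OF right[of x "nat (fst y - fst x)"] up[of _ "nat (snd y - snd x)"]] by simp
  qed
  have "P x (sup x y)" by (rule le) simp
  moreover have "P (sup x y) y" by (rule P_sym[OF le]) simp
  ultimately show ?thesis using P_trans unfolding P_def by blast
qed

text \<open>Existence and uniqueness give the definite description in
  \<open>busemann_measure\<close> its meaning.\<close>

lemma interval_charge_busemann_measure:
  assumes st: "0 < s" "s < t" "t < 1"
  shows "interval_charge (dir_at ` {s..t}) (\<lambda>\<xi> \<sigma>. b \<xi> \<sigma> x y) (busemann_measure b x y (dir_at ` {s..t}))"
proof -
  have eq: "busemann_measure b x y (dir_at ` {s..t}) =
    (THE \<mu>. interval_charge (dir_at ` {s..t}) (\<lambda>\<xi> \<sigma>. b \<xi> \<sigma> x y) \<mu>)"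
    unfolding busemann_measure_def interval_charge_def ..
  have "\<exists>!\<mu>. interval_charge (dir_at ` {s..t}) (\<lambda>\<xi> \<sigma>. b \<xi> \<sigma> x y) \<mu>"
    using interval_charge_exists[OF st] interval_charge_unique[OF st] by blast
  then show ?thesis unfolding eq by (rule theI')
qed

lemma signed_support_busemann_measure:
  assumes st: "0 < s" "s < t" "t < 1"
  shows "signed_support (dir_at ` {s..t}) (busemann_measure b x y (dir_at ` {s..t})) =
    dir_at ` {s..t} - \<Union>{V. open V \<and> (\<forall>C\<in>sets (restrict_space borel (dir_at ` {s..t})). C \<subseteq> V \<longrightarrow>
      busemann_measure b x y (dir_at ` {s..t}) C = 0)}"
  using interval_charge_busemann_measure[OF st] unfolding interval_charge_def
  by (intro signed_support_eq closed_dir_at_image) blast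

text \<open>On a small segment around \<open>u\<close> both the zero measure and the restricted
  Busemann measure satisfy the defining condition, so they agree by uniqueness.\<close>

lemma not_in_support_if_flat:
  assumes st: "0 < s" "s < t" "t < 1" and u: "s \<le> u" "u \<le> t"
    and flat: "flat_at (\<lambda>\<xi> \<sigma>. b \<xi> \<sigma> x y) u"
  shows "dir_at u \<notin> signed_support (dir_at ` {s..t}) (busemann_measure b x y (dir_at ` {s..t}))"
proof -
  let ?F = "\<lambda>\<xi> \<sigma>. b \<xi> \<sigma> x y" and ?\<mu> = "busemann_measure b x y (dir_at ` {s..t})"
  obtain a c r where ac: "a < u" "u < c"
    and r: "\<And>v \<sigma>. a < v \<Longrightarrow> v < c \<Longrightarrow> 0 < v \<Longrightarrow> v < 1 \<Longrightarrow> ?F (dir_at v) \<sigma> = r"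
    using flat unfolding flat_at_def by auto
  define a' where "a' = (a + u) / 2"
  define c' where "c' = (u + c) / 2"
  have ac': "a < a'" "a' < u" "u < c'" "c' < c" using ac by (auto simp: a'_def c'_def)
  \<comment> \<open>Clipping to \<open>{s..t}\<close> covers the case that \<open>u\<close> is an
    end point. The midpoints \<open>a'\<close> and \<open>c'\<close> keep the closed segment
    strictly between \<open>a\<close> and \<open>c\<close>.\<close>
  define s' where "s' = max s a'"
  define t' where "t' = min t c'"
  have st': "0 < s'" "s' < t'" "t' < 1" "s \<le> s'" "t' \<le> t"
    using st u ac' by (auto simp: s'_def t'_def)
  let ?N' = "restrict_space borel (dir_at ` {s'..t'})"
  have "interval_charge (dir_at ` {s'..t'}) ?F (\<lambda>A. 0)"
    unfolding interval_charge_segment[OF st'(1,3)]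
    using signed_measure_on_zero r st' ac' by (auto simp: s'_def t'_def)
  from interval_charge_unique[OF st'(1-3) this
      interval_charge_subsegment[OF st(1,3) st'(4,5) interval_charge_busemann_measure[OF st]]]
  have zero: "?\<mu> C = 0" if "C \<in> sets ?N'" for C using that by (metis (full_types))
  let ?V = "fst -` {a'<..<c'} :: direction set"
  have "open ?V" by (rule open_vimage_fst) simp
  moreover have "?\<mu> C = 0" if C: "C \<in> sets (restrict_space borel (dir_at ` {s..t}))" "C \<subseteq> ?V" for C
  proof (rule zero)
    show "C \<in> sets ?N'"
      unfolding sets_restrict_segment
    proof
      show "C \<subseteq> dir_at ` {s'..t'}"
      proof
        fix \<xi> assume "\<xi> \<in> C"
        moreover from this obtain v where "\<xi> = dir_at v" "s \<le> v" "v \<le> t"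
          using C(1) unfolding sets_restrict_segment by auto
        ultimately show "\<xi> \<in> dir_at ` {s'..t'}" using C(2) by (auto simp: s'_def t'_def)
      qed
    qed (use C in \<open>simp add: sets_restrict_segment\<close>)
  qed
  moreover have "dir_at u \<in> ?V" using ac' by simp
  ultimately show ?thesis unfolding signed_support_busemann_measure[OF st] by blast
qed

text \<open>One segment with \<open>u\<close> in its interior suffices. Near \<open>u\<close> its
  half-open intervals have measure 0, so the function is constant for each sign, and
  \<open>b_left\<close> identifies the two constants.\<close>

lemma flat_if_not_in_support:
  assumes u: "0 < u" "u < 1" and notin: "dir_at u \<notin> busemann_support b x y"
  shows "flat_at (\<lambda>\<xi> \<sigma>. b \<xi> \<sigma> x y) u"
proof -
  define s where "s = u / 2"
  define t where "t = (u + 1) / 2"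
  have st: "0 < s" "s < t" "t < 1" "s < u" "u < t" using u by (auto simp: s_def t_def)
  define F where "F w \<sigma> = b (dir_at w) \<sigma> x y" for w \<sigma>
  let ?\<mu> = "busemann_measure b x y (dir_at ` {s..t})"
  have K: "dir_Icc (dir_at s) (dir_at t) = dir_at ` {s..t}" using st by (intro dir_Icc_dir_at) auto
  have "signed_support (dir_Icc (dir_at s) (dir_at t)) (busemann_measure b x y (dir_Icc (dir_at s) (dir_at t)))
      \<subseteq> busemann_support b x y"
    unfolding busemann_support_def
    by (rule Union_upper, rule CollectI, intro exI conjI refl) (use st in auto)
  then have "dir_at u \<notin> signed_support (dir_at ` {s..t}) ?\<mu>"
    using notin unfolding K by blast
  then obtain V where V: "open V" "dir_at u \<in> V"
    "\<And>C. C \<in> sets (restrict_space borel (dir_at ` {s..t})) \<Longrightarrow> C \<subseteq> V \<Longrightarrow> ?\<mu> C = 0"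
    using st unfolding signed_support_busemann_measure[OF st(1-3)] by auto
  have "open (dir_at -` V)" by (intro open_vimage V(1) continuous_dir_at)
  then obtain e where e: "e > 0" "ball u e \<subseteq> dir_at -` V"
    using V(2) openE[of "dir_at -` V" u] by auto
  define a where "a = max s (u - e)"
  define c where "c = min t (u + e)"
  have ac: "a < u" "u < c" "s \<le> a" "c \<le> t" "u - e \<le> a" "c \<le> u + e"
    using e st by (auto simp: a_def c_def)
  have in_V: "dir_at w \<in> V" if "a < w" "w < c" for w
    using that ac e(2) by (auto simp: subset_eq dist_real_def)
  have charge: "?\<mu> (dir_at ` {w<..z}) = F z Plus - F w Plus \<and> ?\<mu> (dir_at ` {w..<z}) = F z Minus - F w Minus"
    if "s \<le> w" "w < z" "z \<le> t" for w z
    using interval_charge_busemann_measure[OF st(1-3), of x y] that st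
    unfolding F_def by (subst (asm) interval_charge_segment) auto
  have eq: "F w \<sigma> = F z \<sigma>" if wz: "a < w" "w < z" "z < c" for w z \<sigma>
  proof -
    have "?\<mu> (dir_at ` {w<..z}) = 0" "?\<mu> (dir_at ` {w..<z}) = 0"
      using wz ac in_V by (auto intro!: V(3) dir_at_image_in_segment)
    then show ?thesis using charge[of w z] wz ac by (cases \<sigma>) auto
  qed
  have signs: "F w Minus = F w Plus" if w: "a < w" "w < c" for w
  proof -
    have "\<forall>\<^sub>F z in at_left w. z \<in> {a<..<w}" using w by (intro eventually_at_left_real)
    then have "\<forall>\<^sub>F z in at_left w. F z Plus = F w Plus"
      by eventually_elim (use w in \<open>auto intro: eq\<close>)
    then have "((\<lambda>z. F z Plus) \<longlongrightarrow> F w Plus) (at_left w)" by (rule tendsto_eventually)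
    moreover have "((\<lambda>z. F z Plus) \<longlongrightarrow> F w Minus) (at_left w)"
      unfolding F_def using w ac st by (intro b_left) auto
    ultimately show ?thesis using tendsto_unique[OF trivial_limit_at_left_real] by metis
  qed
  have "F w \<sigma> = F u Plus" if w: "a < w" "w < c" for w \<sigma>
  proof -
    have "F w Plus = F u Plus"
    proof (cases w u rule: linorder_cases)
      case less
      show ?thesis by (rule eq[OF w(1) less ac(2)])
    next
      case greater
      show ?thesis by (rule eq[OF ac(1) greater w(2), symmetric])
    qed simp
    then show ?thesis using signs[OF w] by (cases \<sigma>) auto
  qed
  then have "\<forall>w\<in>{a<..<c} \<inter> {0<..<1}. \<forall>\<sigma>. b (dir_at w) \<sigma> x y = F u Plus"
    unfolding F_def by simp
  then show ?thesis unfolding flat_at_def using ac(1,2) by blast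
qed

lemma in_support_iff:
  "\<xi> \<in> busemann_support b x y \<longleftrightarrow> (\<exists>u. 0 < u \<and> u < 1 \<and> \<xi> = dir_at u \<and> \<not> flat_at (\<lambda>\<xi> \<sigma>. b \<xi> \<sigma> x y) u)"
proof
  assume "\<xi> \<in> busemann_support b x y"
  then obtain s t where st: "0 < s" "s < t" "t < 1"
    and \<xi>: "\<xi> \<in> signed_support (dir_Icc (dir_at s) (dir_at t)) (busemann_measure b x y (dir_Icc (dir_at s) (dir_at t)))"
    unfolding busemann_support_def ri_dirs_eq by auto
  have "dir_Icc (dir_at s) (dir_at t) = dir_at ` {s..t}" using st by (intro dir_Icc_dir_at) auto
  with \<xi> have \<xi>: "\<xi> \<in> signed_support (dir_at ` {s..t}) (busemann_measure b x y (dir_at ` {s..t}))" by simp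
  then obtain u where u: "\<xi> = dir_at u" "s \<le> u" "u \<le> t"
    unfolding signed_support_busemann_measure[OF st] by auto
  have "\<not> flat_at (\<lambda>\<xi> \<sigma>. b \<xi> \<sigma> x y) u"
    using \<xi> not_in_support_if_flat[OF st u(2,3)] unfolding u(1) by blast
  then show "\<exists>u. 0 < u \<and> u < 1 \<and> \<xi> = dir_at u \<and> \<not> flat_at (\<lambda>\<xi> \<sigma>. b \<xi> \<sigma> x y) u"
    using u st by (intro exI[of _ u]) auto
next
  assume "\<exists>u. 0 < u \<and> u < 1 \<and> \<xi> = dir_at u \<and> \<not> flat_at (\<lambda>\<xi> \<sigma>. b \<xi> \<sigma> x y) u"
  then show "\<xi> \<in> busemann_support b x y" using flat_if_not_in_support by blast
qed

section \<open>From isolated support points to coalescence\<close>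

lemma coalescence_if_isolated:
  assumes isolated: "\<And>x y \<xi>. \<xi> \<in> busemann_support b x y \<Longrightarrow> \<xi> isolated_in busemann_support b x y"
    and rational: "\<And>q \<sigma> x y. q \<in> \<rat> \<Longrightarrow> 0 < q \<Longrightarrow> q < 1 \<Longrightarrow> meets (tie_step \<sigma> (b (dir_at q) \<sigma>)) x y"
    and u: "0 < u" "u < 1"
  shows "meets (tie_step \<sigma> (b (dir_at u) \<sigma>)) x y"
proof (rule meets_all_if_neighbours[OF up_right_tie_step])
  fix x :: site
  let ?y = "x + (1, -1)"
  define f where "f w \<sigma> = b (dir_at w) \<sigma> x ?y" for w \<sigma>
  \<comment> \<open>If \<open>u\<close> lies in the support, isolation clears a punctured
    neighbourhood of it; otherwise flatness at \<open>u\<close> carries over to all points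
    nearby.\<close>
  obtain e where e: "e > 0" and flat: "\<And>w. w \<noteq> u \<Longrightarrow> \<bar>w - u\<bar> < e \<Longrightarrow> 0 < w \<Longrightarrow> w < 1 \<Longrightarrow>
      flat_at (\<lambda>\<xi> \<sigma>. b \<xi> \<sigma> x ?y) w"
  proof (cases "dir_at u \<in> busemann_support b x ?y")
    case True
    then have "dir_at u isolated_in busemann_support b x ?y" by (rule isolated)
    then obtain U where U: "open U" "U \<inter> busemann_support b x ?y = {dir_at u}"
      unfolding isolated_in_def by blast
    have "open (dir_at -` U)" by (intro open_vimage U(1) continuous_dir_at)
    then obtain e where e: "e > 0" "ball u e \<subseteq> dir_at -` U"
      using U(2) openE[of "dir_at -` U" u] by auto
    have "flat_at (\<lambda>\<xi> \<sigma>. b \<xi> \<sigma> x ?y) w"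
      if "w \<noteq> u" "\<bar>w - u\<bar> < e" "0 < w" "w < 1" for w
    proof -
      have "dir_at w \<in> U" using that e(2) by (auto simp: subset_eq dist_real_def)
      moreover have "dir_at w \<notin> {dir_at u}" using that(1) by simp
      ultimately have "dir_at w \<notin> busemann_support b x ?y" unfolding U(2)[symmetric] by blast
      then show ?thesis by (rule flat_if_not_in_support[OF that(3,4)])
    qed
    then show ?thesis by (rule that[OF e(1)])
  next
    case False
    then obtain a c r where ac: "a < u" "u < c"
      "\<And>w \<sigma>. a < w \<Longrightarrow> w < c \<Longrightarrow> 0 < w \<Longrightarrow> w < 1 \<Longrightarrow> b (dir_at w) \<sigma> x ?y = r"
      using flat_if_not_in_support[OF u] unfolding flat_at_def by fastforce
    have "flat_at (\<lambda>\<xi> \<sigma>. b \<xi> \<sigma> x ?y) w" if "\<bar>w - u\<bar> < min (u - a) (c - u)" for w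
      unfolding flat_at_def using that ac by (intro exI[of _ a] exI[of _ c] exI[of _ r]) auto
    then show ?thesis using that[of "min (u - a) (c - u)"] ac by auto
  qed
  \<comment> \<open>On an interval to one side of \<open>u\<close>, local constancy is constancy by
    connectedness. The values on the two sides may differ.\<close>
  have const: "f p \<tau> = f q \<tau>" if A: "A = {u<..<min 1 (u + e)} \<or> A = {max 0 (u - e)<..<u}" "p \<in> A" "q \<in> A" for A p q \<tau>
  proof (rule connected_local_const[of A p q "\<lambda>w. f w \<tau>"])
    show "connected A" using A(1) by auto
    show "\<forall>w\<in>A. \<forall>\<^sub>F z in at w within A. f w \<tau> = f z \<tau>"
    proof
      fix w assume "w \<in> A"
      then have w: "w \<noteq> u" "\<bar>w - u\<bar> < e" "0 < w" "w < 1" using A(1) u by auto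
      obtain a c r where ac: "a < w" "w < c"
        "\<And>z \<sigma>. a < z \<Longrightarrow> z < c \<Longrightarrow> 0 < z \<Longrightarrow> z < 1 \<Longrightarrow> f z \<sigma> = r"
        using flat[OF w] unfolding flat_at_def f_def by fastforce
      have "\<forall>\<^sub>F z in nhds w. z \<in> {max a 0<..<min c 1}"
        using ac w by (intro eventually_nhds_in_open) auto
      then have "\<forall>\<^sub>F z in nhds w. f w \<tau> = f z \<tau>"
        by eventually_elim (use ac w in auto)
      then show "\<forall>\<^sub>F z in at w within A. f w \<tau> = f z \<tau>"
        unfolding eventually_at_filter by eventually_elim simp
    qed
  qed (use A in auto)
  show "meets (tie_step \<sigma> (b (dir_at u) \<sigma>)) x ?y"
  proof (cases \<sigma>)
    case Plus
    have "u < min 1 (u + e)" using u e by simp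
    then obtain q where q: "q \<in> \<rat>" "u < q" "q < min 1 (u + e)" using Rats_dense_in_real by blast
    have "\<forall>\<^sub>F w in at_right u. w \<in> {u<..<min 1 (u + e)}"
      using u e by (intro eventually_at_right_real) auto
    then have "\<forall>\<^sub>F w in at_right u. f w Plus = f q Plus"
      by eventually_elim (rule const[OF disjI1[OF refl]], use q in auto)
    then have "((\<lambda>w. f w Plus) \<longlongrightarrow> f q Plus) (at_right u)" by (rule tendsto_eventually)
    moreover have "((\<lambda>w. f w Plus) \<longlongrightarrow> f u Plus) (at_right u)"
      unfolding f_def by (rule b_right[OF u])
    ultimately have eq: "f u Plus = f q Plus"
      using tendsto_unique[OF trivial_limit_at_right_real] by metis
    let ?\<beta> = "b (dir_at u) Plus" and ?\<beta>' = "b (dir_at q) Plus"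
    have rec: "recovers v ?\<beta>" "recovers v ?\<beta>'" using u q by (auto intro: b_recovers)
    have mono: "?\<beta>' z (z + e\<^sub>1) \<le> ?\<beta> z (z + e\<^sub>1)" "?\<beta> z (z + e\<^sub>2) \<le> ?\<beta>' z (z + e\<^sub>2)" for z
      using u q by (auto intro: b_antimono_1 b_mono_2)
    have min: "min (?\<beta> z (z + e\<^sub>1)) (?\<beta> z (z + e\<^sub>2)) = v z"
      "min (?\<beta>' z (z + e\<^sub>1)) (?\<beta>' z (z + e\<^sub>2)) = v z" for z
      using rec unfolding recovers_def by blast+
    have "meets (tie_step Plus ?\<beta>) x ?y"
    proof (rule meets_if_cocycles_agree[where \<beta>' = ?\<beta>' and s' = "tie_step Plus ?\<beta>'"])
      \<comment> \<open>If the step at \<open>q\<close> goes up, its strict inequality persists at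
        \<open>u\<close> by monotonicity. If it goes right, the sign \<open>Plus\<close> resolves a
        possible tie at \<open>u\<close> in the same way.\<close>
      show "tie_step Plus ?\<beta> z = tie_step Plus ?\<beta>' z" if "?\<beta> z (tie_step Plus ?\<beta>' z) = v z" for z
        using that mono[of z] min[of z] by (auto simp: tie_step_def min_def split: if_splits)
      show "(\<forall>z. tie_step Plus ?\<beta> z = z + e\<^sub>1 \<longrightarrow> tie_step Plus ?\<beta>' z = z + e\<^sub>1) \<or>
          (\<forall>z. tie_step Plus ?\<beta>' z = z + e\<^sub>1 \<longrightarrow> tie_step Plus ?\<beta> z = z + e\<^sub>1)"
      proof (intro disjI1 allI impI)
        fix z assume "tie_step Plus ?\<beta> z = z + e\<^sub>1"
        then have "?\<beta> z (z + e\<^sub>1) \<le> ?\<beta> z (z + e\<^sub>2)" by (simp add: tie_step_Plus e1_neq_e2[symmetric] split: if_splits)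
        then have "?\<beta>' z (z + e\<^sub>1) \<le> ?\<beta>' z (z + e\<^sub>2)" using mono[of z] by linarith
        then show "tie_step Plus ?\<beta>' z = z + e\<^sub>1" by (simp add: tie_step_Plus)
      qed
    qed (use rec q u eq in \<open>auto simp: f_def level_def up_right_tie_step tie_step_tight intro!: rational\<close>)
    then show ?thesis using Plus by simp
  next
    case Minus
    have "max 0 (u - e) < u" using u e by simp
    then obtain q where q: "q \<in> \<rat>" "max 0 (u - e) < q" "q < u" using Rats_dense_in_real by blast
    have "\<forall>\<^sub>F w in at_left u. w \<in> {max 0 (u - e)<..<u}"
      using u e by (intro eventually_at_left_real) auto
    then have "\<forall>\<^sub>F w in at_left u. f w Minus = f q Minus"
      by eventually_elim (rule const[OF disjI2[OF refl]], use q in auto)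
    then have "((\<lambda>w. f w Minus) \<longlongrightarrow> f q Minus) (at_left u)" by (rule tendsto_eventually)
    moreover have "((\<lambda>w. f w Minus) \<longlongrightarrow> f u Minus) (at_left u)"
      unfolding f_def by (rule b_left[OF u])
    ultimately have eq: "f u Minus = f q Minus"
      using tendsto_unique[OF trivial_limit_at_left_real] by metis
    let ?\<beta> = "b (dir_at u) Minus" and ?\<beta>' = "b (dir_at q) Minus"
    have rec: "recovers v ?\<beta>" "recovers v ?\<beta>'" using u q by (auto intro: b_recovers)
    have mono: "?\<beta> z (z + e\<^sub>1) \<le> ?\<beta>' z (z + e\<^sub>1)" "?\<beta>' z (z + e\<^sub>2) \<le> ?\<beta> z (z + e\<^sub>2)" for z
      using u q by (auto intro: b_antimono_1 b_mono_2)
    have min: "min (?\<beta> z (z + e\<^sub>1)) (?\<beta> z (z + e\<^sub>2)) = v z"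
      "min (?\<beta>' z (z + e\<^sub>1)) (?\<beta>' z (z + e\<^sub>2)) = v z" for z
      using rec unfolding recovers_def by blast+
    have "meets (tie_step Minus ?\<beta>) x ?y"
    proof (rule meets_if_cocycles_agree[where \<beta>' = ?\<beta>' and s' = "tie_step Minus ?\<beta>'"])
      \<comment> \<open>Mirrored: a step to the right at \<open>q\<close> is strict and persists at
        \<open>u\<close>, and the sign \<open>Minus\<close> resolves a tie at \<open>u\<close>
        upward.\<close>
      show "tie_step Minus ?\<beta> z = tie_step Minus ?\<beta>' z" if "?\<beta> z (tie_step Minus ?\<beta>' z) = v z" for z
        using that mono[of z] min[of z] by (auto simp: tie_step_def min_def split: if_splits)
      show "(\<forall>z. tie_step Minus ?\<beta> z = z + e\<^sub>1 \<longrightarrow> tie_step Minus ?\<beta>' z = z + e\<^sub>1) \<or>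
          (\<forall>z. tie_step Minus ?\<beta>' z = z + e\<^sub>1 \<longrightarrow> tie_step Minus ?\<beta> z = z + e\<^sub>1)"
      proof (intro disjI2 allI impI)
        fix z assume "tie_step Minus ?\<beta>' z = z + e\<^sub>1"
        then have "?\<beta>' z (z + e\<^sub>1) < ?\<beta>' z (z + e\<^sub>2)" by (simp add: tie_step_Minus e1_neq_e2[symmetric] split: if_splits)
        then have "?\<beta> z (z + e\<^sub>1) < ?\<beta> z (z + e\<^sub>2)" using mono[of z] by linarith
        then show "tie_step Minus ?\<beta> z = z + e\<^sub>1" by (simp add: tie_step_Minus)
      qed
    qed (use rec q u eq in \<open>auto simp: f_def level_def up_right_tie_step tie_step_tight intro!: rational\<close>)
    then show ?thesis using Minus by simp
  qed
qed

section \<open>From coalescence to isolated support points\<close>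

lemma eventually_constant:
  assumes steps: "\<And>z. \<forall>\<^sub>F w in \<F>. \<forall>\<sigma>. tie_step \<sigma> (b (dir_at w) \<sigma>) z = s z"
    and unit: "\<forall>\<^sub>F w in \<F>. w \<in> {0<..<1}"
    and "meets s x y"
  obtains r where "\<forall>\<^sub>F w in \<F>. \<forall>\<sigma>. b (dir_at w) \<sigma> x y = r"
proof -
  \<comment> \<open>A path of length \<open>n\<close> visits finitely many sites, so eventually all
    its steps are those of \<open>s\<close>. Up to the meeting point the cocycle is then a
    difference of path sums that do not depend on \<open>w\<close>.\<close>
  have paths: "\<forall>\<^sub>F w in \<F>. \<forall>\<sigma>. \<forall>i\<le>n. (tie_step \<sigma> (b (dir_at w) \<sigma>) ^^ i) z = (s ^^ i) z" for n z
  proof (induction n)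
    case (Suc n)
    from Suc steps[of "(s ^^ n) z"] show ?case
      by eventually_elim (auto simp: le_Suc_eq)
  qed simp
  obtain m n where mn: "(s ^^ m) x = (s ^^ n) y" using \<open>meets s x y\<close> unfolding meets_def by blast
  from paths[of m x] paths[of n y] unit
  have "\<forall>\<^sub>F w in \<F>. \<forall>\<sigma>. b (dir_at w) \<sigma> x y = (\<Sum>i<m. v ((s ^^ i) x)) - (\<Sum>i<n. v ((s ^^ i) y))"
  proof eventually_elim
    case (elim w)
    show ?case
    proof
      fix \<sigma>
      let ?\<beta> = "b (dir_at w) \<sigma>" and ?s = "tie_step \<sigma> (b (dir_at w) \<sigma>)"
      have rec: "recovers v ?\<beta>" using elim(3) by (auto intro: b_recovers)
      have x: "?\<beta> x ((s ^^ m) x) = (\<Sum>i<m. v ((s ^^ i) x))"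
        using path_sum_eq[OF rec, where s = ?s and x = x and n = m] tie_step_tight[OF rec] elim(1) by simp
      have y: "?\<beta> y ((s ^^ m) x) = (\<Sum>i<n. v ((s ^^ i) y))"
        using path_sum_eq[OF rec, where s = ?s and x = y and n = n] tie_step_tight[OF rec] elim(2) mn by simp
      show "?\<beta> x y = (\<Sum>i<m. v ((s ^^ i) x)) - (\<Sum>i<n. v ((s ^^ i) y))"
        using recovers_add[OF rec, of x y "(s ^^ m) x"] x y by simp
    qed
  qed
  then show ?thesis by (rule that)
qed

text \<open>If the step in direction \<open>dir_at u\<close> is \<open>e\<^sub>1\<close> and the increments tie in a direction further to the
  right, then by monotonicity they tie in all rational directions in between.\<close>

lemma steps_right:
  assumes no_ties: "\<And>q \<sigma> x. q \<in> \<rat> \<Longrightarrow> 0 < q \<Longrightarrow> q < 1 \<Longrightarrow> b (dir_at q) \<sigma> x (x + e\<^sub>1) \<noteq> b (dir_at q) \<sigma> x (x + e\<^sub>2)"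
    and u: "0 < u" "u < 1"
  shows "\<forall>\<^sub>F w in at_right u. \<forall>\<sigma>. tie_step \<sigma> (b (dir_at w) \<sigma>) z = tie_step Plus (b (dir_at u) Plus) z"
proof (cases "b (dir_at u) Plus z (z + e\<^sub>1) \<le> b (dir_at u) Plus z (z + e\<^sub>2)")
  case True
  have "\<forall>\<^sub>F w in at_right u. w \<in> {u<..<1}" using u by (intro eventually_at_right_real)
  then show ?thesis
  proof eventually_elim
    case (elim w)
    then obtain q where q: "q \<in> \<rat>" "u < q" "q < w" using Rats_dense_in_real[of u w] by auto
    have "b (dir_at w) \<sigma> z (z + e\<^sub>1) < b (dir_at w) \<sigma> z (z + e\<^sub>2)" for \<sigma>
    proof -
      have "b (dir_at w) \<sigma> z (z + e\<^sub>1) \<le> b (dir_at q) Plus z (z + e\<^sub>1)"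
        "b (dir_at q) Plus z (z + e\<^sub>1) \<le> b (dir_at u) Plus z (z + e\<^sub>1)"
        "b (dir_at u) Plus z (z + e\<^sub>2) \<le> b (dir_at q) Plus z (z + e\<^sub>2)"
        "b (dir_at q) Plus z (z + e\<^sub>2) \<le> b (dir_at w) \<sigma> z (z + e\<^sub>2)"
        using q elim u by (auto intro!: b_antimono_1 b_mono_2)
      then show ?thesis using True no_ties[of q Plus z] q elim u by auto
    qed
    then show ?case using True by (auto simp: tie_step_def)
  qed
next
  case False
  have "\<forall>\<^sub>F w in at_right u. b (dir_at w) \<sigma> z (z + e\<^sub>2) < b (dir_at w) \<sigma> z (z + e\<^sub>1)" for \<sigma>
  proof -
    have "((\<lambda>w. b (dir_at w) \<sigma> z (z + e\<^sub>1) - b (dir_at w) \<sigma> z (z + e\<^sub>2)) \<longlongrightarrow>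
        b (dir_at u) Plus z (z + e\<^sub>1) - b (dir_at u) Plus z (z + e\<^sub>2)) (at_right u)"
      by (intro tendsto_diff b_right u)
    from order_tendstoD(1)[OF this, of 0] show ?thesis using False by simp
  qed
  from this[of Plus] this[of Minus] show ?thesis
  proof eventually_elim
    case (elim w)
    then have "b (dir_at w) \<sigma> z (z + e\<^sub>2) < b (dir_at w) \<sigma> z (z + e\<^sub>1)" for \<sigma> by (cases \<sigma>) auto
    then show ?case using False by (auto simp: tie_step_def dest: less_asym)
  qed
qed

text \<open>Mirror image of \<open>steps_right\<close>: a step \<open>e\<^sub>2\<close> is
  stabilized by the absence of ties in rational directions, a step \<open>e\<^sub>1\<close> by the
  left limit.\<close>

lemma steps_left:
  assumes no_ties: "\<And>q \<sigma> x. q \<in> \<rat> \<Longrightarrow> 0 < q \<Longrightarrow> q < 1 \<Longrightarrow> b (dir_at q) \<sigma> x (x + e\<^sub>1) \<noteq> b (dir_at q) \<sigma> x (x + e\<^sub>2)"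
    and u: "0 < u" "u < 1"
  shows "\<forall>\<^sub>F w in at_left u. \<forall>\<sigma>. tie_step \<sigma> (b (dir_at w) \<sigma>) z = tie_step Minus (b (dir_at u) Minus) z"
proof (cases "b (dir_at u) Minus z (z + e\<^sub>2) \<le> b (dir_at u) Minus z (z + e\<^sub>1)")
  case True
  have "\<forall>\<^sub>F w in at_left u. w \<in> {0<..<u}" using u by (intro eventually_at_left_real)
  then show ?thesis
  proof eventually_elim
    case (elim w)
    then obtain q where q: "q \<in> \<rat>" "w < q" "q < u" using Rats_dense_in_real[of w u] by auto
    have "b (dir_at w) \<sigma> z (z + e\<^sub>2) < b (dir_at w) \<sigma> z (z + e\<^sub>1)" for \<sigma>
    proof -
      have "b (dir_at u) Minus z (z + e\<^sub>1) \<le> b (dir_at q) Plus z (z + e\<^sub>1)"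
        "b (dir_at q) Plus z (z + e\<^sub>1) \<le> b (dir_at w) \<sigma> z (z + e\<^sub>1)"
        "b (dir_at w) \<sigma> z (z + e\<^sub>2) \<le> b (dir_at q) Plus z (z + e\<^sub>2)"
        "b (dir_at q) Plus z (z + e\<^sub>2) \<le> b (dir_at u) Minus z (z + e\<^sub>2)"
        using q elim u by (auto intro!: b_antimono_1 b_mono_2)
      then show ?thesis using True no_ties[of q Plus z] q elim u by auto
    qed
    then show ?case using True by (auto simp: tie_step_def dest: less_asym)
  qed
next
  case False
  have "\<forall>\<^sub>F w in at_left u. b (dir_at w) \<sigma> z (z + e\<^sub>1) < b (dir_at w) \<sigma> z (z + e\<^sub>2)" for \<sigma>
  proof -
    have "((\<lambda>w. b (dir_at w) \<sigma> z (z + e\<^sub>2) - b (dir_at w) \<sigma> z (z + e\<^sub>1)) \<longlongrightarrow>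
        b (dir_at u) Minus z (z + e\<^sub>2) - b (dir_at u) Minus z (z + e\<^sub>1)) (at_left u)"
      by (intro tendsto_diff b_left u)
    from order_tendstoD(1)[OF this, of 0] show ?thesis using False by simp
  qed
  from this[of Plus] this[of Minus] show ?thesis
  proof eventually_elim
    case (elim w)
    then have "b (dir_at w) \<sigma> z (z + e\<^sub>1) < b (dir_at w) \<sigma> z (z + e\<^sub>2)" for \<sigma> by (cases \<sigma>) auto
    then show ?case using False by (auto simp: tie_step_def)
  qed
qed

text \<open>By \<open>eventually_constant\<close> the Busemann function is constant close to
  \<open>u\<close> on either side, with constants that may differ by a jump at \<open>u\<close>.
  Every other nearby point has a neighbourhood within one side and is flat.\<close>

lemma isolated_if_coalescence:
  assumes coalescence: "\<And>u \<sigma> x y. 0 < u \<Longrightarrow> u < 1 \<Longrightarrow> meets (tie_step \<sigma> (b (dir_at u) \<sigma>)) x y"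
    and no_ties: "\<And>q \<sigma> x. q \<in> \<rat> \<Longrightarrow> 0 < q \<Longrightarrow> q < 1 \<Longrightarrow> b (dir_at q) \<sigma> x (x + e\<^sub>1) \<noteq> b (dir_at q) \<sigma> x (x + e\<^sub>2)"
    and \<xi>: "\<xi> \<in> busemann_support b x y"
  shows "\<xi> isolated_in busemann_support b x y"
proof -
  obtain u where u: "0 < u" "u < 1" "\<xi> = dir_at u" using \<xi> unfolding in_support_iff by blast
  have "\<forall>\<^sub>F w in at_right u. w \<in> {u<..<1}" using u(2) by (rule eventually_at_right_real)
  then have unit: "\<forall>\<^sub>F w in at_right u. w \<in> {0<..<1}" by eventually_elim (use u in auto)
  obtain r where "\<forall>\<^sub>F w in at_right u. \<forall>\<sigma>. b (dir_at w) \<sigma> x y = r"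
    by (rule eventually_constant[OF steps_right[OF no_ties u(1,2)] unit coalescence[OF u(1,2)]])
  then obtain c where c: "u < c" "\<And>w \<sigma>. u < w \<Longrightarrow> w < c \<Longrightarrow> b (dir_at w) \<sigma> x y = r"
    unfolding eventually_at_right_field by blast
  have "\<forall>\<^sub>F w in at_left u. w \<in> {0<..<u}" using u(1) by (rule eventually_at_left_real)
  then have unit': "\<forall>\<^sub>F w in at_left u. w \<in> {0<..<1}" by eventually_elim (use u in auto)
  obtain r' where "\<forall>\<^sub>F w in at_left u. \<forall>\<sigma>. b (dir_at w) \<sigma> x y = r'"
    by (rule eventually_constant[OF steps_left[OF no_ties u(1,2)] unit' coalescence[OF u(1,2)]])
  then obtain a where a: "a < u" "\<And>w \<sigma>. a < w \<Longrightarrow> w < u \<Longrightarrow> b (dir_at w) \<sigma> x y = r'"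
    unfolding eventually_at_left_field by blast
  let ?U = "fst -` {a<..<c} :: direction set"
  have "open ?U" by (rule open_vimage_fst) simp
  moreover have "?U \<inter> busemann_support b x y = {\<xi>}"
  proof (intro equalityI subsetI)
    fix \<eta> assume \<eta>: "\<eta> \<in> ?U \<inter> busemann_support b x y"
    then obtain w where w: "\<eta> = dir_at w" "\<not> flat_at (\<lambda>\<xi> \<sigma>. b \<xi> \<sigma> x y) w"
      using in_support_iff by blast
    have "a < w" "w < c" using \<eta> w(1) by auto
    note w = w this
    have "w = u"
    proof (rule ccontr)
      assume "w \<noteq> u"
      then consider "w < u" | "u < w" by linarith
      then have "flat_at (\<lambda>\<xi> \<sigma>. b \<xi> \<sigma> x y) w"
      proof cases
        case 1
        then show ?thesis unfolding flat_at_def using a(2) w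
          by (intro exI[of _ a] exI[of _ u] exI[of _ r']) auto
      next
        case 2
        then show ?thesis unfolding flat_at_def using c(2) w
          by (intro exI[of _ u] exI[of _ c] exI[of _ r]) auto
      qed
      then show False using w(2) by simp
    qed
    then show "\<eta> \<in> {\<xi>}" using w u by simp
  qed (use \<xi> u a c in auto)
  ultimately show ?thesis using \<xi> unfolding isolated_in_def by blast
qed

end

lemma busemann_function_if_regular:
  assumes reg: "busemann_regular T w B \<omega>"
  shows "busemann_function (\<lambda>\<xi> \<sigma> x y. B \<xi> \<sigma> x y \<omega>) (\<lambda>x. w x \<omega>)"
proof
  show "recovers (\<lambda>x. w x \<omega>) (\<lambda>x y. B \<xi> \<sigma> x y \<omega>)" if "\<xi> \<in> ri_dirs" for \<xi> \<sigma>
    using reg that unfolding busemann_regular_def recovers_def by blast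
next
  fix s t :: real and x assume "0 < s" "s < t" "t < 1"
  then have "dir_at s \<in> ri_dirs" "dir_at t \<in> ri_dirs" "dir_less (dir_at s) (dir_at t)" by auto
  then show "B (dir_at s) Minus x (x + e\<^sub>1) \<omega> \<ge> B (dir_at s) Plus x (x + e\<^sub>1) \<omega> \<and>
      B (dir_at s) Plus x (x + e\<^sub>1) \<omega> \<ge> B (dir_at t) Minus x (x + e\<^sub>1) \<omega> \<and>
      B (dir_at t) Minus x (x + e\<^sub>1) \<omega> \<ge> B (dir_at t) Plus x (x + e\<^sub>1) \<omega> \<and>
      B (dir_at s) Minus x (x + e\<^sub>2) \<omega> \<le> B (dir_at s) Plus x (x + e\<^sub>2) \<omega> \<and>
      B (dir_at s) Plus x (x + e\<^sub>2) \<omega> \<le> B (dir_at t) Minus x (x + e\<^sub>2) \<omega> \<and>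
      B (dir_at t) Minus x (x + e\<^sub>2) \<omega> \<le> B (dir_at t) Plus x (x + e\<^sub>2) \<omega>"
    using reg unfolding busemann_regular_def by blast
next
  fix t :: real and \<sigma> x y assume t: "0 < t" "t < 1"
  then have "dir_at t \<in> ri_dirs" by simp
  then have lims: "((\<lambda>\<zeta>. B \<zeta> \<sigma> x y \<omega>) \<longlongrightarrow> B (dir_at t) Minus x y \<omega>) (dir_at_left (dir_at t))"
    "((\<lambda>\<zeta>. B \<zeta> \<sigma> x y \<omega>) \<longlongrightarrow> B (dir_at t) Plus x y \<omega>) (dir_at_right (dir_at t))"
    using reg unfolding busemann_regular_def by blast+
  show "((\<lambda>s. B (dir_at s) \<sigma> x y \<omega>) \<longlongrightarrow> B (dir_at t) Minus x y \<omega>) (at_left t)"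
    by (rule filterlim_compose[OF lims(1) filterlim_dir_at_left[OF t]])
  show "((\<lambda>s. B (dir_at s) \<sigma> x y \<omega>) \<longlongrightarrow> B (dir_at t) Plus x y \<omega>) (at_right t)"
    by (rule filterlim_compose[OF lims(2) filterlim_dir_at_right[OF t]])
qed

section \<open>The equivalence\<close>

lemma (in prob_space) indep_set_mono:
  "indep_set A B \<Longrightarrow> A' \<subseteq> A \<Longrightarrow> B' \<subseteq> B \<Longrightarrow> indep_set A' B'"
  unfolding indep_sets2_eq by blast

context busemann_process
begin

lemma AE_regular: "AE \<omega> in M. busemann_regular T w B \<omega>"
proof -
  obtain E where "E \<in> events" "prob E = 1" "\<forall>\<omega>\<in>E. busemann_regular T w B \<omega>"
    using B_regular by blast
  then show ?thesis using AE_prob_1[of E] by auto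
qed

lemma recovering_cocycle_B:
  assumes \<xi>: "\<xi> \<in> ri_dirs" shows "recovering_cocycle M T w (B \<xi> \<sigma>)"
proof
  show "B \<xi> \<sigma> x y \<in> borel_measurable M" for x y
    using B_integrable[OF \<xi>] by (rule borel_measurable_integrable)
  show "AE \<omega> in M. \<forall>x y z. B \<xi> \<sigma> (x + z) (y + z) \<omega> = B \<xi> \<sigma> x y (T z \<omega>)"
    using AE_regular by eventually_elim (use \<xi> in \<open>simp add: busemann_regular_def\<close>)
  show "AE \<omega> in M. recovers (\<lambda>x. w x \<omega>) (\<lambda>x y. B \<xi> \<sigma> x y \<omega>)"
    using AE_regular
  proof eventually_elim
    case (elim \<omega>)
    then interpret busemann_function "\<lambda>\<xi> \<sigma> x y. B \<xi> \<sigma> x y \<omega>" "\<lambda>x. w x \<omega>"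
      by (rule busemann_function_if_regular)
    show ?case using \<xi> by (rule b_recovers)
  qed
  \<comment> \<open>Levels are monotone in the coordinatewise order, so no site of negative level
    dominates a site of this half-plane.\<close>
  let ?I = "{x :: site. 0 \<le> level x}"
  have level_mono: "level z \<le> level x" if "z \<le> x" for z x
    using that by (simp add: level_def less_eq_prod_def)
  show "indep_set (generated_sets M {B \<xi> \<sigma> x y | x y. 0 \<le> level x \<and> x \<le> y})
      (generated_sets M {w x | x. level x < 0})"
  proof (rule indep_set_mono[OF B_indep[of ?I]]; rule generated_sets_mono)
    show "{B \<xi> \<sigma> x y | x y. 0 \<le> level x \<and> x \<le> y} \<subseteq>
      w ` ?I \<union> {B \<xi> \<sigma> x y | \<xi> \<sigma> x y. \<xi> \<in> ri_dirs \<and> x \<in> ?I \<and> x \<le> y}"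
      using \<xi> by blast
    show "{w x | x. level x < 0} \<subseteq> {w x | x. \<forall>z\<in>?I. \<not> z \<le> x}"
    proof
      fix X assume "X \<in> {w x | x. level x < 0}"
      then obtain x where x: "X = w x" "level x < 0" by blast
      have "\<not> z \<le> x" if "z \<in> ?I" for z using level_mono[of z x] x(2) that by auto
      then show "X \<in> {w x | x. \<forall>z\<in>?I. \<not> z \<le> x}" using x(1) by blast
    qed
  qed
qed

text \<open>The null set of \<open>AE_meets\<close> depends on the direction, but countably many
  directions share one. Rational directions are dense, which suffices for the comparisons with
  arbitrary directions.\<close>

lemma AE_rational_coalescence:
  "AE \<omega> in M. \<forall>q\<in>\<rat> \<inter> {0<..<1}. \<forall>\<sigma> x y. meets (tie_step \<sigma> (\<lambda>x y. B (dir_at q) \<sigma> x y \<omega>)) x y"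
proof (subst AE_ball_countable)
  show "countable (\<rat> \<inter> {0<..<1} :: real set)" by (simp add: countable_rat)
  show "\<forall>q\<in>\<rat> \<inter> {0<..<1}. AE \<omega> in M. \<forall>\<sigma> x y. meets (tie_step \<sigma> (\<lambda>x y. B (dir_at q) \<sigma> x y \<omega>)) x y"
  proof
    fix q :: real assume q: "q \<in> \<rat> \<inter> {0<..<1}"
    have "AE \<omega> in M. \<forall>x y. meets (tie_step \<sigma> (\<lambda>x y. B (dir_at q) \<sigma> x y \<omega>)) x y" for \<sigma>
    proof -
      interpret recovering_cocycle M T w "B (dir_at q) \<sigma>" \<sigma>
        using q by (intro recovering_cocycle_B) auto
      show ?thesis using AE_meets unfolding step_def .
    qed
    from this[of Plus] this[of Minus]
    show "AE \<omega> in M. \<forall>\<sigma> x y. meets (tie_step \<sigma> (\<lambda>x y. B (dir_at q) \<sigma> x y \<omega>)) x y"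
    proof eventually_elim
      case (elim \<omega>)
      show ?case
      proof
        fix \<sigma> show "\<forall>x y. meets (tie_step \<sigma> (\<lambda>x y. B (dir_at q) \<sigma> x y \<omega>)) x y"
          using elim by (cases \<sigma>) simp_all
      qed
    qed
  qed
qed

lemma AE_rational_no_ties:
  "AE \<omega> in M. \<forall>q\<in>\<rat> \<inter> {0<..<1}. \<forall>\<sigma> x. B (dir_at q) \<sigma> x (x + e\<^sub>1) \<omega> \<noteq> B (dir_at q) \<sigma> x (x + e\<^sub>2) \<omega>"
proof (subst AE_ball_countable)
  show "\<forall>q\<in>\<rat> \<inter> {0<..<1}. AE \<omega> in M. \<forall>\<sigma> x.
      B (dir_at q) \<sigma> x (x + e\<^sub>1) \<omega> \<noteq> B (dir_at q) \<sigma> x (x + e\<^sub>2) \<omega>"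
    by (intro ballI B_no_ties) simp
qed (simp add: countable_rat)

end

theorem theorem3p5:
  fixes M :: "'w::polish_space measure"
    and T :: "site \<Rightarrow> 'w \<Rightarrow> 'w"
    and w :: "site \<Rightarrow> 'w \<Rightarrow> real"
    and g :: "direction \<Rightarrow> real"
    and B :: "direction \<Rightarrow> sign \<Rightarrow> site \<Rightarrow> site \<Rightarrow> 'w \<Rightarrow> real"
  assumes "busemann_process M T w g B"
  shows "(\<exists>E\<in>sets M. measure M E = 1 \<and>
            (\<forall>\<omega>\<in>E. \<forall>x y. \<forall>\<xi>\<in>busemann_support (\<lambda>\<xi> \<sigma> x y. B \<xi> \<sigma> x y \<omega>) x y.
               \<xi> isolated_in busemann_support (\<lambda>\<xi> \<sigma> x y. B \<xi> \<sigma> x y \<omega>) x y))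
     \<longleftrightarrow>
         (AE \<omega> in M. \<forall>x y. \<forall>\<xi>\<in>ri_dirs. \<forall>\<sigma>.
            coalesce (busemann_geodesic (\<lambda>\<xi> \<sigma> x y. B \<xi> \<sigma> x y \<omega>) x \<xi> \<sigma>)
                     (busemann_geodesic (\<lambda>\<xi> \<sigma> x y. B \<xi> \<sigma> x y \<omega>) y \<xi> \<sigma>))"
    (is "?jump \<longleftrightarrow> (AE \<omega> in M. ?coal \<omega>)")
proof -
  interpret busemann_process M T w g B by fact
  let ?b = "\<lambda>\<omega> \<xi> \<sigma> x y. B \<xi> \<sigma> x y \<omega>"
  let ?iso = "\<lambda>\<omega>. \<forall>x y. \<forall>\<xi>\<in>busemann_support (?b \<omega>) x y. \<xi> isolated_in busemann_support (?b \<omega>) x y"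
  have jump: "?jump \<longleftrightarrow> (AE \<omega> in M. ?iso \<omega>)"
  proof
    assume ?jump
    then obtain E where "E \<in> events" "prob E = 1" "\<forall>\<omega>\<in>E. ?iso \<omega>" by blast
    then show "AE \<omega> in M. ?iso \<omega>" using AE_prob_1[of E] by (auto elim!: eventually_mono)
  next
    assume "AE \<omega> in M. ?iso \<omega>"
    \<comment> \<open>The set of bad outcomes need not be measurable, so the event is the complement
      of a measurable null set that contains it.\<close>
    then obtain N where N: "{\<omega>\<in>space M. \<not> ?iso \<omega>} \<subseteq> N" "emeasure M N = 0" "N \<in> events"
      by (rule AE_E)
    have "prob N = 0" using N(2) by (simp add: measure_def)
    then have "prob (space M - N) = 1" using prob_compl[OF N(3)] by simp
    moreover have "\<forall>\<omega>\<in>space M - N. ?iso \<omega>" using N(1) by blast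
    ultimately show ?jump using N(3) by (intro bexI[of _ "space M - N"] conjI) auto
  qed
  \<comment> \<open>The two conditions are compared outcome by outcome, where the process is regular
    and the rational directions coalesce and have no ties.\<close>
  have "AE \<omega> in M. ?iso \<omega> \<longleftrightarrow> ?coal \<omega>"
    using AE_regular AE_rational_coalescence AE_rational_no_ties
  proof eventually_elim
    case (elim \<omega>)
    interpret busemann_function "?b \<omega>" "\<lambda>x. w x \<omega>"
      by (rule busemann_function_if_regular[OF elim(1)])
    have coal: "?coal \<omega> \<longleftrightarrow> (\<forall>u \<sigma> x y. 0 < u \<and> u < 1 \<longrightarrow> meets (tie_step \<sigma> (?b \<omega> (dir_at u) \<sigma>)) x y)"
      unfolding coalesce_iff_meets ri_dirs_eq by auto
    show ?case
    proof
      assume iso: "?iso \<omega>"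
      have "meets (tie_step \<sigma> (?b \<omega> (dir_at u) \<sigma>)) x y" if "0 < u" "u < 1" for u \<sigma> x y
        by (rule coalescence_if_isolated[OF _ _ that]) (use iso elim(2) in auto)
      then show "?coal \<omega>" unfolding coal by blast
    next
      assume "?coal \<omega>"
      then have "meets (tie_step \<sigma> (?b \<omega> (dir_at u) \<sigma>)) x y" if "0 < u" "u < 1" for u \<sigma> x y
        unfolding coal using that by blast
      then show "?iso \<omega>" using isolated_if_coalescence elim(3) by auto
    qed
  qed
  then have "(AE \<omega> in M. ?iso \<omega>) \<longleftrightarrow> (AE \<omega> in M. ?coal \<omega>)"
    by (rule eventually_subst)
  then show ?thesis unfolding jump .
qed

end
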